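(* Let $d\ge2$, let $D=\{0,\dots,d\}$, let $\mathcal T$ be the $(d+1)$-regular rooted tree with a fixed legal edge colouring by $D$, and let $F\le\operatorname{Sym}(D)$ be any subgroup. The commutator subgroup $D(\mathcal N_F)$ of $\mathcal N_F=\mathcal F(U(F))$ is open and has finite index. More precisely, the homomorphism $V_F/D(V_F)\to\mathcal N_F/D(\mathcal N_F)$, $\varphi D(V_F)\mapsto\varphi D(\mathcal N_F)$, is surjective, where $D(V_F)$ denotes the commutator subgroup of $V_F$.
   Context: Tree and colouring: $\mathcal T=(\mathcal V,\mathcal E)$ is the $(d+1)$-regular tree with root $v_0$; edges are directed, with origin $o(e)$, terminus $t(e)$ and inverse $\bar e$. A legal edge colouring is a map $\operatorname{col}:\mathcal E\to D$ with $\operatorname{col}(e)=\operatorname{col}(\bar e)$ and such that for each vertex $v$ the restriction of $\operatorname{col}$ to $o^{-1}(v)$ is a bijection onto $D$. For $g\in\operatorname{Aut}(\mathcal T)$, $\operatorname{prm}_{g,v}(\chi)=\operatorname{col}\big(g((\operatorname{col}|_{o^{-1}(v)})^{-1}(\chi))\big)$, and $U(F)=\{g\in\operatorname{Aut}(\mathcal T)\mid\operatorname{prm}_{g,v}\in F\ \forall v\in\mathcal V\}$. $\operatorname{Aut}(\mathcal T)$ has the topology with neighbourhood basis of the identity the pointwise fixators of finite sets of vertices and edges; $U(F)$ has the subspace topology. Almost automorphisms: the children of a vertex $v$ are its neighbours farther from $v_0$, and $\mathcal T_v$ is the subtree of all $w$ such that $v$ lies on the geodesic from $v_0$ to $w$.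 A finite subtree $T$ is complete if it contains $v_0$ and, for every vertex of $T$ that is not a leaf, all its children lie in $T$; a leaf of $T$ is a vertex with no child in $T$, and $\mathcal LT$ is the set of leaves. Put $\mathcal T\setminus T:=\bigsqcup_{v\in\mathcal LT}\mathcal T_v$. An honest almost automorphism is a forest isomorphism $\varphi:\mathcal T\setminus T_1\to\mathcal T\setminus T_2$ with $T_1,T_2$ finite complete; two of them with domains $\mathcal T\setminus T_1,\mathcal T\setminus T_1'$ are equivalent if they agree on $\mathcal T\setminus T$ for some finite complete $T\supset T_1\cup T_1'$. Classes form a group $\operatorname{AAut}(\mathcal T)$ under composition of suitable representatives, containing $\operatorname{Aut}(\mathcal T)$. $\varphi$ is $U(F)$-honest if for every $v\in\mathcal LT_1$ there is $g_v\in U(F)$ with $\varphi|_{\mathcal T_v}=g_v|_{\mathcal T_v}$; $\mathcal N_F=\mathcal F(U(F))$ is the subgroup of classes of $U(F)$-honest almost automorphisms, with the unique group topology for which the inclusion $U(F)\hookrightarrow\mathcal N_F$ is continuous and open. The group $V_F$: let $D^{(0)},\dots,D^{(l)}$ be the $F$-orbits in $D$. For $v\ne v_0$ let $e_v$ be the parent edge of $v$ (joining $v$ to its parent), and let $\ell_F(v)$ be the $F$-orbit of $\operatorname{col}(e_v)$. Choose reference colours $\chi^{(i)}\in D^{(i)}$, and for each $\chi\in D^{(i)}$ an element $f_\chi\in F$ with $f_\chi(\chi)=\chi^{(i)}$, where $f_{\chi^{(i)}}=\mathrm{id}$. Order the children of $v_0$ by the colour of their parent edge; for $v\ne v_0$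 with $\operatorname{col}(e_v)=\chi$ order the children of $v$ by $v_1<_vv_2$ iff $f_\chi(\operatorname{col}(e_{v_1}))<f_\chi(\operatorname{col}(e_{v_2}))$. An honest almost automorphism $\varphi:\mathcal T\setminus T_1\to\mathcal T\setminus T_2$ is label-preserving if it maps the children of every vertex $v$ of $\mathcal T\setminus T_1$ order-preservingly to the children of $\varphi(v)$ and $\ell_F(v)=\ell_F(\varphi(v))$ for all $v\in\mathcal LT_1$ (the latter being void if $T_1=T_2=\{v_0\}$). $V_F\le\mathcal N_F$ is the subgroup of all almost automorphisms having a label-preserving representative. *)

theory Defs
  imports "HOL-Algebra.Bij" "HOL-Algebra.Generated_Groups" "HOL-Analysis.Function_Topology"
    "HOL-Analysis.Product_Topology"
begin

section \<open>Trees\<close>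

text \<open>A graph is given by its vertex set \<open>V\<close> and its set \<open>E\<close> of directed edges. The edge
  \<open>(x, y)\<close> has origin \<open>x\<close>, terminus \<open>y\<close> and inverse \<open>(y, x)\<close>; trees have no multiple edges,
  so an edge is determined by its origin and terminus.\<close>

definition simple_path :: "'v set \<Rightarrow> ('v \<times> 'v) set \<Rightarrow> 'v \<Rightarrow> 'v \<Rightarrow> 'v list \<Rightarrow> bool" where
  "simple_path V E x y p \<longleftrightarrow>
     p \<noteq> [] \<and> hd p = x \<and> last p = y \<and> set p \<subseteq> V \<and> distinct p \<and>
     successively (\<lambda>a b. (a, b) \<in> E) p"

definition is_tree :: "'v set \<Rightarrow> ('v \<times> 'v) set \<Rightarrow> bool" where
  "is_tree V E \<longleftrightarrow>
     V \<noteq> {} \<and> E \<subseteq> V \<times> V \<and> sym E \<and> irrefl E \<and> (\<forall>x\<in>V. \<forall>y\<in>V. \<exists>!p. simple_path V E x y p)"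

definition geodesic :: "'v set \<Rightarrow> ('v \<times> 'v) set \<Rightarrow> 'v \<Rightarrow> 'v \<Rightarrow> 'v list" where
  "geodesic V E x y = (THE p. simple_path V E x y p)"

definition tree_dist :: "'v set \<Rightarrow> ('v \<times> 'v) set \<Rightarrow> 'v \<Rightarrow> 'v \<Rightarrow> nat" where
  "tree_dist V E x y = length (geodesic V E x y) - 1"


section \<open>Group topologies\<close>

definition group_topology :: "('a, 'b) monoid_scheme \<Rightarrow> 'a topology \<Rightarrow> bool" where
  "group_topology G \<tau> \<longleftrightarrow>
     topspace \<tau> = carrier G \<and>
     continuous_map (prod_topology \<tau> \<tau>) \<tau> (\<lambda>(x, y). x \<otimes>\<^bsub>G\<^esub> y) \<and>
     continuous_map \<tau> \<tau> (\<lambda>x. inv\<^bsub>G\<^esub> x)"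


section \<open>Almost automorphisms of a legally coloured regular rooted tree\<close>

text \<open>A triple \<open>(T\<^sub>1, T\<^sub>2, \<phi>)\<close> stands for a map \<open>\<phi>\<close> from \<open>\<T> - T\<^sub>1\<close> to \<open>\<T> - T\<^sub>2\<close>, where \<open>\<phi>\<close> acts on
  vertices. Maps are extensional (\<open>undefined\<close> outside their domain), so that equal
  maps are equal functions.\<close>

type_synonym 'v forest_map = "'v set \<times> 'v set \<times> ('v \<Rightarrow> 'v)"

locale legally_coloured_tree =
  fixes V :: "'v set" and E :: "('v \<times> 'v) set" and v0 :: 'v and d :: nat
    and col :: "'v \<times> 'v \<Rightarrow> nat"
  assumes tree: "is_tree V E"
    and root: "v0 \<in> V"
    and regular: "\<And>v. v \<in> V \<Longrightarrow> card {w. (v, w) \<in> E} = d + 1"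
    and col_colour: "\<And>e. e \<in> E \<Longrightarrow> col e \<in> {0..d}"
    and col_inverse: "\<And>x y. (x, y) \<in> E \<Longrightarrow> col (x, y) = col (y, x)"
    and col_bij: "\<And>v. v \<in> V \<Longrightarrow> bij_betw col {e \<in> E. fst e = v} {0..d}"
begin

subsection \<open>\<open>Aut(\<T>)\<close> and \<open>U(F)\<close>\<close>

definition Aut :: "('v \<Rightarrow> 'v) monoid" where
  "Aut = (BijGroup V)
     \<lparr>carrier := {g \<in> Bij V. \<forall>x\<in>V. \<forall>y\<in>V. (x, y) \<in> E \<longleftrightarrow> (g x, g y) \<in> E}\<rparr>"

definition fixator :: "'v set \<Rightarrow> ('v \<times> 'v) set \<Rightarrow> ('v \<Rightarrow> 'v) set" where
  "fixator A B = {g \<in> carrier Aut. (\<forall>x\<in>A. g x = x) \<and> (\<forall>e\<in>B. map_prod g g e = e)}"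

text \<open>Fixators of finite sets form a filter base of subgroups, so their left translates form a
  basis of the group topology in which they are a neighbourhood basis of the identity.\<close>

definition Aut_topology :: "('v \<Rightarrow> 'v) topology" where
  "Aut_topology = topology_generated_by
     {g <#\<^bsub>Aut\<^esub> fixator A B | g A B.
        g \<in> carrier Aut \<and> A \<subseteq> V \<and> finite A \<and> B \<subseteq> E \<and> finite B}"

definition prm :: "('v \<Rightarrow> 'v) \<Rightarrow> 'v \<Rightarrow> nat \<Rightarrow> nat" where
  "prm g v = (\<lambda>\<chi>\<in>{0..d}. col (map_prod g g (inv_into {e \<in> E. fst e = v} col \<chi>)))"

definition UF :: "(nat \<Rightarrow> nat) set \<Rightarrow> ('v \<Rightarrow> 'v) set" where
  "UF F = {g \<in> carrier Aut. \<forall>v\<in>V. prm g v \<in> F}"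

definition UF_topology :: "(nat \<Rightarrow> nat) set \<Rightarrow> ('v \<Rightarrow> 'v) topology" where
  "UF_topology F = subtopology Aut_topology (UF F)"


subsection \<open>Finite complete subtrees\<close>

definition children :: "'v \<Rightarrow> 'v set" where
  "children v = {w. (v, w) \<in> E \<and> tree_dist V E v0 v < tree_dist V E v0 w}"

definition parent :: "'v \<Rightarrow> 'v" where
  "parent v = (THE u. v \<in> children u)"

definition subtree_at :: "'v \<Rightarrow> 'v set" where
  "subtree_at v = {w \<in> V. v \<in> set (geodesic V E v0 w)}"

definition leaves :: "'v set \<Rightarrow> 'v set" where
  "leaves T = {v \<in> T. children v \<inter> T = {}}"

definition finite_complete :: "'v set \<Rightarrow> bool" where
  "finite_complete T \<longleftrightarrow>
     finite T \<and> T \<subseteq> V \<and> is_tree T (E \<inter> T \<times> T) \<and> v0 \<in> T \<and>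
     (\<forall>v\<in>T - leaves T. children v \<subseteq> T)"

text \<open>The vertex set of the forest \<open>\<T> - T\<close>; note that it contains the leaves of \<open>T\<close>. The trees
  at distinct leaves are disjoint and not joined by edges, so the forest is the subgraph
  induced on this set.\<close>

definition outside :: "'v set \<Rightarrow> 'v set" where
  "outside T = (\<Union>v\<in>leaves T. subtree_at v)"


subsection \<open>The group \<open>AAut(\<T>)\<close>\<close>

definition honest :: "'v forest_map set" where
  "honest = {(T1, T2, \<phi>).
     finite_complete T1 \<and> finite_complete T2 \<and>
     \<phi> \<in> extensional (outside T1) \<and> bij_betw \<phi> (outside T1) (outside T2) \<and>
     (\<forall>x\<in>outside T1. \<forall>y\<in>outside T1. (x, y) \<in> E \<longleftrightarrow> (\<phi> x, \<phi> y) \<in> E)}"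

definition almost_eq :: "('v forest_map \<times> 'v forest_map) set" where
  "almost_eq = {((T1, T2, \<phi>), (T1', T2', \<phi>')).
     (T1, T2, \<phi>) \<in> honest \<and> (T1', T2', \<phi>') \<in> honest \<and>
     (\<exists>T. finite_complete T \<and> T1 \<union> T1' \<subseteq> T \<and> (\<forall>x\<in>outside T. \<phi> x = \<phi>' x))}"

text \<open>The product of two classes \<open>A\<close> and \<open>B\<close> is the class of \<open>\<phi> \<circ> \<psi>\<close> for representatives
  \<open>\<phi>\<close> of \<open>A\<close> and \<open>\<psi>\<close> of \<open>B\<close> such that the range of \<open>\<psi>\<close> is the domain of \<open>\<phi>\<close>.\<close>

definition AAut :: "'v forest_map set monoid" where
  "AAut =
     \<lparr>carrier = honest // almost_eq,
      mult = (\<lambda>A B. almost_eq `` {(T1, T3, compose (outside T1) \<phi> \<psi>) | T1 T2 T3 \<phi> \<psi>.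
                (T2, T3, \<phi>) \<in> A \<and> (T1, T2, \<psi>) \<in> B}),
      one = almost_eq `` {({v0}, {v0}, \<lambda>x\<in>V. x)}\<rparr>"

definition Aut_incl :: "('v \<Rightarrow> 'v) \<Rightarrow> 'v forest_map set" where
  "Aut_incl g = almost_eq `` {({v0}, {v0}, g)}"


subsection \<open>The group \<open>\<N>\<^sub>F\<close> and its topology\<close>

definition UF_honest :: "(nat \<Rightarrow> nat) set \<Rightarrow> 'v forest_map set" where
  "UF_honest F = {(T1, T2, \<phi>) \<in> honest.
     \<forall>v\<in>leaves T1. \<exists>g\<in>UF F. \<forall>w\<in>subtree_at v. \<phi> w = g w}"

definition NF :: "(nat \<Rightarrow> nat) set \<Rightarrow> 'v forest_map set monoid" where
  "NF F = AAut\<lparr>carrier := {A \<in> carrier AAut. \<exists>a\<in>A. a \<in> UF_honest F}\<rparr>"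

definition NF_topology :: "(nat \<Rightarrow> nat) set \<Rightarrow> 'v forest_map set topology \<Rightarrow> bool" where
  "NF_topology F \<tau> \<longleftrightarrow>
     group_topology (NF F) \<tau> \<and>
     continuous_map (UF_topology F) \<tau> Aut_incl \<and> open_map (UF_topology F) \<tau> Aut_incl"


subsection \<open>The group \<open>V\<^sub>F\<close>\<close>

definition colour_orbit :: "(nat \<Rightarrow> nat) set \<Rightarrow> nat \<Rightarrow> nat set" where
  "colour_orbit F \<chi> = {p \<chi> | p. p \<in> F}"

definition parent_colour :: "'v \<Rightarrow> nat" where
  "parent_colour v = col (v, parent v)"

definition label :: "(nat \<Rightarrow> nat) set \<Rightarrow> 'v \<Rightarrow> nat set" where
  "label F v = colour_orbit F (parent_colour v)"

text \<open>\<open>r O\<close> is the reference colour of the orbit \<open>O\<close>, and \<open>f \<chi> \<in> F\<close> carries \<open>\<chi>\<close> to the reference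
  colour of its orbit.\<close>

definition reference_choice ::
    "(nat \<Rightarrow> nat) set \<Rightarrow> (nat set \<Rightarrow> nat) \<Rightarrow> (nat \<Rightarrow> nat \<Rightarrow> nat) \<Rightarrow> bool" where
  "reference_choice F r f \<longleftrightarrow>
     (\<forall>\<chi>\<in>{0..d}.
        r (colour_orbit F \<chi>) \<in> colour_orbit F \<chi> \<and>
        f \<chi> \<in> F \<and> f \<chi> \<chi> = r (colour_orbit F \<chi>) \<and>
        f (r (colour_orbit F \<chi>)) = (\<lambda>\<eta>\<in>{0..d}. \<eta>))"

definition child_less :: "(nat \<Rightarrow> nat \<Rightarrow> nat) \<Rightarrow> 'v \<Rightarrow> 'v \<Rightarrow> 'v \<Rightarrow> bool" where
  "child_less f v v1 v2 \<longleftrightarrow>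
     (if v = v0 then parent_colour v1 < parent_colour v2
      else f (parent_colour v) (parent_colour v1) < f (parent_colour v) (parent_colour v2))"

definition label_preserving ::
    "(nat \<Rightarrow> nat) set \<Rightarrow> (nat \<Rightarrow> nat \<Rightarrow> nat) \<Rightarrow> 'v forest_map set" where
  "label_preserving F f = {(T1, T2, \<phi>) \<in> honest.
     (\<forall>v\<in>outside T1. \<phi> ` children v = children (\<phi> v) \<and>
        (\<forall>v1\<in>children v. \<forall>v2\<in>children v.
           child_less f v v1 v2 \<longrightarrow> child_less f (\<phi> v) (\<phi> v1) (\<phi> v2))) \<and>
     (T1 = {v0} \<and> T2 = {v0} \<or> (\<forall>v\<in>leaves T1. label F v = label F (\<phi> v)))}"

definition VF ::
    "(nat \<Rightarrow> nat) set \<Rightarrow> (nat \<Rightarrow> nat \<Rightarrow> nat) \<Rightarrow> 'v forest_map set monoid" where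
  "VF F f = (NF F)\<lparr>carrier := {A \<in> carrier AAut. \<exists>a\<in>A. a \<in> label_preserving F f}\<rparr>"

end


section \<open>Commutator subgroups\<close>

abbreviation commutator_subgroup :: "('a, 'b) monoid_scheme \<Rightarrow> 'a set" where
  "commutator_subgroup G \<equiv> derived G (carrier G)"

end

theory Submission
  imports Defs "HOL-Library.Sublist" "HOL-Algebra.FiniteProduct"
begin

text \<open>An almost automorphism is treated as a germ at infinity: a map of the vertices, defined up to
  finitely many values, which is eventually a rooted forest isomorphism. Composition of germs is
  composition of maps, and \<open>\<N>\<^sub>F\<close> consists of the germs whose local actions are eventually in \<open>F\<close>.

  Let \<open>k \<in> U(F)\<close> fix everything outside the branch \<open>B\<close> of colour \<open>c\<close> at \<open>v\<^sub>0\<close>. If \<open>t\<close> is the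
  translation with trivial local actions along the line through \<open>v\<^sub>0\<close> with alternating colours
  \<open>a, b \<noteq> c\<close>, then the sets \<open>t\<^sup>n B\<close> are disjoint, \<open>h = \<Prod>\<^sub>n t\<^sup>n k t\<^sup>-\<^sup>n\<close> lies in \<open>U(F)\<close>, and \<open>k = [h, t]\<close>. Hence the
  fixator of the 1-ball in \<open>U(F)\<close> lies in the commutator subgroup, which is therefore open, and
  modulo commutators an element of \<open>\<N>\<^sub>F\<close> only depends on the bijection it induces between the leaves
  of two finite complete trees. Every such bijection respects labels, so it is also induced by an element of
  \<open>V\<^sub>F\<close>; this is the surjectivity.

  For the finite index, let a swap exchange the branches at two incomparable vertices with the same
  label. Counting leaves of each label shows that the two trees have equally many interior vertices
  of each label, and therefore every leaf bijection is a product of swaps. Swaps are involutions, and moving the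
  two vertices into a fixed branch does not change the class of a swap modulo commutators, so the
  abelianization is generated by finitely many involutions.\<close>

section \<open>Groups, permutations and finite sets\<close>

text \<open>The product \<open>h\<close> keeps its local actions in \<open>F\<close> because the
  translation contributes none: at \<open>(t ^^ n) z\<close> it acts as \<open>k\<close> does at
  \<open>z\<close>, and off the copies it is the identity. The two descriptions meet along the
  single edge leaving each copy, and they agree there because \<open>k\<close> fixes the top vertex
  of its branch; this is why the 1-ball is fixed and not only the root.

  The obstacle with honest representatives is at the leaves. An element of U(F) may turn a branch
  around, sending the parent direction at a vertex to a child direction of the image. Far out this
  is impossible for an almost automorphism: a vertex so treated has a child mapped to the parent of
  its image, that child is treated in the same way, and the images climb until they hit the root,
  which is avoided far out. Hence a deep enough representative sends parent edges to parent edges,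
  and all later arguments use only such representatives.

  The bound \<open>d \<ge> 2\<close> enters twice: it leaves two colours besides \<open>c\<close>
  for the line, and it makes the coefficient positive in the count of \<open>(d - 1) n + 2\<close>
  leaves for \<open>n > 0\<close> interior vertices, so that leaves determine interiors.\<close>

lemma (in group) commutator_in_derived:
  assumes "x \<in> carrier G" "y \<in> carrier G" "z \<in> carrier G" "x \<otimes> y = z \<otimes> (y \<otimes> x)"
  shows "z \<in> derived G (carrier G)"
proof -
  have "z = x \<otimes> y \<otimes> inv (y \<otimes> x)"
    using assms inv_solve_right[of z "x \<otimes> y" "y \<otimes> x"] by simp
  also have "\<dots> = x \<otimes> y \<otimes> inv x \<otimes> inv y"
    using assms(1,2) by (simp add: inv_mult_group m_assoc)
  finally show ?thesis using assms(1,2) unfolding derived_def by (blast intro: generate.incl)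
qed

lemma (in group) open_subgroup:
  assumes \<tau>: "group_topology G \<tau>" and H: "subgroup H G" and U: "openin \<tau> U" "\<one> \<in> U" "U \<subseteq> H"
  shows "openin \<tau> H"
proof (subst openin_subopen, intro ballI)
  fix x assume x: "x \<in> H"
  have ts: "topspace \<tau> = carrier G" and mult: "continuous_map (prod_topology \<tau> \<tau>) \<tau> (\<lambda>(x, y). x \<otimes> y)"
    using \<tau> by (auto simp: group_topology_def)
  have xc: "x \<in> carrier G" using x subgroup.subset[OF H] by blast
  have "continuous_map \<tau> (prod_topology \<tau> \<tau>) (\<lambda>y. (inv x, y))"
    using xc ts by (intro continuous_map_pairedI) auto
  from continuous_map_compose[OF this mult] have "continuous_map \<tau> \<tau> (\<lambda>y. inv x \<otimes> y)"
    by (simp add: comp_def)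
  then have "openin \<tau> {y \<in> topspace \<tau>. inv x \<otimes> y \<in> U}" using U(1) openin_continuous_map_preimage by blast
  moreover have "{y \<in> topspace \<tau>. inv x \<otimes> y \<in> U} \<subseteq> H"
  proof clarify
    fix y assume y: "y \<in> topspace \<tau>" "inv x \<otimes> y \<in> U"
    then have "x \<otimes> (inv x \<otimes> y) \<in> H" using x U H by (blast intro: subgroup.m_closed)
    then show "y \<in> H" using xc y ts by (simp add: m_assoc[symmetric])
  qed
  moreover have "x \<in> {y \<in> topspace \<tau>. inv x \<otimes> y \<in> U}" using xc ts U by simp
  ultimately show "\<exists>T. openin \<tau> T \<and> x \<in> T \<and> T \<subseteq> H" by blast
qed

text \<open>The infinite product of the conjugates of \<open>k\<close> by the powers of \<open>t\<close>.\<close>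

lemma product_of_shifted_copies:
  fixes t k :: "'a \<Rightarrow> 'a"
  assumes inj: "\<And>n m z z'. z \<in> T \<Longrightarrow> z' \<in> T \<Longrightarrow> (t ^^ n) z = (t ^^ m) z' \<Longrightarrow> n = m \<and> z = z'"
  obtains h where "\<And>n z. z \<in> T \<Longrightarrow> h ((t ^^ n) z) = (t ^^ n) (k z)"
    "\<And>y. (\<And>n z. z \<in> T \<Longrightarrow> y \<noteq> (t ^^ n) z) \<Longrightarrow> h y = y"
proof -
  define R where "R y p \<longleftrightarrow> snd p \<in> T \<and> y = (t ^^ fst p) (snd p)" for y p
  \<comment> \<open>The choice is forced on the copies: by \<open>inj\<close> a point has at most
    one representation as \<open>(t ^^ n) z\<close> with \<open>z\<close> in
    \<open>T\<close>.\<close>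
  define h where "h y = (if \<exists>p. R y p then (t ^^ fst (SOME p. R y p)) (k (snd (SOME p. R y p))) else y)" for y
  have "h ((t ^^ n) z) = (t ^^ n) (k z)" if "z \<in> T" for n z
  proof -
    let ?y = "(t ^^ n) z"
    have ex: "R ?y (n, z)" using that by (simp add: R_def)
    have "(SOME p. R ?y p) = (n, z)"
    proof (rule some_equality[of "R ?y"])
      fix p assume "R ?y p"
      then have "n = fst p \<and> z = snd p" using inj[OF that] unfolding R_def by blast
      then show "p = (n, z)" by (simp add: prod_eq_iff)
    qed (rule ex)
    then show ?thesis using ex by (auto simp: h_def)
  qed
  moreover have "h y = y" if "\<And>n z. z \<in> T \<Longrightarrow> y \<noteq> (t ^^ n) z" for y
    using that by (auto simp: h_def R_def)
  ultimately show ?thesis using that by blast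
qed

text \<open>The map multiplies a whole coset by the derived group of \<open>G\<close>, so no
  representative is chosen; it has the stated value because the derived group of \<open>H\<close>
  lies in that of \<open>G\<close>. The covering hypothesis is exactly surjectivity.\<close>

lemma (in group) derived_quotient_epi:
  assumes H: "subgroup H G"
    and cover: "\<And>g. g \<in> carrier G \<Longrightarrow> \<exists>w\<in>H. \<exists>x\<in>derived G (carrier G). g = x \<otimes> w"
  defines "W \<equiv> G\<lparr>carrier := H\<rparr>"
  shows "\<exists>h. h \<in> epi (W Mod derived W (carrier W)) (G Mod derived G (carrier G)) \<and>
    (\<forall>w\<in>carrier W. h (derived W (carrier W) #>\<^bsub>W\<^esub> w) = derived G (carrier G) #> w)"
proof -
  interpret W: group W unfolding W_def by (rule subgroup.subgroup_is_group[OF H is_group])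
  let ?D = "derived G (carrier G)" and ?DW = "derived W (carrier W)"
  have HG: "H \<subseteq> carrier G" using H by (rule subgroup.subset)
  have DW: "?DW = derived G H" using derived_consistent[OF _ H] by (simp add: W_def)
  have sub: "?DW \<subseteq> ?D" unfolding DW by (rule mono_derived[OF HG])
  have D: "subgroup ?D G" by (rule derived_is_subgroup) simp
  have DWs: "subgroup ?DW W" by (rule W.derived_is_subgroup) simp
  interpret ND: normal ?D G by (rule derived_self_is_normal)
  interpret NW: normal ?DW W by (rule W.derived_self_is_normal)
  define h where "h X = ?D <#> X" for X
  have coset: "?DW #>\<^bsub>W\<^esub> w = ?DW #> w" for w by (simp add: W_def r_coset_def)
  have mult: "X <#>\<^bsub>W\<^esub> Y = X <#> Y" for X Y by (simp add: W_def set_mult_def)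
  have DWG: "?DW \<subseteq> carrier G" using sub subgroup.subset[OF D] by blast
  have h: "h (?DW #>\<^bsub>W\<^esub> w) = ?D #> w" if "w \<in> H" for w
  proof -
    have w: "w \<in> carrier G" using that HG by blast
    have "?D <#> (?DW #> w) = (?D <#> ?DW) #> w"
      using setmult_rcos_assoc[OF subgroup.subset[OF D] DWG w] .
    moreover have "?D <#> ?DW = ?D"
    proof
      show "?D <#> ?DW \<subseteq> ?D" using sub subgroup.m_closed[OF D] by (auto simp: set_mult_def)
      have one: "\<one> \<in> ?DW" using subgroup.one_closed[OF DWs] by (simp add: W_def)
      have "x \<otimes> \<one> \<in> ?D <#> ?DW" if "x \<in> ?D" for x
        using that one unfolding set_mult_def by blast
      then show "?D \<subseteq> ?D <#> ?DW" using subgroup.subset[OF D] by auto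
    qed
    ultimately show ?thesis by (simp add: h_def coset)
  qed
  have carr: "carrier (W Mod ?DW) = {?DW #>\<^bsub>W\<^esub> w |w. w \<in> H}"
    by (auto simp: FactGroup_def RCOSETS_def W_def)
  have carr': "carrier (G Mod ?D) = {?D #> g |g. g \<in> carrier G}"
    by (auto simp: FactGroup_def RCOSETS_def)
  have "h \<in> hom (W Mod ?DW) (G Mod ?D)"
  proof (rule homI)
    fix X assume "X \<in> carrier (W Mod ?DW)"
    then obtain w where w: "w \<in> H" "X = ?DW #>\<^bsub>W\<^esub> w" by (auto simp: carr)
    then show "h X \<in> carrier (G Mod ?D)" using h HG by (auto simp: carr')
    fix Y assume "Y \<in> carrier (W Mod ?DW)"
    then obtain v where v: "v \<in> H" "Y = ?DW #>\<^bsub>W\<^esub> v" by (auto simp: carr)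
    have "X <#>\<^bsub>W\<^esub> Y = ?DW #>\<^bsub>W\<^esub> (w \<otimes> v)"
      using NW.rcos_sum[of w v] w v by (simp add: W_def)
    then have "h (X <#>\<^bsub>W\<^esub> Y) = ?D #> (w \<otimes> v)" using h subgroup.m_closed[OF H] w v by simp
    also have "\<dots> = h X <#> h Y" using ND.rcos_sum[of w v] w v h HG by (simp add: subset_iff)
    finally show "h (X \<otimes>\<^bsub>W Mod ?DW\<^esub> Y) = h X \<otimes>\<^bsub>G Mod ?D\<^esub> h Y" by (simp add: FactGroup_def)
  qed
  moreover have "h ` carrier (W Mod ?DW) = carrier (G Mod ?D)"
  proof
    show "h ` carrier (W Mod ?DW) \<subseteq> carrier (G Mod ?D)" using h HG by (auto simp: carr carr')
    show "carrier (G Mod ?D) \<subseteq> h ` carrier (W Mod ?DW)"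
    proof
      fix X assume "X \<in> carrier (G Mod ?D)"
      then obtain g where g: "g \<in> carrier G" "X = ?D #> g" by (auto simp: carr')
      then obtain w x where w: "w \<in> H" "x \<in> ?D" "g = x \<otimes> w" using cover by blast
      then have "?D #> g = (?D #> x) #> w"
        using coset_mult_assoc[of ?D x w] subgroup.subset[OF D] HG by auto
      also have "\<dots> = ?D #> w" using coset_join2[OF _ D w(2)] subgroup.subset[OF D] w(2) by auto
      finally have "X = h (?DW #>\<^bsub>W\<^esub> w)" using g h w by simp
      then show "X \<in> h ` carrier (W Mod ?DW)" using w by (auto simp: carr)
    qed
  qed
  ultimately have "h \<in> epi (W Mod ?DW) (G Mod ?D)" by (simp add: epi_def)
  then show ?thesis using h by (auto simp: W_def)
qed

text \<open>This later forces an order-preserving bijection between children. A least point with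
  \<open>g b < b\<close> would be sent to a smaller such point, so no value drops; then the largest
  moved point would go up to a larger moved point.\<close>

lemma strict_mono_on_self_id:
  fixes g :: "nat \<Rightarrow> nat"
  assumes "finite A" "g ` A \<subseteq> A" "\<And>a b. a \<in> A \<Longrightarrow> b \<in> A \<Longrightarrow> a < b \<Longrightarrow> g a < g b" "a \<in> A"
  shows "g a = a"
proof (rule ccontr)
  assume ne: "g a \<noteq> a"
  define B where "B = {b \<in> A. g b \<noteq> b}"
  have B: "finite B" "B \<noteq> {}" using assms ne by (auto simp: B_def)
  have lo: "\<not> g b < b" if "b \<in> A" for b
    using that
  proof (induction b rule: less_induct)
    case (less b)
    show ?case
    proof
      assume b: "g b < b"
      have "g b \<in> A" using less.prems assms(2) by blast
      then have "g (g b) < g b" using assms(3) b less.prems by blast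
      then show False using less.IH b \<open>g b \<in> A\<close> by blast
    qed
  qed
  let ?m = "Max B"
  have m: "?m \<in> B" using B by simp
  then have "?m < g ?m" "?m \<in> A" "g ?m \<in> A" using lo[of ?m] assms(2) by (auto simp: B_def)
  then have "g ?m \<in> B" using assms(3)[of ?m "g ?m"] by (auto simp: B_def)
  then have "g ?m \<le> ?m" using B by simp
  then show False using \<open>?m < g ?m\<close> by simp
qed

text \<open>The products over subsets of \<open>S\<close> form a finite set, and multiplying by
  \<open>s\<close> only toggles the membership of \<open>s\<close> in the subset, because
  \<open>s\<close> squares to the identity.\<close>

lemma (in comm_group) finite_generate_involutions:
  assumes S: "finite S" "S \<subseteq> carrier G" and inv: "\<And>s. s \<in> S \<Longrightarrow> s \<otimes> s = \<one>"
  shows "finite (generate G S)"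
proof -
  define P where "P = finprod G (\<lambda>s. s) ` Pow S"
  have one: "\<one> \<in> P" unfolding P_def by (rule image_eqI[of _ _ "{}"]) auto
  have PG: "P \<subseteq> carrier G" using S by (auto simp: P_def intro!: finprod_closed)
  have s_P: "s \<otimes> p \<in> P" if s: "s \<in> S" and p: "p \<in> P" for s p
  proof -
    obtain X where X: "X \<subseteq> S" "p = finprod G (\<lambda>s. s) X" using p by (auto simp: P_def)
    have fin: "finite X" "finite (X - {s})" using X S finite_subset by blast+
    have c: "s \<in> carrier G" "X \<subseteq> carrier G" using s X S by auto
    have ins: "finprod G (\<lambda>s. s) (insert s (X - {s})) = s \<otimes> finprod G (\<lambda>s. s) (X - {s})"
      using fin c by (intro finprod_insert) auto
    show ?thesis
    proof (cases "s \<in> X")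
      case True
      then have "insert s (X - {s}) = X" by blast
      then have "s \<otimes> p = (s \<otimes> s) \<otimes> finprod G (\<lambda>s. s) (X - {s})"
        using ins X c by (subst m_assoc) (auto intro!: finprod_closed)
      also have "\<dots> = finprod G (\<lambda>s. s) (X - {s})" using inv s c by (simp, intro l_one finprod_closed) auto
      finally show ?thesis using X by (auto simp: P_def)
    next
      case False
      then have "s \<otimes> p = finprod G (\<lambda>s. s) (insert s X)" using ins X by simp
      then show ?thesis using X s by (auto simp: P_def)
    qed
  qed
  \<comment> \<open>Stability of \<open>P\<close> under left multiplication passes to products of
    generators directly; membership of \<open>h\<close> in \<open>P\<close> then follows by applying
    it to the identity.\<close>
  have "h \<in> carrier G \<and> (\<forall>p\<in>P. h \<otimes> p \<in> P)" if "h \<in> generate G S" for h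
    using that
  proof (induction rule: generate.induct)
    case one
    then show ?case using PG by auto
  next
    case (incl h)
    then show ?case using s_P S by auto
  next
    case (inv h)
    then have "inv h = h" using inv_equality[of h h] \<open>\<And>s. s \<in> S \<Longrightarrow> s \<otimes> s = \<one>\<close> S by auto
    then show ?case using s_P S inv by auto
  next
    case (eng h1 h2)
    then show ?case using PG by (auto simp: m_assoc subset_iff)
  qed
  then have "generate G S \<subseteq> P" using one by (metis r_one subsetI)
  then show ?thesis by (rule finite_subset) (use S in \<open>simp add: P_def\<close>)
qed

context legally_coloured_tree
begin

section \<open>Coding vertices by reduced colour words\<close>

text \<open>The colouring makes the tree the Cayley graph of a free product of \<open>d + 1\<close>
  groups of order two, with \<open>nbr v c\<close> as right multiplication by the generator
  \<open>c\<close>.\<close>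

definition nbr :: "'v \<Rightarrow> nat \<Rightarrow> 'v" where
  "nbr v c = (THE w. (v, w) \<in> E \<and> col (v, w) = c)"

lemma nbr_ex1:
  assumes "v \<in> V" "c \<le> d"
  shows "\<exists>!w. (v, w) \<in> E \<and> col (v, w) = c"
proof -
  have bij: "bij_betw col {e \<in> E. fst e = v} {0..d}" using col_bij[OF assms(1)] .
  then have "c \<in> col ` {e \<in> E. fst e = v}" using assms(2) by (simp add: bij_betw_def)
  then obtain e where e: "e \<in> E" "fst e = v" "col e = c" by blast
  then have "(v, snd e) \<in> E \<and> col (v, snd e) = c" by (metis prod.collapse)
  moreover have "w = w'" if "(v, w) \<in> E \<and> col (v, w) = c" "(v, w') \<in> E \<and> col (v, w') = c" for w w'
    using bij that by (auto simp: bij_betw_def inj_on_def)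
  ultimately show ?thesis by blast
qed

lemma nbr:
  assumes "v \<in> V" "c \<le> d"
  shows "(v, nbr v c) \<in> E" "col (v, nbr v c) = c"
  using theI'[OF nbr_ex1[OF assms]] by (auto simp: nbr_def)

lemma E_in_V: "(x, y) \<in> E \<Longrightarrow> x \<in> V" "(x, y) \<in> E \<Longrightarrow> y \<in> V"
  using tree by (auto simp: is_tree_def)

lemma E_sym: "(x, y) \<in> E \<Longrightarrow> (y, x) \<in> E"
  using tree by (auto simp: is_tree_def dest: symD)

lemma E_irrefl: "(x, x) \<notin> E"
  using tree by (auto simp: is_tree_def irrefl_def)

lemma col_le: "(x, y) \<in> E \<Longrightarrow> col (x, y) \<le> d"
  using col_colour by force

lemma nbr_eqI: "(x, y) \<in> E \<Longrightarrow> col (x, y) = c \<Longrightarrow> nbr x c = y"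
  using nbr_ex1[of x c] nbr[of x c] E_in_V col_le by blast

lemma nbr_in [simp]: "v \<in> V \<Longrightarrow> c \<le> d \<Longrightarrow> nbr v c \<in> V"
  using nbr E_in_V by blast

lemma nbr_nbr [simp]: "v \<in> V \<Longrightarrow> c \<le> d \<Longrightarrow> nbr (nbr v c) c = v"
  using nbr[of v c] by (intro nbr_eqI) (auto dest: E_sym simp: col_inverse[symmetric])

lemma nbr_inj [simp]: "v \<in> V \<Longrightarrow> c \<le> d \<Longrightarrow> c' \<le> d \<Longrightarrow> nbr v c = nbr v c' \<longleftrightarrow> c = c'"
  using nbr by metis

lemma nbr_neq: "v \<in> V \<Longrightarrow> c \<le> d \<Longrightarrow> nbr v c \<noteq> v"
  using nbr E_irrefl by metis

lemma E_iff: "(x, y) \<in> E \<longleftrightarrow> x \<in> V \<and> (\<exists>c\<le>d. y = nbr x c)"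
  using nbr nbr_eqI E_in_V col_le by metis

text \<open>These are the normal forms of the free product: repeating a colour walks back along the
  edge just used.\<close>

definition reduced :: "nat list \<Rightarrow> bool" where
  "reduced u \<longleftrightarrow> set u \<subseteq> {0..d} \<and> successively (\<noteq>) u"

abbreviation walk :: "'v \<Rightarrow> nat list \<Rightarrow> 'v" where
  "walk \<equiv> foldl nbr"

lemma walk_in: "v \<in> V \<Longrightarrow> set u \<subseteq> {0..d} \<Longrightarrow> walk v u \<in> V"
  by (induction u arbitrary: v) auto

lemma reduced_Nil [simp]: "reduced []"
  by (simp add: reduced_def)

lemma reduced_append:
  "reduced (u @ w) \<longleftrightarrow> reduced u \<and> reduced w \<and> (u \<noteq> [] \<longrightarrow> w \<noteq> [] \<longrightarrow> last u \<noteq> hd w)"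
  by (auto simp: reduced_def successively_append_iff)

lemma reduced_single [simp]: "reduced [c] \<longleftrightarrow> c \<le> d"
  by (auto simp: reduced_def)

lemma reduced_snoc: "reduced (u @ [c]) \<longleftrightarrow> reduced u \<and> c \<le> d \<and> (u \<noteq> [] \<longrightarrow> last u \<noteq> c)"
  by (simp add: reduced_append)

lemma reduced_Cons: "reduced (c # u) \<longleftrightarrow> reduced u \<and> c \<le> d \<and> (u \<noteq> [] \<longrightarrow> hd u \<noteq> c)"
  using reduced_append[of "[c]" u] by auto

lemma reduced_set: "reduced u \<Longrightarrow> c \<in> set u \<Longrightarrow> c \<le> d"
  by (auto simp: reduced_def)

lemma walk_reduced_in: "v \<in> V \<Longrightarrow> reduced u \<Longrightarrow> walk v u \<in> V"
  by (rule walk_in) (auto simp: reduced_def)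

lemma simple_path_unique:
  assumes "simple_path V E x y p" "simple_path V E x y q"
  shows "p = q"
proof -
  have "x \<in> V" "y \<in> V" using assms(1) by (auto simp: simple_path_def)
  moreover have "\<forall>x\<in>V. \<forall>y\<in>V. \<exists>!p. simple_path V E x y p" using tree by (simp add: is_tree_def)
  ultimately show ?thesis using assms by blast
qed

text \<open>If the last step revisits the vertex reached by a prefix \<open>q\<close>, the rest of
  the word is a closed reduced walk based there. For nonempty \<open>q\<close> it is shorter than
  \<open>u\<close>, so the induction, which covers all base points, excludes it.\<close>

lemma simple_path_walk:
  assumes "v \<in> V" "reduced u"
  shows "simple_path V E v (walk v u) (map (walk v) (prefixes u))"
  using assms
proof (induction "length u" arbitrary: v u rule: less_induct)
  case less
  show ?case
  proof (cases u rule: rev_cases)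
    case Nil
    then show ?thesis using less.prems by (simp add: simple_path_def)
  next
    case (snoc s c)
    have s: "reduced s" "c \<le> d" "s \<noteq> [] \<Longrightarrow> last s \<noteq> c"
      using less.prems snoc by (auto simp: reduced_snoc)
    let ?y = "walk v s"
    let ?p = "map (walk v) (prefixes s)"
    have sp: "simple_path V E v ?y ?p" using less.hyps[of s v] snoc s less.prems by auto
    have yV: "?y \<in> V" using walk_reduced_in less.prems(1) s by auto
    have E: "(?y, nbr ?y c) \<in> E" using nbr yV s by auto
    have "nbr ?y c \<notin> set ?p"
    proof
      assume "nbr ?y c \<in> set ?p"
      then obtain q where q: "prefix q s" "nbr ?y c = walk v q" by auto
      then obtain t where t: "s = q @ t" by (auto simp: prefix_def)
      let ?z = "walk v q"
      have z: "?z \<in> V" using walk_reduced_in less.prems(1) s t by (auto simp: reduced_append)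
      have cyc: "walk ?z (t @ [c]) = ?z" using q t by simp
      have tc: "reduced (t @ [c])" using less.prems(2) snoc t by (simp add: reduced_append)
      show False
      proof (cases "q = []")
        case False
        then have "length (t @ [c]) < length u" using snoc t by simp
        then have "simple_path V E ?z (walk ?z (t @ [c])) (map (walk ?z) (prefixes (t @ [c])))"
          using less.hyps z tc by blast
        then have "distinct (map (walk ?z) (prefixes t) @ [walk ?z (t @ [c])])"
          by (simp add: simple_path_def)
        moreover have "walk ?z [] \<in> set (map (walk ?z) (prefixes t))"
          by (metis image_eqI in_set_prefixes Nil_prefix list.set_map)
        ultimately show False using cyc by simp
      next
        case True
        \<comment> \<open>Here the whole walk closes up at \<open>v\<close>, so its last edge joins
          \<open>v\<close> to \<open>?y\<close>. Uniqueness of simple paths then gives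
          \<open>s\<close> a single letter, which must equal \<open>c\<close>, against
          reducedness.\<close>
        then have ts: "t = s" and bk: "nbr ?y c = v" using t q by auto
        have "s \<noteq> []" using bk nbr_neq less.prems s by auto
        have e2: "(v, ?y) \<in> E" using E bk E_sym by auto
        then have "simple_path V E v ?y [v, ?y]"
          using less.prems yV E_irrefl by (auto simp: simple_path_def)
        then have "?p = [v, ?y]" using simple_path_unique sp by blast
        then have "length (prefixes s) = 2" by (metis length_map length_Cons list.size(3) One_nat_def Suc_1)
        then obtain e where "s = [e]" by (auto simp: length_Suc_conv)
        then show False using bk s less.prems by (metis foldl_Cons foldl_Nil last.simps nbr_nbr nbr_inj nbr_in reduced_single)
      qed
    qed
    moreover have "prefixes u = prefixes s @ [u]" using snoc by simp
    moreover have "walk v u = nbr ?y c" using snoc by simp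
    ultimately show ?thesis
      using sp E yV E_in_V
      by (auto simp: simple_path_def successively_append_iff)
  qed
qed

lemma map_walk_prefixes_Cons:
  "map (walk v) (prefixes (c # u)) = v # map (walk (nbr v c)) (prefixes u)"
  by (simp add: comp_def)

lemma hd_map_walk_prefixes: "hd (map (walk v) (prefixes u)) = v"
  by (cases u) auto

lemma map_walk_inj:
  assumes "v \<in> V" "reduced u" "reduced u'"
    and "map (walk v) (prefixes u) = map (walk v) (prefixes u')"
  shows "u = u'"
  using assms
proof (induction u arbitrary: v u')
  case Nil
  then have "length (prefixes u') = 1" by (metis length_map length_prefixes list.size(3) add_0)
  then show ?case by simp
next
  case (Cons c u)
  then have "length (prefixes u') = length (prefixes (c # u))" by (metis length_map)
  then obtain c' w where u': "u' = c' # w" by (cases u') auto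
  have eq: "map (walk (nbr v c)) (prefixes u) = map (walk (nbr v c')) (prefixes w)"
    using Cons.prems(4) unfolding u' map_walk_prefixes_Cons by simp
  then have "nbr v c = nbr v c'" using hd_map_walk_prefixes by metis
  then have "c = c'" using Cons.prems u' by (simp add: reduced_Cons)
  then show ?case using Cons.IH[of "nbr v c" w] Cons.prems u' eq by (auto simp: reduced_Cons)
qed

lemma walk_inj:
  assumes "v \<in> V" "reduced u" "reduced u'" "walk v u = walk v u'"
  shows "u = u'"
  using map_walk_inj[OF assms(1-3)] simple_path_unique simple_path_walk assms by metis

lemma path_is_walk:
  assumes "p \<noteq> []" "set p \<subseteq> V" "distinct p" "successively (\<lambda>a b. (a, b) \<in> E) p"
  shows "\<exists>u. reduced u \<and> map (walk (hd p)) (prefixes u) = p"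
  using assms
proof (induction p)
  case Nil
  then show ?case by simp
next
  case (Cons v p)
  show ?case
  proof (cases p)
    case Nil
    then show ?thesis by (intro exI[of _ "[]"]) simp
  next
    case (Cons v' ps)
    obtain u where u: "reduced u" "map (walk v') (prefixes u) = p"
      using Cons.IH Cons.prems Cons by auto
    let ?c = "col (v, v')"
    have e: "(v, v') \<in> E" using Cons.prems Cons by auto
    have n: "nbr v ?c = v'" "nbr v' ?c = v" "?c \<le> d"
      using nbr_eqI e E_sym col_inverse col_le by metis+
    have "hd u \<noteq> ?c" if ne: "u \<noteq> []"
    proof
      assume "hd u = ?c"
      then obtain u2 where u2: "u = ?c # u2" using ne by (cases u) auto
      then have "walk v' [?c] \<in> set (map (walk v') (prefixes u))" by (metis Cons_prefix_Cons Nil_prefix image_eqI in_set_prefixes list.set_map)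
      then have "v \<in> set p" using n u by simp
      then show False using Cons.prems by simp
    qed
    then have "reduced (?c # u)" using u n by (simp add: reduced_Cons)
    moreover have "map (walk v) (prefixes (?c # u)) = v # p"
      unfolding map_walk_prefixes_Cons using n u by simp
    ultimately show ?thesis by (metis list.sel(1))
  qed
qed

lemma walk_surj:
  assumes "v \<in> V" "w \<in> V"
  shows "\<exists>u. reduced u \<and> walk v u = w"
proof -
  have "\<forall>x\<in>V. \<forall>y\<in>V. \<exists>!p. simple_path V E x y p" using tree by (simp add: is_tree_def)
  then obtain p where p: "simple_path V E v w p" using assms by blast
  then obtain u where u: "reduced u" "map (walk v) (prefixes u) = p"
    using path_is_walk[of p] by (auto simp: simple_path_def)
  have "last p = walk v u" using u by (metis last_map last_prefixes prefixes_not_Nil)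
  then show ?thesis using p u by (auto simp: simple_path_def)
qed

text \<open>With codes the rooted tree becomes a tree of words: depth is length and descent is the
  prefix order, so facts about geodesics reduce to facts about lists.\<close>

definition code :: "'v \<Rightarrow> nat list" where
  "code v = (THE u. reduced u \<and> walk v0 u = v)"

lemma code_ex1: "v \<in> V \<Longrightarrow> \<exists>!u. reduced u \<and> walk v0 u = v"
  using walk_surj[OF root] walk_inj[OF root] by blast

lemma code [simp]:
  assumes "v \<in> V" shows "reduced (code v)" "walk v0 (code v) = v"
  using theI'[OF code_ex1[OF assms]] by (auto simp: code_def)

lemma code_walk [simp]: "reduced u \<Longrightarrow> code (walk v0 u) = u"
  using walk_inj[OF root] walk_reduced_in[OF root] code by blast

lemma code_inj: "v \<in> V \<Longrightarrow> w \<in> V \<Longrightarrow> code v = code w \<Longrightarrow> v = w"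
  using code by metis

lemma code_root [simp]: "code v0 = []"
  using code_walk[of "[]"] by simp

lemma code_Nil_iff: "v \<in> V \<Longrightarrow> code v = [] \<longleftrightarrow> v = v0"
  using code_inj root by fastforce

section \<open>Depth, children and parents in terms of codes\<close>

lemma geodesic_root: "x \<in> V \<Longrightarrow> geodesic V E v0 x = map (walk v0) (prefixes (code x))"
  unfolding geodesic_def
  using simple_path_walk[OF root, of "code x"] simple_path_unique by (intro the_equality) auto

lemma tree_dist_root: "x \<in> V \<Longrightarrow> tree_dist V E v0 x = length (code x)"
  by (simp add: tree_dist_def geodesic_root)

text \<open>The root is treated separately because its code is empty and \<open>last []\<close> is
  unspecified.\<close>

definition child_colours :: "'v \<Rightarrow> nat set" where
  "child_colours v = {c. c \<le> d \<and> (v = v0 \<or> c \<noteq> last (code v))}"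

lemma child_coloursD: "c \<in> child_colours v \<Longrightarrow> c \<le> d"
  by (simp add: child_colours_def)

lemma last_code_le: "v \<in> V \<Longrightarrow> v \<noteq> v0 \<Longrightarrow> last (code v) \<le> d"
  by (metis code(1) code_Nil_iff last_in_set reduced_set)

lemma finite_child_colours [simp]: "finite (child_colours v)"
  by (rule finite_subset[of _ "{0..d}"]) (auto simp: child_colours_def)

lemma code_child: "v \<in> V \<Longrightarrow> c \<in> child_colours v \<Longrightarrow> code (nbr v c) = code v @ [c]"
  using code_walk[of "code v @ [c]"] code_Nil_iff[of v]
  by (auto simp: child_colours_def reduced_snoc)

lemma child_neq_root: "v \<in> V \<Longrightarrow> c \<in> child_colours v \<Longrightarrow> nbr v c \<noteq> v0"
  by (metis code_child code_root append_is_Nil_conv not_Cons_self2)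

lemma code_parent: "v \<in> V \<Longrightarrow> v \<noteq> v0 \<Longrightarrow> code (nbr v (last (code v))) = butlast (code v)"
proof -
  assume v: "v \<in> V" "v \<noteq> v0"
  then obtain u c where u: "code v = u @ [c]" by (metis code_Nil_iff rev_exhaust)
  then have r: "reduced u" "c \<le> d" using code(1)[OF v(1)] by (auto simp: reduced_snoc)
  have "v = nbr (walk v0 u) c" using u code(2)[OF v(1)] by simp
  then have "nbr v c = walk v0 u" using r walk_reduced_in[OF root] by simp
  then show ?thesis using u r by simp
qed

lemma parent_step:
  assumes "v \<in> V" "v \<noteq> v0"
  obtains u where "u \<in> V" "last (code v) \<in> child_colours u" "v = nbr u (last (code v))"
    "u = nbr v (last (code v))" "code u = butlast (code v)"
proof -
  let ?c = "last (code v)"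
  let ?u = "nbr v ?c"
  have c: "?c \<le> d" using last_code_le assms by auto
  have u: "?u \<in> V" "v = nbr ?u ?c" using assms c by auto
  have cu: "code v = code ?u @ [?c]"
    using code_parent[OF assms] code_Nil_iff assms by simp
  then have "?u = v0 \<or> ?c \<noteq> last (code ?u)"
    using code(1)[OF assms(1)] u code_Nil_iff[of ?u] by (metis reduced_snoc)
  then have "?c \<in> child_colours ?u" using c by (simp add: child_colours_def)
  then show ?thesis using that u code_parent assms by blast
qed

lemma children_eq:
  assumes "v \<in> V" shows "children v = nbr v ` child_colours v"
proof
  show "nbr v ` child_colours v \<subseteq> children v"
    using assms nbr by (auto simp: children_def tree_dist_root code_child child_coloursD)
  show "children v \<subseteq> nbr v ` child_colours v"
  proof
    fix w assume w: "w \<in> children v"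
    then obtain c where c: "c \<le> d" "w = nbr v c" by (auto simp: children_def E_iff)
    have "c \<in> child_colours v"
    proof (rule ccontr)
      assume "c \<notin> child_colours v"
      then have "v \<noteq> v0" "c = last (code v)" using c by (auto simp: child_colours_def)
      then have "length (code w) \<le> length (code v)" using code_parent assms c by simp
      then show False using w assms c by (simp add: children_def tree_dist_root)
    qed
    then show "w \<in> nbr v ` child_colours v" using c by auto
  qed
qed

lemma in_childrenD: "w \<in> children v \<Longrightarrow> v \<in> V \<and> w \<in> V"
  by (auto simp: children_def dest: E_in_V)

lemma child_unique_parent:
  assumes "u \<in> V" "c \<in> child_colours u" "u' \<in> V" "c' \<in> child_colours u'" "nbr u c = nbr u' c'"
  shows "u = u' \<and> c = c'"
  using assms code_child code_inj by (metis butlast_snoc last_snoc)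

lemma parent_nbr:
  assumes "v \<in> V" "c \<in> child_colours v"
  shows "parent (nbr v c) = v"
  unfolding parent_def
proof (rule the_equality)
  show "nbr v c \<in> children v" using assms by (simp add: children_eq)
  fix u assume u: "nbr v c \<in> children u"
  then have uV: "u \<in> V" using in_childrenD by blast
  then obtain c' where "c' \<in> child_colours u" "nbr v c = nbr u c'" using u children_eq by blast
  then show "u = v" using child_unique_parent uV assms by metis
qed

lemma parent_colour_nbr: "v \<in> V \<Longrightarrow> c \<in> child_colours v \<Longrightarrow> parent_colour (nbr v c) = c"
  using nbr[of v c] E_sym col_inverse by (simp add: parent_colour_def parent_nbr child_coloursD)

lemma parent_colour_eq: "v \<in> V \<Longrightarrow> v \<noteq> v0 \<Longrightarrow> parent_colour v = last (code v)"
  using parent_step parent_colour_nbr by metis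

lemma parent_props:
  assumes "v \<in> V" "v \<noteq> v0"
  shows "parent v \<in> V" "parent_colour v \<in> child_colours (parent v)"
    "nbr (parent v) (parent_colour v) = v" "nbr v (parent_colour v) = parent v"
    "code v = code (parent v) @ [parent_colour v]" "parent_colour v \<le> d"
proof -
  obtain u where u: "u \<in> V" "last (code v) \<in> child_colours u" "v = nbr u (last (code v))"
    "u = nbr v (last (code v))" "code u = butlast (code v)"
    using parent_step assms by metis
  have p: "parent v = u" "parent_colour v = last (code v)"
    using parent_nbr parent_colour_eq u assms by metis+
  show "parent v \<in> V" "parent_colour v \<in> child_colours (parent v)"
    "nbr (parent v) (parent_colour v) = v" "nbr v (parent_colour v) = parent v"
    "code v = code (parent v) @ [parent_colour v]" "parent_colour v \<le> d"
    using p u last_code_le assms code_Nil_iff by auto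
qed

lemma child_colours_eq:
  "v \<in> V \<Longrightarrow> child_colours v = (if v = v0 then {0..d} else {0..d} - {parent_colour v})"
  by (auto simp: child_colours_def parent_colour_eq)

lemma vertex_induct [consumes 1, case_names root child]:
  assumes "x \<in> V" "P v0" "\<And>v c. v \<in> V \<Longrightarrow> P v \<Longrightarrow> c \<in> child_colours v \<Longrightarrow> P (nbr v c)"
  shows "P x"
  using assms(1)
proof (induction "length (code x)" arbitrary: x rule: less_induct)
  case less
  show ?case
  proof (cases "x = v0")
    case False
    then show ?thesis
      using parent_props[OF less.prems False] less.hyps[of "parent x"] assms(3)[of "parent x" "parent_colour x"]
      by auto
  qed (use assms in simp)
qed

section \<open>Branches and the order of descent\<close>

lemma subtree_at_eq:
  assumes "v \<in> V" shows "subtree_at v = {w \<in> V. prefix (code v) (code w)}"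
proof -
  have "v \<in> walk v0 ` set (prefixes (code w)) \<longleftrightarrow> prefix (code v) (code w)" if "w \<in> V" for w
  proof
    assume "v \<in> walk v0 ` set (prefixes (code w))"
    then obtain q where q: "prefix q (code w)" "v = walk v0 q" by auto
    then have "reduced q" using code(1)[OF that] by (auto simp: prefix_def reduced_append)
    then show "prefix (code v) (code w)" using q by simp
  qed (use assms in \<open>auto intro!: image_eqI[of _ _ "code v"]\<close>)
  then show ?thesis by (auto simp: subtree_at_def geodesic_root)
qed

lemma subtree_atD: "w \<in> subtree_at v \<Longrightarrow> w \<in> V"
  by (simp add: subtree_at_def)

lemma subtree_at_self [simp]: "v \<in> V \<Longrightarrow> v \<in> subtree_at v"
  by (simp add: subtree_at_eq)

lemma subtree_at_child_iff:
  assumes "v \<in> V" "x \<in> V" "c \<in> child_colours x"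
  shows "nbr x c \<in> subtree_at v \<longleftrightarrow> nbr x c = v \<or> x \<in> subtree_at v"
  using assms code_inj[of v "nbr x c"]
  by (auto simp: subtree_at_eq code_child child_coloursD)

lemma subtree_at_antisym: "v \<in> V \<Longrightarrow> w \<in> subtree_at v \<Longrightarrow> v \<in> subtree_at w \<Longrightarrow> v = w"
  using subtree_atD[of w v] by (auto simp: subtree_at_eq intro: code_inj dest: prefix_order.antisym)

lemma subtree_at_comparable:
  "v \<in> V \<Longrightarrow> w \<in> V \<Longrightarrow> x \<in> subtree_at v \<Longrightarrow> x \<in> subtree_at w \<Longrightarrow> w \<in> subtree_at v \<or> v \<in> subtree_at w"
  by (auto simp: subtree_at_eq dest: prefix_same_cases)

lemma root_in_subtree_at: "v \<in> V \<Longrightarrow> v0 \<in> subtree_at v \<longleftrightarrow> v = v0"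
  using root by (auto simp: subtree_at_eq code_Nil_iff)

lemma subtree_at_parent:
  "v \<in> V \<Longrightarrow> x \<in> subtree_at v \<Longrightarrow> x \<noteq> v \<Longrightarrow> x \<noteq> v0 \<and> parent x \<in> subtree_at v"
  using parent_props[of x] subtree_at_child_iff[of v "parent x" "parent_colour x"]
    root_in_subtree_at subtree_atD by metis

lemma subtree_induct [consumes 2, case_names base child]:
  assumes "v \<in> V" "x \<in> subtree_at v" "P v"
    and "\<And>x c. x \<in> subtree_at v \<Longrightarrow> P x \<Longrightarrow> c \<in> child_colours x \<Longrightarrow> P (nbr x c)"
  shows "P x"
proof -
  have "x \<in> subtree_at v \<longrightarrow> P x" using subtree_atD[OF assms(2)]
  proof (induction rule: vertex_induct)
    case root
    then show ?case using assms(1,3) root_in_subtree_at by auto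
  next
    case (child y c)
    then show ?case using assms subtree_at_child_iff[of v y c] by auto
  qed
  then show ?thesis using assms(2) by blast
qed


section \<open>Automorphisms from local data\<close>

lemma nbr_closed_eq_V:
  assumes "S \<subseteq> V" "y \<in> S" "\<And>x c. x \<in> S \<Longrightarrow> c \<le> d \<Longrightarrow> nbr x c \<in> S"
  shows "S = V"
proof -
  have "walk y u \<in> S" if "set u \<subseteq> {0..d}" for u
    using that by (induction u rule: rev_induct) (auto simp: assms)
  moreover have "\<exists>u. reduced u \<and> walk y u = w" if "w \<in> V" for w
    using walk_surj assms that by blast
  ultimately show ?thesis using assms(1) by (metis reduced_def subsetI subset_antisym)
qed

text \<open>A locally bijective map of the tree to itself is a covering, and a tree has no
  nontrivial connected covering. Concretely, a reduced word from \<open>x\<close> to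
  \<open>y\<close> is carried to a reduced word of the same length from \<open>g x\<close> to
  \<open>g y\<close>, which cannot close up unless it is empty.\<close>

lemma locally_bij_imp_bij:
  assumes gV: "\<And>x. x \<in> V \<Longrightarrow> g x \<in> V"
    and bij: "\<And>x. x \<in> V \<Longrightarrow> bij_betw (p x) {0..d} {0..d}"
    and loc: "\<And>x c. x \<in> V \<Longrightarrow> c \<le> d \<Longrightarrow> g (nbr x c) = nbr (g x) (p x c)"
  shows "bij_betw g V V"
proof -
  have p: "p x c \<le> d" if "x \<in> V" "c \<le> d" for x c
    using bij[OF that(1)] that(2) by (auto dest: bij_betwE)
  have pinj: "p x c = p x c' \<longleftrightarrow> c = c'" if "x \<in> V" "c \<le> d" "c' \<le> d" for x c c'
    using bij[OF that(1)] that(2,3) by (auto simp: bij_betw_def inj_on_def)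
  \<comment> \<open>Both ends of an edge give its colour the same image. This is what keeps lifted
    words reduced.\<close>
  have edge: "p (nbr x c) c = p x c" if "x \<in> V" "c \<le> d" for x c
  proof -
    have "nbr (g (nbr x c)) (p (nbr x c) c) = g x" using loc[of "nbr x c" c] that by simp
    moreover have "nbr (g (nbr x c)) (p x c) = g x" using loc[of x c] that gV p by simp
    ultimately show ?thesis using that gV p by (metis nbr_inj nbr_in)
  qed
  have lift: "\<exists>u'. reduced u' \<and> length u' = length u \<and> walk (g x) u' = g (walk x u) \<and>
      (u \<noteq> [] \<longrightarrow> hd u' = p x (hd u))" if "x \<in> V" "reduced u" for x u
    using that
  proof (induction u arbitrary: x)
    case Nil
    then show ?case by (intro exI[of _ "[]"]) auto
  next
    case (Cons c u)
    have c: "reduced u" "c \<le> d" "u \<noteq> [] \<Longrightarrow> hd u \<noteq> c" using Cons.prems by (auto simp: reduced_Cons)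
    let ?x = "nbr x c"
    obtain u' where u': "reduced u'" "length u' = length u" "walk (g ?x) u' = g (walk ?x u)"
      "u \<noteq> [] \<longrightarrow> hd u' = p ?x (hd u)"
      using Cons.IH[of ?x] Cons.prems c by auto
    have "hd u' \<noteq> p x c" if "u' \<noteq> []"
    proof -
      have ne: "u \<noteq> []" using that u' by auto
      then have "hd u \<le> d" using c(1) by (metis hd_in_set reduced_set)
      then show ?thesis using u' ne c edge[of x c] pinj[of ?x "hd u" c] Cons.prems by auto
    qed
    then have "reduced (p x c # u')" using u' p c Cons.prems by (auto simp: reduced_Cons)
    then show ?case using u' loc[of x c] Cons.prems c by (intro exI[of _ "p x c # u'"]) auto
  qed
  have "inj_on g V"
  proof (rule inj_onI)
    fix x y assume xy: "x \<in> V" "y \<in> V" "g x = g y"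
    obtain u where u: "reduced u" "walk x u = y" using walk_surj xy by blast
    obtain u' where u': "reduced u'" "length u' = length u" "walk (g x) u' = g y"
      using lift[OF xy(1) u(1)] u by auto
    then have "u' = []" using walk_inj[of "g x" u' "[]"] gV xy by simp
    then show "x = y" using u u' by simp
  qed
  moreover have "g ` V = V"
  proof (rule nbr_closed_eq_V)
    show "g ` V \<subseteq> V" using gV by auto
    show "g v0 \<in> g ` V" using root by auto
    fix y c assume y: "y \<in> g ` V" "c \<le> d"
    then obtain x where x: "x \<in> V" "y = g x" by auto
    have "c \<in> p x ` {0..d}" using bij[OF x(1)] y(2) by (simp add: bij_betw_def)
    then obtain c' where "c' \<le> d" "p x c' = c" by auto
    then show "nbr y c \<in> g ` V" using x loc[of x c'] by (metis image_eqI nbr_in)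
  qed
  ultimately show ?thesis by (simp add: bij_betw_def)
qed

text \<open>The permutation \<open>\<sigma> x y\<close> prescribes the local action at \<open>x\<close> once \<open>x\<close> has been sent to \<open>y\<close>;
  the consistency condition is only needed for steps away from the root.\<close>

lemma local_data_extends:
  fixes \<sigma> :: "'v \<Rightarrow> 'v \<Rightarrow> nat \<Rightarrow> nat" and P :: "'v \<Rightarrow> 'v \<Rightarrow> bool"
  assumes "y0 \<in> V" "P v0 y0"
    and bij: "\<And>x y. x \<in> V \<Longrightarrow> y \<in> V \<Longrightarrow> P x y \<Longrightarrow> bij_betw (\<sigma> x y) {0..d} {0..d}"
    and step: "\<And>x y c. x \<in> V \<Longrightarrow> y \<in> V \<Longrightarrow> P x y \<Longrightarrow> c \<in> child_colours x \<Longrightarrow>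
       P (nbr x c) (nbr y (\<sigma> x y c)) \<and> \<sigma> (nbr x c) (nbr y (\<sigma> x y c)) c = \<sigma> x y c"
  obtains g where "bij_betw g V V" "g v0 = y0" "\<And>x. x \<in> V \<Longrightarrow> P x (g x)"
    "\<And>x c. x \<in> V \<Longrightarrow> c \<le> d \<Longrightarrow> g (nbr x c) = nbr (g x) (\<sigma> x (g x) c)"
proof -
  \<comment> \<open>The fold carries source and target along the code together, since the next step
    of the target depends on both.\<close>
  define G where "G = foldl (\<lambda>(x, y) c. (nbr x c, nbr y (\<sigma> x y c))) (v0, y0)"
  have G_fst: "fst (G u) = walk v0 u" for u
    by (induction u rule: rev_induct) (auto simp: G_def split: prod.splits)
  have G_snoc: "snd (G (u @ [c])) = nbr (snd (G u)) (\<sigma> (walk v0 u) (snd (G u)) c)" for u c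
    using G_fst[of u] by (auto simp: G_def split: prod.splits)
  define g where "g x = snd (G (code x))" for x
  have g0: "g v0 = y0" by (simp add: g_def G_def)
  have child: "g (nbr x c) = nbr (g x) (\<sigma> x (g x) c)" if "x \<in> V" "c \<in> child_colours x" for x c
    using that by (simp add: g_def code_child G_snoc)
  have gP: "g x \<in> V \<and> P x (g x)" if "x \<in> V" for x
    using that
  proof (induction rule: vertex_induct)
    case root
    then show ?case using g0 assms by simp
  next
    case (child x c)
    then have "\<sigma> x (g x) c \<le> d"
      using bij[of x "g x"] by (auto dest!: bij_betwE child_coloursD)
    then show ?case using child.IH child.hyps step[of x "g x" c] \<open>\<And>x c. \<lbrakk>x \<in> V; c \<in> child_colours x\<rbrakk> \<Longrightarrow> g (nbr x c) = _\<close>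
      by simp
  qed
  have loc: "g (nbr x c) = nbr (g x) (\<sigma> x (g x) c)" if x: "x \<in> V" and c: "c \<le> d" for x c
  proof (cases "c \<in> child_colours x")
    case True
    then show ?thesis using child x by simp
  next
    case False
    \<comment> \<open>The only edge left leads to the parent. The consistency condition at the
      parent says that \<open>c\<close> has the same image at both ends, so the step in the target
      leads back to \<open>g ?u\<close>.\<close>
    then have ne: "x \<noteq> v0" and pc: "c = parent_colour x" using x c by (auto simp: child_colours_eq split: if_splits)
    let ?u = "parent x"
    have u: "?u \<in> V" "c \<in> child_colours ?u" "nbr ?u c = x" "nbr x c = ?u"
      using parent_props[OF x ne] pc by auto
    have gx: "g x = nbr (g ?u) (\<sigma> ?u (g ?u) c)" using child[OF u(1,2)] u by simp
    have "\<sigma> x (g x) c = \<sigma> ?u (g ?u) c" using step[of ?u "g ?u" c] gP[of ?u] u gx by simp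
    moreover have "\<sigma> ?u (g ?u) c \<le> d" using bij[of ?u "g ?u"] gP[of ?u] u c by (auto dest!: bij_betwE)
    ultimately show ?thesis using gx u gP[of ?u] by simp
  qed
  have "bij_betw g V V"
    using locally_bij_imp_bij[of g "\<lambda>x. \<sigma> x (g x)"] gP bij loc by blast
  then show ?thesis using that g0 gP loc by blast
qed

lemma walk_rev: "v \<in> V \<Longrightarrow> set u \<subseteq> {0..d} \<Longrightarrow> walk (walk v (rev u)) u = v"
proof (induction u arbitrary: v)
  case (Cons c u)
  then show ?case using walk_in[of v "rev u"] by simp
qed simp

lemma walk_colour_preserving:
  assumes "\<And>x c. x \<in> V \<Longrightarrow> c \<le> d \<Longrightarrow> t (nbr x c) = nbr (t x) c" "v \<in> V" "set u \<subseteq> {0..d}"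
  shows "t (walk v u) = walk (t v) u"
  using assms(2,3) by (induction u arbitrary: v) (auto simp: assms(1))

text \<open>These are the left translations of the free product. The image of the root is found by
  walking back from \<open>b\<close> along the reversed code of \<open>a\<close>.\<close>

lemma translation_exists:
  assumes "a \<in> V" "b \<in> V"
  obtains t where "bij_betw t V V" "t a = b" "\<And>x c. x \<in> V \<Longrightarrow> c \<le> d \<Longrightarrow> t (nbr x c) = nbr (t x) c"
proof -
  let ?y = "walk b (rev (code a))"
  have ca: "set (code a) \<subseteq> {0..d}" using code(1)[OF assms(1)] by (simp add: reduced_def)
  have "?y \<in> V" using walk_in[of b "rev (code a)"] assms ca by simp
  then obtain t where t: "bij_betw t V V" "t v0 = ?y"
    "\<And>x c. x \<in> V \<Longrightarrow> c \<le> d \<Longrightarrow> t (nbr x c) = nbr (t x) c"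
    using local_data_extends[of ?y "\<lambda>_ _. True" "\<lambda>_ _ c. c"] by (auto simp: bij_betw_def)
  have "t a = b"
    using walk_colour_preserving[of t v0 "code a"] t root ca walk_rev[of b "code a"] assms by simp
  then show ?thesis using that t by blast
qed

text \<open>The map is built from the root and then composed with a translation to send
  \<open>a\<close> to \<open>b\<close>; translations preserve colours and so leave the prescribed
  local actions unchanged.\<close>

lemma local_action_extends:
  assumes "a \<in> V" "b \<in> V"
    and bij: "\<And>x. x \<in> V \<Longrightarrow> bij_betw (\<sigma> x) {0..d} {0..d}"
    and step: "\<And>x c. x \<in> V \<Longrightarrow> c \<in> child_colours x \<Longrightarrow> \<sigma> (nbr x c) c = \<sigma> x c"
  obtains g where "bij_betw g V V" "g a = b" "\<And>x c. x \<in> V \<Longrightarrow> c \<le> d \<Longrightarrow> g (nbr x c) = nbr (g x) (\<sigma> x c)"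
proof -
  obtain g where g: "bij_betw g V V" "\<And>x c. x \<in> V \<Longrightarrow> c \<le> d \<Longrightarrow> g (nbr x c) = nbr (g x) (\<sigma> x c)"
    using local_data_extends[of v0 "\<lambda>_ _. True" "\<lambda>x _. \<sigma> x"] root bij step by (metis (full_types))
  have gV: "g x \<in> V" if "x \<in> V" for x using g(1) that by (auto dest: bij_betwE)
  obtain t where t: "bij_betw t V V" "t (g a) = b" "\<And>x c. x \<in> V \<Longrightarrow> c \<le> d \<Longrightarrow> t (nbr x c) = nbr (t x) c"
    using translation_exists gV assms by metis
  have "\<sigma> x c \<le> d" if "x \<in> V" "c \<le> d" for x c using bij[OF that(1)] that by (auto dest: bij_betwE)
  then have "(t \<circ> g) (nbr x c) = nbr ((t \<circ> g) x) (\<sigma> x c)" if "x \<in> V" "c \<le> d" for x c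
    using g t gV that by simp
  then show ?thesis using that[of "t \<circ> g"] t g bij_betw_trans by fastforce
qed

section \<open>Finite complete subtrees and their interiors\<close>

text \<open>A finite complete subtree \<open>T\<close> is encoded by the set \<open>J = T - \<L>T\<close> of its interior vertices, which is an
  arbitrary finite set closed under taking parents. Then \<open>\<L>T = border J\<close>, \<open>T = J \<union> border J\<close> and
  \<open>\<T> - T\<close> has the vertex set \<open>V - J\<close>; the tree \<open>{v\<^sub>0}\<close> corresponds to \<open>J = {}\<close>.\<close>

definition root_closed :: "'v set \<Rightarrow> bool" where
  "root_closed J \<longleftrightarrow> finite J \<and> J \<subseteq> V \<and> (\<forall>x\<in>J. x \<noteq> v0 \<longrightarrow> parent x \<in> J)"

definition border :: "'v set \<Rightarrow> 'v set" where
  "border J = {v \<in> V - J. v = v0 \<or> parent v \<in> J}"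

lemma root_closedD:
  "root_closed J \<Longrightarrow> finite J" "root_closed J \<Longrightarrow> J \<subseteq> V"
  "root_closed J \<Longrightarrow> x \<in> J \<Longrightarrow> x \<noteq> v0 \<Longrightarrow> parent x \<in> J"
  by (auto simp: root_closed_def)

lemma root_closed_Un: "root_closed I \<Longrightarrow> root_closed J \<Longrightarrow> root_closed (I \<union> J)"
  by (auto simp: root_closed_def)

lemma root_closed_subtree:
  assumes "root_closed J" "v \<in> V" "x \<in> subtree_at v" "x \<in> J"
  shows "v \<in> J"
proof -
  have "x \<in> J \<longrightarrow> v \<in> J" using assms(2,3)
  proof (induction rule: subtree_induct)
    case (child x c)
    then have "parent (nbr x c) = x" "nbr x c \<noteq> v0"
      using parent_nbr[of x c] child_neq_root[of x c] subtree_atD by auto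
    then show ?case using child root_closedD[OF assms(1)] by metis
  qed simp
  then show ?thesis using assms by simp
qed

lemma border_finite: "root_closed J \<Longrightarrow> finite (border J)"
proof -
  assume J: "root_closed J"
  have "border J \<subseteq> insert v0 (\<Union>x\<in>J. nbr x ` {0..d})"
  proof
    fix v assume v: "v \<in> border J"
    then have "v = v0 \<or> (parent v \<in> J \<and> v = nbr (parent v) (parent_colour v) \<and> parent_colour v \<le> d)"
      using parent_props[of v] by (auto simp: border_def)
    then show "v \<in> insert v0 (\<Union>x\<in>J. nbr x ` {0..d})" by (metis UN_iff atLeastAtMost_iff imageI insert_iff zero_le)
  qed
  then show ?thesis by (rule finite_subset) (use J root_closedD in auto)
qed

lemma border_exists:
  assumes "root_closed J" "x \<in> V - J"
  shows "\<exists>v\<in>border J. x \<in> subtree_at v"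
proof -
  have root_in_V: "v0 \<in> V" by (rule root)
  have "x \<in> V" using assms by simp
  then have "x \<notin> J \<longrightarrow> (\<exists>v\<in>border J. x \<in> subtree_at v)"
  proof (induction rule: vertex_induct)
    case root
    then show ?case using root_in_V by (auto simp: border_def)
  next
    case (child x c)
    have x': "nbr x c \<in> V" "parent (nbr x c) = x" using child child_coloursD parent_nbr by auto
    show ?case
    proof (intro impI)
      assume n: "nbr x c \<notin> J"
      show "\<exists>v\<in>border J. nbr x c \<in> subtree_at v"
      proof (cases "x \<in> J")
        case True
        then have "nbr x c \<in> border J" using x' n by (simp add: border_def)
        then show ?thesis using x' subtree_at_self by blast
      next
        case False
        then obtain v where v: "v \<in> border J" "x \<in> subtree_at v" using child by blast
        then have "v \<in> V" by (auto simp: border_def)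
        then show ?thesis using v child subtree_at_child_iff[of v x c] by auto
      qed
    qed
  qed
  then show ?thesis using assms by simp
qed

lemma border_subtree_outside:
  "root_closed J \<Longrightarrow> v \<in> border J \<Longrightarrow> x \<in> subtree_at v \<Longrightarrow> x \<in> V - J"
  using root_closed_subtree subtree_atD by (auto simp: border_def)

lemma simple_path_extend:
  assumes "simple_path S R x y p" "(y, z) \<in> R" "z \<in> S"
  shows "\<exists>q. simple_path S R x z q"
proof (cases "z \<in> set p")
  case True
  then obtain a b where p: "p = a @ z # b" by (auto dest: split_list)
  have "simple_path S R x z (a @ [z])"
    using assms(1) unfolding p simple_path_def successively_append_iff by (cases a) auto
  then show ?thesis by blast
next
  case False
  have "simple_path S R x z (p @ [z])"
    using assms False unfolding simple_path_def by (auto simp: successively_append_iff)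
  then show ?thesis by blast
qed

text \<open>Paths exist by going up to the root and down again inside \<open>T\<close>; their
  uniqueness is inherited from the whole tree.\<close>

lemma root_closed_is_tree:
  assumes T: "root_closed T" "v0 \<in> T"
  shows "is_tree T (E \<inter> T \<times> T)"
proof -
  let ?E = "E \<inter> T \<times> T"
  have TV: "T \<subseteq> V" using T root_closedD by blast
  have up: "(x, v0) \<in> ?E\<^sup>* \<and> (v0, x) \<in> ?E\<^sup>*" if "x \<in> T" for x
  proof -
    have "x \<in> V" using that TV by auto
    then have "x \<in> T \<longrightarrow> (x, v0) \<in> ?E\<^sup>* \<and> (v0, x) \<in> ?E\<^sup>*"
    proof (induction rule: vertex_induct)
      case (child x c)
      have c: "parent (nbr x c) = x" "nbr x c \<noteq> v0" "(x, nbr x c) \<in> E" "(nbr x c, x) \<in> E"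
        using child parent_nbr child_neq_root nbr(1)[of x c] E_sym child_coloursD by auto
      show ?case
      proof
        assume n: "nbr x c \<in> T"
        then have x: "x \<in> T" using c root_closedD[OF T(1)] by metis
        then have "(x, nbr x c) \<in> ?E" "(nbr x c, x) \<in> ?E" using c n by auto
        then show "(nbr x c, v0) \<in> ?E\<^sup>* \<and> (v0, nbr x c) \<in> ?E\<^sup>*"
          using child x by (meson converse_rtrancl_into_rtrancl rtrancl_into_rtrancl)
      qed
    qed simp
    then show ?thesis using that by simp
  qed
  have ex: "\<exists>p. simple_path T ?E x y p" if "x \<in> T" "y \<in> T" for x y
  proof -
    have "(x, y) \<in> ?E\<^sup>*" using up that by (meson rtrancl_trans)
    then show ?thesis
    proof induction
      case base
      show ?case using that by (intro exI[of _ "[x]"]) (simp add: simple_path_def)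
    next
      case (step y z)
      then show ?case using simple_path_extend by fastforce
    qed
  qed
  have "simple_path V E x y p" if "simple_path T ?E x y p" for x y p
    using that TV unfolding simple_path_def by (auto elim: successively_mono)
  then have "\<exists>!p. simple_path T ?E x y p" if "x \<in> T" "y \<in> T" for x y
    using ex[OF that] simple_path_unique by metis
  moreover have "sym ?E" "irrefl ?E" using E_sym E_irrefl by (auto simp: sym_def irrefl_def)
  ultimately show ?thesis using T(2) by (auto simp: is_tree_def)
qed

text \<open>The simple path from the root inside \<open>T\<close> is also the one in the whole tree,
  and that one passes through the parent.\<close>

lemma finite_complete_root_closed:
  assumes "finite_complete T" shows "root_closed T"
proof -
  have T: "finite T" "T \<subseteq> V" "is_tree T (E \<inter> T \<times> T)" "v0 \<in> T"
    using assms by (auto simp: finite_complete_def)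
  have "parent x \<in> T" if "x \<in> T" "x \<noteq> v0" for x
  proof -
    have "\<forall>x\<in>T. \<forall>y\<in>T. \<exists>!p. simple_path T (E \<inter> T \<times> T) x y p" using T by (simp add: is_tree_def)
    then have "\<exists>!p. simple_path T (E \<inter> T \<times> T) v0 x p" using T(4) that(1) by simp
    then obtain p where p: "simple_path T (E \<inter> T \<times> T) v0 x p" by (elim ex1E)
    then have "simple_path V E v0 x p"
      using T(2) unfolding simple_path_def by (auto elim: successively_mono)
    moreover have x: "x \<in> V" using that T by auto
    ultimately have "p = map (walk v0) (prefixes (code x))"
      using simple_path_walk[OF root, of "code x"] simple_path_unique by auto
    moreover have "code x = code (parent x) @ [parent_colour x]" "parent x \<in> V"
      using parent_props[OF x that(2)] by auto
    ultimately have "parent x \<in> set p" by (auto intro!: image_eqI[of _ _ "code (parent x)"])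
    then show ?thesis using p by (auto simp: simple_path_def)
  qed
  then show ?thesis using T by (simp add: root_closed_def)
qed

lemma child_iff_parent: "w \<in> children v \<longleftrightarrow> v \<in> V \<and> w \<in> V \<and> w \<noteq> v0 \<and> parent w = v"
proof
  assume w: "w \<in> children v"
  then have v: "v \<in> V" using in_childrenD by blast
  then obtain c where c: "c \<in> child_colours v" "w = nbr v c" using w children_eq by blast
  then show "v \<in> V \<and> w \<in> V \<and> w \<noteq> v0 \<and> parent w = v"
    using v parent_nbr child_neq_root child_coloursD by simp
next
  assume w: "v \<in> V \<and> w \<in> V \<and> w \<noteq> v0 \<and> parent w = v"
  then have "parent_colour w \<in> child_colours v" "nbr v (parent_colour w) = w"
    using parent_props[of w] by auto
  then show "w \<in> children v" using w by (metis children_eq imageI)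
qed

lemma honestD:
  assumes "(T1, T2, \<phi>) \<in> honest"
  shows "finite_complete T1" "finite_complete T2" "\<phi> \<in> extensional (outside T1)"
    "bij_betw \<phi> (outside T1) (outside T2)"
    "\<And>x y. x \<in> outside T1 \<Longrightarrow> y \<in> outside T1 \<Longrightarrow> (x, y) \<in> E \<longleftrightarrow> (\<phi> x, \<phi> y) \<in> E"
  using assms by (auto simp: honest_def)

end

locale coloured_neretin = legally_coloured_tree V E v0 d col
  for V :: "'v set" and E :: "('v \<times> 'v) set" and v0 :: 'v and d :: nat and col :: "'v \<times> 'v \<Rightarrow> nat" +
  fixes F :: "(nat \<Rightarrow> nat) set"
  assumes d2: "d \<ge> 2" and F_subgroup: "subgroup F (BijGroup {0..d})"
begin

lemma F_Bij: "p \<in> F \<Longrightarrow> p \<in> Bij {0..d}"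
  using subgroup.subset[OF F_subgroup] by (auto simp: BijGroup_def)

lemma F_bij: "p \<in> F \<Longrightarrow> bij_betw p {0..d} {0..d}"
  using F_Bij by (auto simp: Bij_def)

lemma F_le: "p \<in> F \<Longrightarrow> c \<le> d \<Longrightarrow> p c \<le> d"
  using bij_betwE[OF F_bij] by force

lemma F_inj: "p \<in> F \<Longrightarrow> c \<le> d \<Longrightarrow> c' \<le> d \<Longrightarrow> p c = p c' \<longleftrightarrow> c = c'"
  using F_bij[of p] by (auto simp: bij_betw_def inj_on_def)

lemma F_id: "(\<lambda>c\<in>{0..d}. c) \<in> F"
  using subgroup.one_closed[OF F_subgroup] by (simp add: BijGroup_def)

lemma F_comp: "p \<in> F \<Longrightarrow> q \<in> F \<Longrightarrow> compose {0..d} p q \<in> F"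
  using subgroup.m_closed[OF F_subgroup, of p q] F_Bij by (auto simp: BijGroup_def)

lemma F_inv:
  assumes "p \<in> F" obtains q where "q \<in> F" "\<And>c. c \<le> d \<Longrightarrow> q (p c) = c" "\<And>c. c \<le> d \<Longrightarrow> p (q c) = c"
proof -
  let ?G = "BijGroup {0..d}"
  let ?q = "inv\<^bsub>?G\<^esub> p"
  have c: "p \<in> carrier ?G" "?q \<in> carrier ?G" and q: "?q \<in> F"
    using assms subgroup.subset[OF F_subgroup] subgroup.m_inv_closed[OF F_subgroup] by auto
  have "compose {0..d} ?q p = (\<lambda>c\<in>{0..d}. c)" "compose {0..d} p ?q = (\<lambda>c\<in>{0..d}. c)"
    using group.l_inv[OF group_BijGroup c(1)] group.r_inv[OF group_BijGroup c(1)] c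
    by (simp_all add: BijGroup_def)
  then have "?q (p c) = c" "p (?q c) = c" if "c \<le> d" for c
    using that by (metis atLeastAtMost_iff compose_eq restrict_apply' zero_le)+
  then show ?thesis using that q by blast
qed

text \<open>Among the colours 0, 1, 2 at most two are excluded. This provides branches at the root
  that avoid one or two given ones.\<close>

lemma third_colour: "\<exists>c\<le>d. c \<noteq> a \<and> c \<noteq> b"
proof -
  have "a \<noteq> 0 \<and> b \<noteq> 0 \<or> a \<noteq> 1 \<and> b \<noteq> 1 \<or> a \<noteq> 2 \<and> b \<noteq> 2" by auto
  then show ?thesis using d2 by (metis le0 le_trans one_le_numeral)
qed

lemma child_colours_nonempty: "v \<in> V \<Longrightarrow> child_colours v \<noteq> {}"
proof -
  assume v: "v \<in> V"
  have "(if parent_colour v = 0 then 1 else 0) \<in> {0..d} - {parent_colour v}" using d2 by auto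
  then show ?thesis using v by (auto simp: child_colours_eq split: if_splits)
qed

section \<open>Finite complete trees versus their interiors\<close>

lemma closure_finite_complete:
  assumes J: "root_closed J"
  shows "finite_complete (J \<union> border J)" "leaves (J \<union> border J) = border J"
    "outside (J \<union> border J) = V - J"
proof -
  let ?T = "J \<union> border J"
  have rc: "root_closed ?T"
    using J border_finite[OF J] by (auto simp: root_closed_def border_def)
  have v0: "v0 \<in> ?T" using root by (auto simp: border_def)
  have sub: "children v \<subseteq> ?T" if "v \<in> J" for v
    using that by (auto simp: child_iff_parent border_def)
  \<comment> \<open>A vertex without children would count as a leaf, so the interior could not be
    read off from the tree.\<close>
  have ne: "children v \<noteq> {}" if "v \<in> J" for v
    using that root_closedD[OF J] child_colours_nonempty by (auto simp: children_eq)
  have disj: "children v \<inter> ?T = {}" if "v \<in> border J" for v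
  proof -
    have "v \<notin> J" using that by (simp add: border_def)
    then have "w \<notin> ?T" if "w \<in> children v" for w
      using that root_closedD(3)[OF J, of w] by (auto simp: child_iff_parent border_def)
    then show ?thesis by blast
  qed
  show l: "leaves ?T = border J"
  proof
    show "leaves ?T \<subseteq> border J" using sub ne unfolding leaves_def by blast
    show "border J \<subseteq> leaves ?T" using disj by (auto simp: leaves_def)
  qed
  show "finite_complete ?T"
    unfolding finite_complete_def l
    using root_closedD(1,2)[OF rc] v0 root_closed_is_tree[OF rc v0] sub by blast
  show "outside ?T = V - J"
    unfolding outside_def l using border_exists[OF J] border_subtree_outside[OF J] by blast
qed

lemma finite_complete_is_closure:
  assumes T: "finite_complete T"
  obtains J where "root_closed J" "T = J \<union> border J"
proof -
  let ?J = "T - leaves T"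
  have rc: "root_closed T" using finite_complete_root_closed[OF T] .
  have v0: "v0 \<in> T" and ch: "\<And>v. v \<in> ?J \<Longrightarrow> children v \<subseteq> T" using T by (auto simp: finite_complete_def)
  have par: "parent x \<in> ?J" if "x \<in> T" "x \<noteq> v0" for x
  proof -
    have "x \<in> children (parent x)" "parent x \<in> T"
      using that rc parent_props[of x] by (auto simp: child_iff_parent root_closed_def)
    then show ?thesis using that by (auto simp: leaves_def)
  qed
  have "root_closed ?J" using rc par by (auto simp: root_closed_def)
  moreover have "T = ?J \<union> border ?J"
  proof
    show "T \<subseteq> ?J \<union> border ?J" using par rc by (auto simp: border_def root_closed_def)
    show "?J \<union> border ?J \<subseteq> T"
    proof
      fix x assume "x \<in> ?J \<union> border ?J"
      then consider "x \<in> T" | "x = v0" | "x \<in> V" "parent x \<in> ?J" "x \<noteq> v0" by (auto simp: border_def)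
      then show "x \<in> T"
      proof cases
        case 3
        then have "x \<in> children (parent x)" using parent_props by (simp add: child_iff_parent)
        then show ?thesis using ch 3 by blast
      qed (use v0 in auto)
    qed
  qed
  ultimately show ?thesis using that by blast
qed

text \<open>Relational form of \<open>prm\<close>: it makes sense for maps not yet known to be
  automorphisms, and the permutation can be supplied as a witness.\<close>

definition acts_as :: "('v \<Rightarrow> 'v) \<Rightarrow> 'v \<Rightarrow> (nat \<Rightarrow> nat) \<Rightarrow> bool" where
  "acts_as g x p \<longleftrightarrow> (\<forall>c\<le>d. g (nbr x c) = nbr (g x) (p c))"

lemma acts_asD: "acts_as g x p \<Longrightarrow> c \<le> d \<Longrightarrow> g (nbr x c) = nbr (g x) (p c)"
  by (simp add: acts_as_def)

lemma locally_F_imp_bij: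
  assumes "\<And>x. x \<in> V \<Longrightarrow> g x \<in> V" "\<And>x. x \<in> V \<Longrightarrow> \<exists>p\<in>F. acts_as g x p"
  shows "bij_betw g V V"
proof -
  obtain p where p: "\<And>x. x \<in> V \<Longrightarrow> p x \<in> F \<and> acts_as g x (p x)" using assms(2) by metis
  show ?thesis by (rule locally_bij_imp_bij[of g p]) (use assms p F_bij acts_asD in auto)
qed

section \<open>U(F) through local actions\<close>

lemma Aut_iff:
  "g \<in> carrier Aut \<longleftrightarrow> g \<in> extensional V \<and> bij_betw g V V \<and> (\<forall>x\<in>V. \<forall>y\<in>V. (x, y) \<in> E \<longleftrightarrow> (g x, g y) \<in> E)"
  by (auto simp: Aut_def Bij_def)

lemma prm_eq:
  assumes "v \<in> V" shows "prm g v = (\<lambda>c\<in>{0..d}. col (g v, g (nbr v c)))"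
proof
  fix c
  have "inv_into {e \<in> E. fst e = v} col c = (v, nbr v c)" if "c \<le> d"
  proof (rule inv_into_f_eq)
    show "inj_on col {e \<in> E. fst e = v}" using col_bij[OF assms] by (simp add: bij_betw_def)
  qed (use nbr assms that in auto)
  then show "prm g v c = (\<lambda>c\<in>{0..d}. col (g v, g (nbr v c))) c" by (simp add: prm_def)
qed

lemma UF_acts_as:
  assumes "g \<in> UF F" "x \<in> V"
  shows "prm g x \<in> F" "acts_as g x (prm g x)"
proof -
  have g: "bij_betw g V V" "\<forall>x\<in>V. \<forall>y\<in>V. (x, y) \<in> E \<longleftrightarrow> (g x, g y) \<in> E"
    using assms by (auto simp: UF_def Aut_iff)
  show "prm g x \<in> F" using assms by (simp add: UF_def)
  have "g (nbr x c) = nbr (g x) (col (g x, g (nbr x c)))" if "c \<le> d" for c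
  proof -
    have "(g x, g (nbr x c)) \<in> E" using g nbr(1) assms that by auto
    then show ?thesis using nbr_eqI by metis
  qed
  then show "acts_as g x (prm g x)" using assms by (simp add: acts_as_def prm_eq)
qed

text \<open>Bijectivity and the reflection of edges come from the covering argument, so membership
  in U(F) becomes a purely local check.\<close>

lemma UF_iff:
  "g \<in> UF F \<longleftrightarrow> g \<in> extensional V \<and> g ` V \<subseteq> V \<and> (\<forall>x\<in>V. \<exists>p\<in>F. acts_as g x p)" (is "?L \<longleftrightarrow> ?R")
proof
  assume L: ?L
  then have "g \<in> carrier Aut" by (simp add: UF_def)
  then show ?R using UF_acts_as[OF L] by (auto simp: Aut_iff bij_betw_def)
next
  assume R: ?R
  then have gV: "\<And>x. x \<in> V \<Longrightarrow> g x \<in> V" by auto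
  have bij: "bij_betw g V V" using locally_F_imp_bij R by auto
  have 1: "(g x, g y) \<in> E" if "(x, y) \<in> E" for x y
  proof -
    obtain c where c: "x \<in> V" "c \<le> d" "y = nbr x c" using \<open>(x, y) \<in> E\<close> by (auto simp: E_iff)
    then obtain p where p: "p \<in> F" "acts_as g x p" using R by blast
    then show ?thesis using c nbr(1)[of "g x" "p c"] gV F_le acts_asD by simp
  qed
  have 2: "(x, y) \<in> E" if xy: "x \<in> V" "y \<in> V" "(g x, g y) \<in> E" for x y
  proof -
    obtain c where c: "c \<le> d" "g y = nbr (g x) c" using xy by (auto simp: E_iff)
    obtain p where p: "p \<in> F" "acts_as g x p" using R xy by blast
    have "c \<in> p ` {0..d}" using F_bij[OF p(1)] c by (simp add: bij_betw_def)
    then obtain c' where c': "c' \<le> d" "p c' = c" by auto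
    then have "g y = g (nbr x c')" using c acts_asD[OF p(2)] by simp
    then have "y = nbr x c'" using bij xy c' by (auto simp: bij_betw_def inj_on_def)
    then show ?thesis using nbr(1) xy c' by simp
  qed
  have "prm g x \<in> F" if x: "x \<in> V" for x
  proof -
    obtain p where p: "p \<in> F" "acts_as g x p" using R x by blast
    have "prm g x = p"
    proof
      fix c show "prm g x c = p c"
      proof (cases "c \<le> d")
        case True
        then show ?thesis using x p nbr(2)[of "g x" "p c"] gV F_le acts_asD by (simp add: prm_eq)
      next
        case False
        \<comment> \<open>The equality \<open>prm g x = p\<close> is one of functions on all
          numbers; off the colours both sides take the default value.\<close>
        have "p c = undefined" using Bij_imp_extensional[OF F_Bij[OF p(1)]] False by (simp add: extensional_def)
        then show ?thesis using False x by (simp add: prm_eq)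
      qed
    qed
    then show ?thesis using p by simp
  qed
  then show ?L using R bij 1 2 by (auto simp: UF_def Aut_iff)
qed

section \<open>Rooted forest isomorphisms with local action in \<open>F\<close>\<close>

text \<open>The image of the parent of \<open>x\<close> is deliberately left unconstrained, so that the condition makes
  sense at the leaves of the domain; instead the parent edges of \<open>x\<close> and \<open>\<phi> x\<close> correspond under the
  local action.\<close>

definition cloc :: "('v \<Rightarrow> 'v) \<Rightarrow> 'v \<Rightarrow> bool" where
  "cloc \<phi> x \<longleftrightarrow> x \<noteq> v0 \<and> \<phi> x \<in> V \<and> \<phi> x \<noteq> v0 \<and>
     (\<exists>p\<in>F. p (parent_colour x) = parent_colour (\<phi> x) \<and>
        (\<forall>c\<in>child_colours x. \<phi> (nbr x c) = nbr (\<phi> x) (p c)))"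

lemma clocE:
  assumes "cloc \<phi> x"
  obtains p where "p \<in> F" "p (parent_colour x) = parent_colour (\<phi> x)"
    "\<And>c. c \<in> child_colours x \<Longrightarrow> \<phi> (nbr x c) = nbr (\<phi> x) (p c)"
  using assms by (auto simp: cloc_def)

lemma clocD: "cloc \<phi> x \<Longrightarrow> x \<noteq> v0" "cloc \<phi> x \<Longrightarrow> \<phi> x \<in> V" "cloc \<phi> x \<Longrightarrow> \<phi> x \<noteq> v0"
  by (auto simp: cloc_def)

lemma F_child_colours:
  assumes "p \<in> F" "x \<in> V" "x \<noteq> v0" "y \<in> V" "y \<noteq> v0" "p (parent_colour x) = parent_colour y"
  shows "p ` child_colours x = child_colours y" "\<And>c. c \<in> child_colours x \<Longrightarrow> p c \<in> child_colours y"
proof -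
  have "p ` ({0..d} - {parent_colour x}) = {0..d} - {p (parent_colour x)}"
    using F_bij[OF assms(1)] parent_props(6)[OF assms(2,3)]
    by (subst inj_on_image_set_diff[of p "{0..d}"]) (auto simp: bij_betw_def)
  then show "p ` child_colours x = child_colours y" using assms by (simp add: child_colours_eq)
  then show "\<And>c. c \<in> child_colours x \<Longrightarrow> p c \<in> child_colours y" by auto
qed

lemma cloc_children:
  assumes "cloc \<phi> x" "x \<in> V"
  shows "children (\<phi> x) = \<phi> ` children x"
proof -
  obtain p where p: "p \<in> F" "p (parent_colour x) = parent_colour (\<phi> x)"
    "\<And>c. c \<in> child_colours x \<Longrightarrow> \<phi> (nbr x c) = nbr (\<phi> x) (p c)"
    using clocE assms by blast
  have "child_colours (\<phi> x) = p ` child_colours x" using F_child_colours(1) p clocD assms by metis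
  then show ?thesis using p(3) assms clocD[OF assms(1)] by (simp add: children_eq image_image cong: image_cong)
qed

lemma parent_cloc:
  assumes "cloc \<phi> (parent x)" "x \<in> V" "x \<noteq> v0"
  shows "\<phi> x \<in> V" "\<phi> x \<noteq> v0" "parent (\<phi> x) = \<phi> (parent x)"
proof -
  have "x \<in> children (parent x)" using assms parent_props by (simp add: child_iff_parent)
  then have "\<phi> x \<in> children (\<phi> (parent x))" using cloc_children[OF assms(1)] parent_props(1) assms by blast
  then show "\<phi> x \<in> V" "\<phi> x \<noteq> v0" "parent (\<phi> x) = \<phi> (parent x)" by (auto simp: child_iff_parent)
qed

lemma cloc_comp:
  assumes "cloc \<psi> x" "cloc \<phi> (\<psi> x)" "x \<in> V"
  shows "cloc (\<phi> \<circ> \<psi>) x"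
proof -
  note x = clocD[OF assms(1)] clocD[OF assms(2)]
  obtain p where p: "p \<in> F" "p (parent_colour x) = parent_colour (\<psi> x)"
    "\<And>c. c \<in> child_colours x \<Longrightarrow> \<psi> (nbr x c) = nbr (\<psi> x) (p c)"
    using clocE assms by blast
  obtain q where q: "q \<in> F" "q (parent_colour (\<psi> x)) = parent_colour (\<phi> (\<psi> x))"
    "\<And>c. c \<in> child_colours (\<psi> x) \<Longrightarrow> \<phi> (nbr (\<psi> x) c) = nbr (\<phi> (\<psi> x)) (q c)"
    using clocE assms by blast
  have pc: "parent_colour x \<le> d" using parent_props(6) assms x by blast
  have "compose {0..d} q p \<in> F" using F_comp p q by blast
  moreover have "compose {0..d} q p (parent_colour x) = parent_colour (\<phi> (\<psi> x))"
    using p q pc by (simp add: compose_def)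
  moreover have "(\<phi> \<circ> \<psi>) (nbr x c) = nbr ((\<phi> \<circ> \<psi>) x) (compose {0..d} q p c)" if c: "c \<in> child_colours x" for c
    using p q F_child_colours(2)[OF p(1) assms(3) x(1) x(2) x(3) p(2) c] child_coloursD[OF c] c
    by (simp add: compose_def)
  ultimately show ?thesis unfolding cloc_def using x by (metis comp_apply)
qed

lemma cloc_cong:
  assumes "cloc \<phi> x" "x \<in> V" "\<phi> x = \<psi> x" "\<And>c. c \<in> child_colours x \<Longrightarrow> \<phi> (nbr x c) = \<psi> (nbr x c)"
  shows "cloc \<psi> x"
  using assms unfolding cloc_def by metis

text \<open>Keeping \<open>v0\<close> in both interiors removes the root from both forests, so every
  vertex in play has a parent edge and a label.\<close>

definition riso :: "('v \<Rightarrow> 'v) \<Rightarrow> 'v set \<Rightarrow> 'v set \<Rightarrow> bool" where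
  "riso \<phi> I J \<longleftrightarrow> root_closed I \<and> root_closed J \<and> v0 \<in> I \<and> v0 \<in> J \<and>
     bij_betw \<phi> (V - I) (V - J) \<and> (\<forall>x\<in>V - I. cloc \<phi> x)"

lemma risoD:
  assumes "riso \<phi> I J"
  shows "root_closed I" "root_closed J" "v0 \<in> I" "v0 \<in> J" "bij_betw \<phi> (V - I) (V - J)"
    "\<And>x. x \<in> V \<Longrightarrow> x \<notin> I \<Longrightarrow> cloc \<phi> x" "\<And>x. x \<in> V \<Longrightarrow> x \<notin> I \<Longrightarrow> \<phi> x \<in> V - J"
  using assms by (auto simp: riso_def dest: bij_betwE)

lemma child_notin: "root_closed I \<Longrightarrow> x \<in> V \<Longrightarrow> x \<notin> I \<Longrightarrow> c \<in> child_colours x \<Longrightarrow> nbr x c \<in> V - I"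
  using parent_nbr child_neq_root root_closedD(3)[of I "nbr x c"] child_coloursD by auto

lemma riso_cong: "riso \<phi> I J \<Longrightarrow> (\<And>x. x \<in> V - I \<Longrightarrow> \<phi> x = \<psi> x) \<Longrightarrow> riso \<psi> I J"
proof -
  assume r: "riso \<phi> I J" and eq: "\<And>x. x \<in> V - I \<Longrightarrow> \<phi> x = \<psi> x"
  have "cloc \<psi> x" if "x \<in> V - I" for x
  proof (rule cloc_cong[of \<phi>])
    show "cloc \<phi> x" "x \<in> V" "\<phi> x = \<psi> x" using risoD(6)[OF r] eq that by auto
    show "\<phi> (nbr x c) = \<psi> (nbr x c)" if "c \<in> child_colours x" for c
      using child_notin[OF risoD(1)[OF r], of x c] that \<open>x \<in> V - I\<close> eq by blast
  qed
  moreover have "bij_betw \<psi> (V - I) (V - J)" using risoD(5)[OF r] eq bij_betw_cong by blast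
  ultimately show ?thesis using risoD[OF r] by (simp add: riso_def)
qed

lemma riso_comp:
  assumes "riso \<psi> I J" "riso \<phi> J K"
  shows "riso (\<phi> \<circ> \<psi>) I K"
proof -
  have "cloc (\<phi> \<circ> \<psi>) x" if "x \<in> V - I" for x
    using that cloc_comp risoD(6,7)[OF assms(1)] risoD(6)[OF assms(2)] by blast
  then show ?thesis
    using risoD[OF assms(1)] risoD[OF assms(2)] bij_betw_trans by (auto simp: riso_def)
qed

lemma cloc_inverse:
  assumes "cloc \<phi> x" "x \<in> V" "\<psi> (\<phi> x) = x" "\<And>c. c \<in> child_colours x \<Longrightarrow> \<psi> (\<phi> (nbr x c)) = nbr x c"
  shows "cloc \<psi> (\<phi> x)"
proof -
  note x = clocD[OF assms(1)]
  obtain p where p: "p \<in> F" "p (parent_colour x) = parent_colour (\<phi> x)"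
    "\<And>c. c \<in> child_colours x \<Longrightarrow> \<phi> (nbr x c) = nbr (\<phi> x) (p c)"
    using clocE assms by blast
  obtain q where q: "q \<in> F" "\<And>c. c \<le> d \<Longrightarrow> q (p c) = c" "\<And>c. c \<le> d \<Longrightarrow> p (q c) = c"
    using F_inv p by blast
  have "q (parent_colour (\<phi> x)) = parent_colour (\<psi> (\<phi> x))"
    using q(2)[of "parent_colour x"] p parent_props(6)[OF assms(2) x(1)] assms(3) by simp
  moreover have "\<psi> (nbr (\<phi> x) c) = nbr (\<psi> (\<phi> x)) (q c)" if c: "c \<in> child_colours (\<phi> x)" for c
  proof -
    have "c \<in> p ` child_colours x" using F_child_colours(1)[OF p(1) assms(2) x(1) x(2) x(3) p(2)] c by simp
    then obtain c' where c': "c' \<in> child_colours x" "c = p c'" by auto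
    then show ?thesis using assms(3,4) p q child_coloursD by metis
  qed
  ultimately show ?thesis unfolding cloc_def using q x assms by metis
qed

lemma riso_inv:
  assumes "riso \<phi> I J" shows "riso (inv_into (V - I) \<phi>) J I"
proof -
  let ?\<psi> = "inv_into (V - I) \<phi>"
  note r = risoD[OF assms]
  have inv: "?\<psi> (\<phi> x) = x" if "x \<in> V - I" for x
    using r(5) that by (auto simp: bij_betw_def)
  have "cloc ?\<psi> y" if "y \<in> V - J" for y
  proof -
    have "y \<in> \<phi> ` (V - I)" using r(5) that by (simp add: bij_betw_def)
    then obtain x where x: "x \<in> V - I" "y = \<phi> x" by auto
    then show ?thesis using cloc_inverse[of \<phi> x ?\<psi>] r(6) inv child_notin[OF r(1)] by auto
  qed
  then show ?thesis using r bij_betw_inv_into[OF r(5)] by (simp add: riso_def)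
qed

text \<open>The image of a child-closed set is child-closed, because \<open>cloc\<close> maps the
  children of \<open>x\<close> onto those of \<open>\<phi> x\<close>; hence its complement is closed
  under parents. That complement is finite since it lies in the union of \<open>B\<close> and the
  image of \<open>J\<close>.\<close>

lemma riso_restrict_aux:
  assumes A: "finite A" "finite B" "bij_betw \<phi> (V - A) (V - B)"
    and J: "root_closed J" "A \<subseteq> J" "v0 \<in> J"
    and loc: "\<And>x. x \<in> V \<Longrightarrow> x \<notin> J \<Longrightarrow> cloc \<phi> x"
  shows "riso \<phi> J (V - \<phi> ` (V - J))"
proof -
  let ?K = "V - \<phi> ` (V - J)"
  have sub: "\<phi> ` (V - J) \<subseteq> V - {v0}" using loc clocD by blast
  have "?K \<subseteq> B \<union> \<phi> ` J"
  proof
    fix y assume y: "y \<in> ?K"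
    show "y \<in> B \<union> \<phi> ` J"
    proof (cases "y \<in> B")
      case False
      then have "y \<in> \<phi> ` (V - A)" using A(3) y by (auto simp: bij_betw_def)
      then show ?thesis using y by auto
    qed simp
  qed
  then have fin: "finite ?K" using A(2) root_closedD(1)[OF J(1)] finite_subset by blast
  have "parent y \<in> ?K" if y: "y \<in> ?K" "y \<noteq> v0" for y
  proof (rule ccontr)
    assume n: "parent y \<notin> ?K"
    have "parent y \<in> V" "y \<in> children (parent y)" using parent_props y by (auto simp: child_iff_parent)
    then obtain x where x: "x \<in> V - J" "parent y = \<phi> x" using n by auto
    then have "y \<in> \<phi> ` children x" using cloc_children[of \<phi> x] loc \<open>y \<in> children (parent y)\<close> by auto
    then obtain c where c: "c \<in> child_colours x" "y = \<phi> (nbr x c)" using x children_eq by auto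
    then have "y \<in> \<phi> ` (V - J)" using child_notin[OF J(1), of x c] x by auto
    then show False using y by simp
  qed
  then have "root_closed ?K" using fin by (auto simp: root_closed_def)
  moreover have "V - ?K = \<phi> ` (V - J)" using sub by auto
  moreover have "inj_on \<phi> (V - J)" using A(3) J(2) by (auto simp: bij_betw_def intro: inj_on_subset)
  ultimately show ?thesis using J loc sub root by (auto simp: riso_def bij_betw_def)
qed

section \<open>Germs at infinity\<close>

definition ball :: "nat \<Rightarrow> 'v set" where
  "ball n = {x \<in> V. length (code x) < n}"

lemma root_closed_ball: "root_closed (ball n)"
proof -
  have "ball n \<subseteq> walk v0 ` {u. set u \<subseteq> {0..d} \<and> length u \<le> n}"
  proof
    fix x assume x: "x \<in> ball n"
    then have "reduced (code x)" "x = walk v0 (code x)" by (auto simp: ball_def)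
    then show "x \<in> walk v0 ` {u. set u \<subseteq> {0..d} \<and> length u \<le> n}"
      using x by (intro image_eqI[of _ _ "code x"]) (auto simp: ball_def reduced_def)
  qed
  then have "finite (ball n)" by (rule finite_subset) (simp add: finite_lists_length_le)
  moreover have "parent x \<in> ball n" if "x \<in> ball n" "x \<noteq> v0" for x
    using that parent_props(1,5)[of x] by (auto simp: ball_def)
  ultimately show ?thesis by (auto simp: root_closed_def ball_def)
qed

lemma finite_ball: "finite (ball n)"
  using root_closedD root_closed_ball by blast

lemma root_in_ball: "n > 0 \<Longrightarrow> v0 \<in> ball n"
  using root by (simp add: ball_def)

lemma ball_mono: "m \<le> n \<Longrightarrow> ball m \<subseteq> ball n"
  by (auto simp: ball_def)

lemma finite_subset_ball:
  assumes "finite A" shows "\<exists>n>0. A \<inter> V \<subseteq> ball n"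
proof -
  let ?n = "Suc (Max (insert 0 ((length \<circ> code) ` A)))"
  have "length (code x) < ?n" if "x \<in> A" for x
    using assms that by (auto simp: less_Suc_eq_le intro!: Max_ge)
  then have "A \<inter> V \<subseteq> ball ?n" by (auto simp: ball_def)
  then show ?thesis by blast
qed

text \<open>Agreement outside some finite complete tree is agreement at all but finitely many
  vertices, so equivalence of representatives becomes eventual equality along this filter.\<close>

definition ends :: "'v filter" where
  "ends = inf cofinite (principal V)"

lemma eventually_ends: "eventually P ends \<longleftrightarrow> finite {x \<in> V. \<not> P x}"
  by (simp add: ends_def eventually_inf_principal eventually_cofinite)

lemma eventually_ends_ball: "eventually P ends \<longleftrightarrow> (\<exists>n>0. \<forall>x\<in>V - ball n. P x)"
proof
  assume "eventually P ends"
  then obtain n where "n > 0" "{x \<in> V. \<not> P x} \<inter> V \<subseteq> ball n"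
    using finite_subset_ball by (auto simp: eventually_ends)
  then show "\<exists>n>0. \<forall>x\<in>V - ball n. P x" by blast
next
  assume "\<exists>n>0. \<forall>x\<in>V - ball n. P x"
  then obtain n where "\<forall>x\<in>V - ball n. P x" by blast
  then have "{x \<in> V. \<not> P x} \<subseteq> ball n" by blast
  then show "eventually P ends" using finite_ball finite_subset by (auto simp: eventually_ends)
qed

lemma eventually_ends_off: "finite A \<Longrightarrow> (\<And>x. x \<in> V - A \<Longrightarrow> P x) \<Longrightarrow> eventually P ends"
  unfolding eventually_ends by (rule finite_subset[of _ A]) auto

text \<open>Only finitely many points can enter a given finite set; this lets eventual properties be
  pulled back along a map when composing.\<close>

lemma bij_filterlim_ends:
  assumes "bij_betw \<phi> (V - A) (V - B)" "finite A"
  shows "filterlim \<phi> ends ends"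
  unfolding filterlim_iff
proof (intro allI impI)
  fix P assume P: "eventually P ends"
  have "{x \<in> V. \<not> P (\<phi> x)} \<subseteq> A \<union> {x \<in> V - A. \<phi> x \<in> {y \<in> V. \<not> P y}}"
    using assms(1) by (auto dest: bij_betwE)
  moreover have "finite {x \<in> V - A. \<phi> x \<in> {y \<in> V. \<not> P y}}"
    using P assms(1) finite_inverse_image_gen[of "{y \<in> V. \<not> P y}" \<phi> "V - A"]
    by (auto simp: eventually_ends bij_betw_def conj_commute)
  ultimately show "\<forall>\<^sub>F x in ends. P (\<phi> x)"
    using assms(2) finite_subset by (auto simp: eventually_ends)
qed

text \<open>No trees are recorded, and the exceptional sets are arbitrary finite sets;
  \<open>germ_riso\<close> recovers trees on which the map is a forest isomorphism.\<close>

definition germ :: "('v \<Rightarrow> 'v) \<Rightarrow> bool" where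
  "germ \<phi> \<longleftrightarrow> (\<exists>A B. finite A \<and> finite B \<and> bij_betw \<phi> (V - A) (V - B)) \<and> eventually (cloc \<phi>) ends"

lemma germ_riso:
  assumes "germ \<phi>"
  shows "\<exists>n>0. \<forall>J. root_closed J \<longrightarrow> ball n \<subseteq> J \<longrightarrow> riso \<phi> J (V - \<phi> ` (V - J))"
proof -
  obtain A B where AB: "finite A" "finite B" "bij_betw \<phi> (V - A) (V - B)"
    using assms by (auto simp: germ_def)
  obtain m where m: "m > 0" "A \<inter> V \<subseteq> ball m" using finite_subset_ball AB by blast
  obtain k where k: "k > 0" "\<And>x. x \<in> V - ball k \<Longrightarrow> cloc \<phi> x"
    using assms by (auto simp: germ_def eventually_ends_ball)
  have "riso \<phi> J (V - \<phi> ` (V - J))" if J: "root_closed J" "ball (max m k) \<subseteq> J" for J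
  proof (rule riso_restrict_aux[of "A \<inter> V" B])
    show "bij_betw \<phi> (V - A \<inter> V) (V - B)" using AB by (simp add: Diff_Int)
    show "v0 \<in> J" using root_in_ball[of "max m k"] m J by auto
    show "A \<inter> V \<subseteq> J" using m ball_mono[of m "max m k"] J by auto
    show "cloc \<phi> x" if "x \<in> V" "x \<notin> J" for x using that k(2)[of x] ball_mono[of k "max m k"] J by auto
  qed (use AB J in auto)
  then show ?thesis using m by (intro exI[of _ "max m k"]) simp
qed

lemma riso_germ: "riso \<phi> I J \<Longrightarrow> germ \<phi>"
  using risoD[of \<phi> I J] by (auto simp: germ_def intro!: eventually_ends_off[of I] dest: root_closedD)

lemma germ_filterlim: "germ \<phi> \<Longrightarrow> filterlim \<phi> ends ends"
  using bij_filterlim_ends by (auto simp: germ_def)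

text \<open>The range of \<open>\<psi>\<close> has to be the domain of \<open>\<phi>\<close>. The
  ball for \<open>\<psi>\<close> is enlarged until its outside is mapped off the ball beyond which
  \<open>\<phi>\<close> behaves well; the complement of the image then serves both maps.\<close>

lemma germ_riso_pair:
  assumes "germ \<phi>" "germ \<psi>"
  obtains I J K where "riso \<psi> I J" "riso \<phi> J K"
proof -
  obtain m where m: "m > 0" "\<And>J. root_closed J \<Longrightarrow> ball m \<subseteq> J \<Longrightarrow> riso \<phi> J (V - \<phi> ` (V - J))"
    using germ_riso[OF assms(1)] by blast
  obtain n where n: "n > 0" "\<And>J. root_closed J \<Longrightarrow> ball n \<subseteq> J \<Longrightarrow> riso \<psi> J (V - \<psi> ` (V - J))"
    using germ_riso[OF assms(2)] by blast
  have "eventually (\<lambda>x. x \<notin> ball m) ends" by (rule eventually_ends_off[OF finite_ball[of m]]) simp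
  then have "eventually (\<lambda>x. \<psi> x \<notin> ball m) ends"
    by (rule eventually_compose_filterlim) (rule germ_filterlim[OF assms(2)])
  then obtain k where k: "k > 0" "\<And>x. x \<in> V - ball k \<Longrightarrow> \<psi> x \<notin> ball m" by (auto simp: eventually_ends_ball)
  let ?I = "ball (max n k)"
  let ?J = "V - \<psi> ` (V - ?I)"
  have r: "riso \<psi> ?I ?J" using n root_closed_ball ball_mono by simp
  have "ball m \<subseteq> ?J" using k ball_mono[of k "max n k"] by (auto simp: ball_def)
  then show ?thesis using that[OF r] m(2)[of ?J] risoD(2)[OF r] by simp
qed

lemma germ_comp:
  assumes "germ \<phi>" "germ \<psi>" shows "germ (\<phi> \<circ> \<psi>)"
proof -
  obtain I J K where "riso \<psi> I J" "riso \<phi> J K" by (rule germ_riso_pair[OF assms])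
  then show ?thesis using riso_comp riso_germ by blast
qed

lemma germ_riso_ex:
  assumes "germ \<phi>" obtains I J where "riso \<phi> I J"
  using germ_riso_pair[OF assms assms] by blast

lemma germ_cong:
  assumes "germ \<phi>" "\<forall>\<^sub>F x in ends. \<phi> x = \<psi> x"
  shows "germ \<psi>"
proof -
  obtain n where n: "n > 0" "\<And>J. root_closed J \<Longrightarrow> ball n \<subseteq> J \<Longrightarrow> riso \<phi> J (V - \<phi> ` (V - J))"
    using germ_riso[OF assms(1)] by blast
  obtain k where k: "k > 0" "\<And>x. x \<in> V - ball k \<Longrightarrow> \<phi> x = \<psi> x" using assms(2) by (auto simp: eventually_ends_ball)
  let ?I = "ball (max n k)"
  have "riso \<phi> ?I (V - \<phi> ` (V - ?I))" using n root_closed_ball ball_mono by simp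
  then have "riso \<psi> ?I (V - \<phi> ` (V - ?I))"
    by (rule riso_cong) (use k ball_mono[of k "max n k"] in auto)
  then show ?thesis by (rule riso_germ)
qed

lemma germ_inverse:
  assumes "germ \<phi>"
  obtains \<psi> where "germ \<psi>" "\<forall>\<^sub>F x in ends. \<psi> (\<phi> x) = x" "\<forall>\<^sub>F x in ends. \<phi> (\<psi> x) = x"
proof -
  obtain I J where r: "riso \<phi> I J" by (rule germ_riso_ex[OF assms])
  note rD = risoD[OF r]
  let ?\<psi> = "inv_into (V - I) \<phi>"
  have "\<forall>\<^sub>F x in ends. ?\<psi> (\<phi> x) = x"
    using rD(5) root_closedD(1)[OF rD(1)] by (intro eventually_ends_off[of I]) (auto simp: bij_betw_def)
  moreover have "\<forall>\<^sub>F x in ends. \<phi> (?\<psi> x) = x"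
    using rD(5) root_closedD(1)[OF rD(2)]
    by (intro eventually_ends_off[of J]) (auto simp: bij_betw_def intro!: f_inv_into_f)
  ultimately show ?thesis using that riso_germ[OF riso_inv[OF r]] by blast
qed

text \<open>The point is that the parent edge goes to the parent edge. Otherwise some child
  \<open>?x1\<close> of \<open>x\<close> is mapped to the parent of \<open>\<phi> x\<close>. Its
  image is nearer to the root, so by induction the claim holds at \<open>?x1\<close>, and the edge
  from \<open>?x1\<close> back to \<open>x\<close> goes up once more, making \<open>\<phi> x\<close>
  its own grandparent. The map avoids the root, so these parents exist.\<close>

lemma UF_cloc_far:
  assumes loc: "\<And>x. x \<in> V \<Longrightarrow> x \<notin> ball n \<Longrightarrow> \<phi> x \<in> V \<and> \<phi> x \<noteq> v0 \<and> (\<exists>p\<in>F. acts_as \<phi> x p)"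
    and n: "n > 0" and x: "x \<in> V" "x \<notin> ball n"
  shows "cloc \<phi> x"
proof -
  have key: "p (parent_colour x) = parent_colour (\<phi> x)"
    if "x \<in> V" "x \<notin> ball n" "p \<in> F" "acts_as \<phi> x p" for x p
    using that
  proof (induction "length (code (\<phi> x))" arbitrary: x p rule: less_induct)
    case less
    have x0: "x \<noteq> v0" using root_in_ball[OF n] less.prems by auto
    have \<phi>x: "\<phi> x \<in> V" "\<phi> x \<noteq> v0" using loc less.prems by auto
    note px = parent_props[OF less.prems(1) x0] and py = parent_props[OF \<phi>x]
    show ?case
    proof (rule ccontr)
      assume ne: "p (parent_colour x) \<noteq> parent_colour (\<phi> x)"
      have "parent_colour (\<phi> x) \<in> p ` {0..d}" using F_bij[OF less.prems(3)] py by (simp add: bij_betw_def)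
      then obtain c where c: "c \<le> d" "p c = parent_colour (\<phi> x)" by auto
      then have cc: "c \<in> child_colours x" using ne less.prems x0 by (auto simp: child_colours_eq)
      let ?x1 = "nbr x c"
      have x1: "?x1 \<in> V" "?x1 \<notin> ball n" "?x1 \<noteq> v0"
        using child_notin[OF root_closed_ball _ _ cc] child_neq_root cc less.prems by auto
      have \<phi>x1: "\<phi> ?x1 = parent (\<phi> x)" using acts_asD[OF less.prems(4) c(1)] c py by simp
      have \<phi>x1': "\<phi> ?x1 \<noteq> v0" using loc x1 by blast
      note pz = parent_props[OF py(1)] 
      obtain q where q: "q \<in> F" "acts_as \<phi> ?x1 q" using loc x1 by blast
      have "length (code (\<phi> ?x1)) < length (code (\<phi> x))" using py(5) \<phi>x1 by simp
      then have "q (parent_colour ?x1) = parent_colour (\<phi> ?x1)" using less.hyps x1 q by blast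
      moreover have "parent_colour ?x1 = c" using parent_colour_nbr cc less.prems by blast
      ultimately have "\<phi> x = parent (parent (\<phi> x))"
        using acts_asD[OF q(2) c(1)] \<phi>x1 \<phi>x1' pz(4) less.prems c by simp
      then show False using py(5) pz(5) \<phi>x1 \<phi>x1' by (metis append_assoc append_self_conv not_Cons_self2 append_is_Nil_conv)
    qed
  qed
  obtain p where p: "p \<in> F" "acts_as \<phi> x p" using loc x by blast
  moreover have "x \<noteq> v0" using root_in_ball[OF n] x by auto
  ultimately show ?thesis
    using key[OF x p] loc[OF x] acts_asD[OF p(2)] child_coloursD unfolding cloc_def by blast
qed

section \<open>Honest almost automorphisms as germs\<close>

lemma honest_bij:
  assumes "(T1, T2, \<phi>) \<in> honest"
  obtains I J where "root_closed I" "root_closed J" "T1 = I \<union> border I" "T2 = J \<union> border J"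
    "outside T1 = V - I" "outside T2 = V - J" "bij_betw \<phi> (V - I) (V - J)"
proof -
  obtain I where I: "root_closed I" "T1 = I \<union> border I"
    using finite_complete_is_closure honestD(1)[OF assms] by blast
  obtain J where J: "root_closed J" "T2 = J \<union> border J"
    using finite_complete_is_closure honestD(2)[OF assms] by blast
  show ?thesis using that[OF I(1) J(1) I(2) J(2)] honestD(4)[OF assms] closure_finite_complete(3) I J by simp
qed

lemma almost_eq_iff:
  "((T1, T2, \<phi>), (S1, S2, \<psi>)) \<in> almost_eq \<longleftrightarrow>
     (T1, T2, \<phi>) \<in> honest \<and> (S1, S2, \<psi>) \<in> honest \<and> (\<forall>\<^sub>F x in ends. \<phi> x = \<psi> x)" (is "?L \<longleftrightarrow> ?R")
proof
  assume L: ?L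
  then obtain T where T: "finite_complete T" "\<forall>x\<in>outside T. \<phi> x = \<psi> x" by (auto simp: almost_eq_def)
  obtain J where J: "root_closed J" "T = J \<union> border J" using finite_complete_is_closure[OF T(1)] by blast
  then have "outside T = V - J" using closure_finite_complete(3) by simp
  then have "\<forall>\<^sub>F x in ends. \<phi> x = \<psi> x"
    using T(2) root_closedD(1)[OF J(1)] by (intro eventually_ends_off[of J]) auto
  then show ?R using L by (auto simp: almost_eq_def)
next
  assume R: ?R
  have fin: "finite T1" "finite S1" "T1 \<subseteq> V" "S1 \<subseteq> V"
    using R honestD(1)[of T1 T2 \<phi>] honestD(1)[of S1 S2 \<psi>] by (auto simp: finite_complete_def)
  have "finite (T1 \<union> S1 \<union> {x \<in> V. \<phi> x \<noteq> \<psi> x})" using R fin by (simp add: eventually_ends)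
  from finite_subset_ball[OF this]
  obtain n where n: "n > 0" "(T1 \<union> S1 \<union> {x \<in> V. \<phi> x \<noteq> \<psi> x}) \<inter> V \<subseteq> ball n"
    by (elim exE conjE)
  let ?T = "ball n \<union> border (ball n)"
  have "finite_complete ?T" "outside ?T = V - ball n" using closure_finite_complete root_closed_ball by blast+
  moreover have "T1 \<union> S1 \<subseteq> ?T" "\<forall>x\<in>V - ball n. \<phi> x = \<psi> x" using n fin by auto
  ultimately show ?L using R by (auto simp: almost_eq_def)
qed

text \<open>A germ is any map on the whole type, while its representatives are extensional and carry
  their trees; for a germ this set is the equivalence class that it stands for.\<close>

definition cls :: "('v \<Rightarrow> 'v) \<Rightarrow> 'v forest_map set" where
  "cls \<phi> = {(T1, T2, \<psi>) \<in> honest. \<forall>\<^sub>F x in ends. \<psi> x = \<phi> x}"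

lemma cls_iff: "(T1, T2, \<psi>) \<in> cls \<phi> \<longleftrightarrow> (T1, T2, \<psi>) \<in> honest \<and> (\<forall>\<^sub>F x in ends. \<psi> x = \<phi> x)"
  by (simp add: cls_def)

lemma ends_eq_sym: "(\<forall>\<^sub>F x in ends. \<phi> x = \<psi> x) \<Longrightarrow> (\<forall>\<^sub>F x in ends. \<psi> x = \<phi> x)"
  by (erule eventually_mono) simp

lemma ends_eq_trans:
  "(\<forall>\<^sub>F x in ends. \<phi> x = \<psi> x) \<Longrightarrow> (\<forall>\<^sub>F x in ends. \<psi> x = \<theta> x) \<Longrightarrow> (\<forall>\<^sub>F x in ends. \<phi> x = \<theta> x)"
  by (erule (1) eventually_elim2) simp

lemma class_eq_cls:
  assumes "(T1, T2, \<psi>) \<in> cls \<phi>"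
  shows "almost_eq `` {(T1, T2, \<psi>)} = cls \<phi>"
proof -
  have a: "(T1, T2, \<psi>) \<in> honest" "\<forall>\<^sub>F x in ends. \<psi> x = \<phi> x" using assms by (auto simp: cls_iff)
  have "((T1, T2, \<psi>), (S1, S2, \<theta>)) \<in> almost_eq \<longleftrightarrow> (S1, S2, \<theta>) \<in> cls \<phi>" for S1 S2 \<theta>
    using a ends_eq_trans ends_eq_sym unfolding almost_eq_iff cls_iff by blast
  then show ?thesis by auto
qed

lemma cls_eqI: "(\<forall>\<^sub>F x in ends. \<phi> x = \<psi> x) \<Longrightarrow> cls \<phi> = cls \<psi>"
  using ends_eq_trans ends_eq_sym by (fastforce simp: cls_iff)

text \<open>Below a leaf the permutations provided by \<open>cloc\<close> are consistent along
  edges, because they match parent colours; they extend to local actions on the whole tree and so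
  define an element of U(F) agreeing with the map on that branch.\<close>

lemma riso_UF_honest:
  assumes r: "riso \<phi> I J"
  shows "(I \<union> border I, J \<union> border J, restrict \<phi> (V - I)) \<in> UF_honest F"
proof -
  note rD = risoD[OF r]
  note cI = closure_finite_complete[OF rD(1)] and cJ = closure_finite_complete[OF rD(2)]
  let ?\<phi> = "restrict \<phi> (V - I)"
  have inj: "inj_on \<phi> (V - I)" using rD(5) by (simp add: bij_betw_def)
  have child_iff: "y \<in> children x \<longleftrightarrow> \<phi> y \<in> children (\<phi> x)" if xy: "x \<in> V - I" "y \<in> V - I" for x y
  proof -
    have eq: "children (\<phi> x) = \<phi> ` children x" using cloc_children rD(6) xy by blast
    have "children x \<subseteq> V - I"
      using child_notin[OF rD(1)] xy by (auto simp: children_eq)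
    then show ?thesis using inj_on_image_mem_iff[OF inj xy(2)] eq by simp
  qed
  have E_child: "(x, y) \<in> E \<longleftrightarrow> y \<in> children x \<or> x \<in> children y" if xy: "x \<in> V" "y \<in> V" for x y
  proof
    assume e: "(x, y) \<in> E"
    then obtain c where c: "c \<le> d" "y = nbr x c" by (auto simp: E_iff)
    show "y \<in> children x \<or> x \<in> children y"
    proof (cases "c \<in> child_colours x")
      case True
      then show ?thesis using c xy children_eq by auto
    next
      case False
      then have "x \<noteq> v0" "c = parent_colour x" using c xy by (auto simp: child_colours_eq split: if_splits)
      then have "y = parent x" using parent_props xy c by blast
      then show ?thesis using xy \<open>x \<noteq> v0\<close> by (simp add: child_iff_parent)
    qed
  next
    assume "y \<in> children x \<or> x \<in> children y"
    then show "(x, y) \<in> E" using E_sym by (auto simp: children_def)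
  qed
  have "(x, y) \<in> E \<longleftrightarrow> (?\<phi> x, ?\<phi> y) \<in> E" if xy: "x \<in> V - I" "y \<in> V - I" for x y
    using E_child[of x y] E_child[of "\<phi> x" "\<phi> y"] child_iff xy rD(7) by auto
  moreover have "bij_betw ?\<phi> (V - I) (V - J)" using bij_betw_cong[of "V - I" ?\<phi> \<phi> "V - J"] rD(5) by simp
  ultimately have honest: "(I \<union> border I, J \<union> border J, ?\<phi>) \<in> honest"
    using cI cJ by (simp add: honest_def)
  have "\<exists>g\<in>UF F. \<forall>w\<in>subtree_at v. ?\<phi> w = g w" if v: "v \<in> border I" for v
  proof -
    have vV: "v \<in> V" and v0: "v \<noteq> v0" using v rD(3) by (auto simp: border_def)
    have sub: "x \<in> V - I" if "x \<in> subtree_at v" for x using border_subtree_outside[OF rD(1) v that] .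
    have "\<forall>x\<in>subtree_at v. \<exists>p\<in>F. p (parent_colour x) = parent_colour (\<phi> x) \<and>
      (\<forall>c\<in>child_colours x. \<phi> (nbr x c) = nbr (\<phi> x) (p c))"
      using rD(6) sub by (auto simp: cloc_def)
    then obtain q where q: "\<And>x. x \<in> subtree_at v \<Longrightarrow> q x \<in> F \<and> q x (parent_colour x) = parent_colour (\<phi> x) \<and>
      (\<forall>c\<in>child_colours x. \<phi> (nbr x c) = nbr (\<phi> x) (q x c))" by metis
    \<comment> \<open>Outside the branch the action of its top vertex is used everywhere, so no
      inconsistency arises on the edge by which the branch is attached.\<close>
    define \<sigma> where "\<sigma> x = (if x \<in> subtree_at v then q x else q v)" for x
    have \<sigma>F: "\<sigma> x \<in> F" for x using q vV by (auto simp: \<sigma>_def)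
    have step: "\<sigma> (nbr x c) c = \<sigma> x c" if x: "x \<in> V" "c \<in> child_colours x" for x c
    proof (cases "x \<in> subtree_at v")
      case True
      let ?x = "nbr x c"
      have in': "?x \<in> subtree_at v" using True x vV subtree_at_child_iff by blast
      have xI: "x \<in> V - I" "x \<noteq> v0" using True sub rD(3) by auto
      have "q x c \<in> child_colours (\<phi> x)"
        using F_child_colours(2)[of "q x" x "\<phi> x" c] q[OF True] clocD[OF rD(6)] xI x(2) by blast
      then have "parent_colour (\<phi> ?x) = q x c" using parent_colour_nbr rD(7) xI q[OF True] x(2) by auto
      moreover have "parent_colour ?x = c" using parent_colour_nbr x by blast
      ultimately show ?thesis using q[OF in'] in' True by (simp add: \<sigma>_def)
    next
      case False
      then have "nbr x c \<in> subtree_at v \<Longrightarrow> nbr x c = v" using subtree_at_child_iff vV x by blast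
      then show ?thesis using False by (auto simp: \<sigma>_def)
    qed
    have "\<phi> v \<in> V" using rD(7) sub[of v] vV by auto
    then obtain g where g: "bij_betw g V V" "g v = \<phi> v" "\<And>x c. x \<in> V \<Longrightarrow> c \<le> d \<Longrightarrow> g (nbr x c) = nbr (g x) (\<sigma> x c)"
      using local_action_extends[of v "\<phi> v" \<sigma>] vV F_bij[OF \<sigma>F] step by metis
    let ?g = "restrict g V"
    have "?g \<in> UF F"
      using g \<sigma>F by (auto simp: UF_iff acts_as_def bij_betw_def intro!: bexI[of _ "\<sigma> _"])
    moreover have "g w = \<phi> w" if "w \<in> subtree_at v" for w
      using vV that
    proof (induction rule: subtree_induct)
      case base
      then show ?case using g by simp
    next
      case (child x c)
      then show ?case using g(3)[of x c] q[of x] subtree_atD child_coloursD by (simp add: \<sigma>_def)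
    qed
    ultimately show ?thesis using sub subtree_atD by (intro bexI[of _ ?g]) auto
  qed
  then show ?thesis using honest cI by (simp add: UF_honest_def)
qed

text \<open>The elements of U(F) give local actions strictly below the leaves; going further out
  makes \<open>UF_cloc_far\<close> applicable, which turns them into \<open>cloc\<close>.\<close>

lemma UF_honest_germ:
  assumes "(T1, T2, \<phi>) \<in> UF_honest F"
  shows "germ \<phi>"
proof -
  have h: "(T1, T2, \<phi>) \<in> honest" and
    loc: "\<And>v. v \<in> leaves T1 \<Longrightarrow> \<exists>g\<in>UF F. \<forall>w\<in>subtree_at v. \<phi> w = g w"
    using assms by (auto simp: UF_honest_def)
  obtain I J where IJ: "root_closed I" "root_closed J" "T1 = I \<union> border I" "T2 = J \<union> border J"
    "outside T1 = V - I" "outside T2 = V - J" "bij_betw \<phi> (V - I) (V - J)"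
    by (rule honest_bij[OF h])
  have lv: "leaves T1 = border I" using closure_finite_complete(2) IJ by simp
  \<comment> \<open>Leaves are excluded because the parent of a leaf lies outside its branch, where
    nothing relates the map to \<open>g\<close>.\<close>
  have act: "\<exists>p\<in>F. acts_as \<phi> x p" if x: "x \<in> V" "x \<notin> I" "x \<notin> border I" for x
  proof -
    obtain v where v: "v \<in> border I" "x \<in> subtree_at v" using border_exists[OF IJ(1)] x by blast
    obtain g where g: "g \<in> UF F" "\<And>w. w \<in> subtree_at v \<Longrightarrow> \<phi> w = g w" using loc lv v by blast
    obtain p where p: "p \<in> F" "acts_as g x p" using UF_acts_as g x by blast
    have "nbr x c \<in> subtree_at v" if c: "c \<le> d" for c
    proof (cases "c \<in> child_colours x")
      case True
      then show ?thesis using subtree_at_child_iff v x by (auto simp: border_def)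
    next
      case False
      then have "x \<noteq> v0" "c = parent_colour x" using c x by (auto simp: child_colours_eq split: if_splits)
      then have "nbr x c = parent x" using parent_props x by blast
      moreover have "v \<in> V" "x \<noteq> v" using v x by (auto simp: border_def)
      ultimately show ?thesis using subtree_at_parent v by metis
    qed
    then have "acts_as \<phi> x p" using p(2) g(2) v(2) by (simp add: acts_as_def)
    then show ?thesis using p by blast
  qed
  have fin: "finite I" "finite (border I)" "finite J" using IJ root_closedD border_finite by blast+
  have "\<forall>\<^sub>F x in ends. \<phi> x \<noteq> v0"
    by (rule eventually_compose_filterlim[OF _ bij_filterlim_ends[OF IJ(7) fin(1)]])
      (rule eventually_ends_off[of "{v0}"], auto)
  moreover have "\<forall>\<^sub>F x in ends. x \<in> V - I - border I"
    by (rule eventually_ends_off[of "I \<union> border I"]) (use fin in auto)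
  ultimately have "\<forall>\<^sub>F x in ends. \<phi> x \<noteq> v0 \<and> x \<in> V - I - border I" by (rule eventually_conj)
  then obtain n where n: "n > 0" "\<And>x. x \<in> V - ball n \<Longrightarrow> \<phi> x \<noteq> v0 \<and> x \<in> V - I - border I"
    by (auto simp: eventually_ends_ball)
  have "cloc \<phi> x" if "x \<in> V - ball n" for x
  proof (rule UF_cloc_far[of n])
    show "\<phi> y \<in> V \<and> \<phi> y \<noteq> v0 \<and> (\<exists>p\<in>F. acts_as \<phi> y p)" if "y \<in> V" "y \<notin> ball n" for y
      using n(2)[of y] act[of y] that bij_betwE[OF IJ(7)] by auto
  qed (use n that in auto)
  then have "eventually (cloc \<phi>) ends" using n by (auto simp: eventually_ends_ball)
  then show ?thesis using IJ(7) fin by (auto simp: germ_def)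
qed

lemma riso_in_cls:
  assumes "riso \<phi> I J"
  shows "(I \<union> border I, J \<union> border J, restrict \<phi> (V - I)) \<in> cls \<phi>"
proof -
  have "\<forall>\<^sub>F x in ends. restrict \<phi> (V - I) x = \<phi> x"
    using root_closedD(1)[OF risoD(1)[OF assms]] by (intro eventually_ends_off[of I]) auto
  then show ?thesis using riso_UF_honest[OF assms] by (auto simp: cls_iff UF_honest_def)
qed

lemma cls_in_AAut:
  assumes "germ \<phi>" shows "cls \<phi> \<in> carrier AAut"
proof -
  obtain I J where r: "riso \<phi> I J" by (rule germ_riso_ex[OF assms])
  let ?a = "(I \<union> border I, J \<union> border J, restrict \<phi> (V - I))"
  have "?a \<in> honest" using riso_in_cls[OF r] by (simp add: cls_iff)
  then have "almost_eq `` {?a} \<in> honest // almost_eq" by (rule quotientI)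
  then show ?thesis using class_eq_cls[OF riso_in_cls[OF r]] by (simp add: AAut_def)
qed

lemma class_with_member:
  assumes "A \<in> carrier AAut" "(T1, T2, \<phi>) \<in> A"
  shows "A = cls \<phi>"
proof -
  obtain S1 S2 \<psi> where A: "A = almost_eq `` {(S1, S2, \<psi>)}" "(S1, S2, \<psi>) \<in> honest"
    using assms(1) by (auto simp: AAut_def elim!: quotientE)
  then have "((S1, S2, \<psi>), (T1, T2, \<phi>)) \<in> almost_eq" using assms by simp
  then have "(S1, S2, \<psi>) \<in> cls \<phi>" by (simp add: almost_eq_iff cls_iff)
  then show ?thesis using class_eq_cls A by blast
qed

lemma carrier_NF: "carrier (NF F) = cls ` Collect germ"
proof
  show "cls ` Collect germ \<subseteq> carrier (NF F)"
  proof clarify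
    fix \<phi> assume g: "germ \<phi>"
    obtain I J where r: "riso \<phi> I J" by (rule germ_riso_ex[OF g])
    then show "cls \<phi> \<in> carrier (NF F)"
      using cls_in_AAut[OF g] riso_in_cls[OF r] riso_UF_honest[OF r] unfolding NF_def by simp blast
  qed
  show "carrier (NF F) \<subseteq> cls ` Collect germ"
  proof
    fix A assume "A \<in> carrier (NF F)"
    then obtain T1 T2 \<phi> where a: "A \<in> carrier AAut" "(T1, T2, \<phi>) \<in> A" "(T1, T2, \<phi>) \<in> UF_honest F"
      by (auto simp: NF_def)
    then show "A \<in> cls ` Collect germ" using class_with_member UF_honest_germ by blast
  qed
qed

lemma cls_in_NF [simp]: "germ \<phi> \<Longrightarrow> cls \<phi> \<in> carrier (NF F)"
  by (simp add: carrier_NF)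

section \<open>The group of germs\<close>

lemma honest_filterlim: "(T1, T2, \<phi>) \<in> honest \<Longrightarrow> filterlim \<phi> ends ends"
  by (erule honest_bij) (blast intro: bij_filterlim_ends root_closedD(1))

lemma honest_compose:
  assumes "(T2, T3, \<phi>) \<in> honest" "(T1, T2, \<psi>) \<in> honest"
  shows "(T1, T3, compose (outside T1) \<phi> \<psi>) \<in> honest"
proof -
  note a = honestD[OF assms(1)] and b = honestD[OF assms(2)]
  have in': "\<psi> x \<in> outside T2" if "x \<in> outside T1" for x using b(4) that by (auto dest: bij_betwE)
  have "bij_betw (compose (outside T1) \<phi> \<psi>) (outside T1) (outside T3)"
    using bij_betw_compose a(4) b(4) by blast
  then show ?thesis using a b in' by (simp add: honest_def compose_eq)
qed

text \<open>The product in \<open>AAut\<close> collects the composites of all matching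
  representatives. They all have the same germ, and \<open>germ_riso_pair\<close> shows that there
  is at least one of them.\<close>

lemma mult_cls:
  assumes "germ \<phi>" "germ \<psi>"
  shows "cls \<phi> \<otimes>\<^bsub>NF F\<^esub> cls \<psi> = cls (\<phi> \<circ> \<psi>)"
proof -
  let ?S = "{(T1, T3, compose (outside T1) \<alpha> \<beta>) | T1 T2 T3 \<alpha> \<beta>. (T2, T3, \<alpha>) \<in> cls \<phi> \<and> (T1, T2, \<beta>) \<in> cls \<psi>}"
  have S: "a \<in> cls (\<phi> \<circ> \<psi>)" if aS: "a \<in> ?S" for a
  proof -
    obtain T1 T2 T3 \<alpha> \<beta> where a: "a = (T1, T3, compose (outside T1) \<alpha> \<beta>)"
      "(T2, T3, \<alpha>) \<in> honest" "\<forall>\<^sub>F x in ends. \<alpha> x = \<phi> x" "(T1, T2, \<beta>) \<in> honest" "\<forall>\<^sub>F x in ends. \<beta> x = \<psi> x"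
      using aS unfolding cls_iff mem_Collect_eq by blast
    obtain I J where I: "root_closed I" "outside T1 = V - I"
      by (rule honest_bij[OF a(4)]) blast
    have "\<forall>\<^sub>F x in ends. x \<in> V - I" using root_closedD(1)[OF I(1)] by (intro eventually_ends_off[of I]) auto
    moreover have "\<forall>\<^sub>F x in ends. \<alpha> (\<beta> x) = \<phi> (\<beta> x)"
      by (rule eventually_compose_filterlim[OF a(3) honest_filterlim[OF a(4)]])
    ultimately have "\<forall>\<^sub>F x in ends. compose (outside T1) \<alpha> \<beta> x = (\<phi> \<circ> \<psi>) x"
      using a(5) by eventually_elim (simp add: I(2) compose_eq)
    then show ?thesis using honest_compose a by (simp add: cls_iff)
  qed
  obtain I J K where r: "riso \<psi> I J" "riso \<phi> J K" by (rule germ_riso_pair[OF assms])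
  have ne: "(I \<union> border I, K \<union> border K, compose (outside (I \<union> border I)) (restrict \<phi> (V - J)) (restrict \<psi> (V - I))) \<in> ?S"
    using riso_in_cls[OF r(1)] riso_in_cls[OF r(2)] by blast
  have eq: "almost_eq `` {a} = cls (\<phi> \<circ> \<psi>)" if "a \<in> ?S" for a
    using S[OF that] class_eq_cls by (metis prod_cases3)
  have "almost_eq `` ?S = (\<Union>a\<in>?S. almost_eq `` {a})" by blast
  also have "\<dots> = cls (\<phi> \<circ> \<psi>)" using eq ne by (metis (no_types, lifting) SUP_eq_const empty_iff)
  finally show ?thesis by (simp add: NF_def AAut_def)
qed

lemma riso_id: "root_closed J \<Longrightarrow> v0 \<in> J \<Longrightarrow> riso (\<lambda>x. x) J J"
proof -
  assume J: "root_closed J" "v0 \<in> J"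
  have "cloc (\<lambda>x. x) x" if "x \<in> V - J" for x
  proof -
    have "x \<in> V" "x \<noteq> v0" using that J by auto
    then show ?thesis
      using F_id parent_props(6) child_coloursD unfolding cloc_def by (intro conjI bexI[of _ "\<lambda>c\<in>{0..d}. c"]) auto
  qed
  then show ?thesis using J by (auto simp: riso_def bij_betw_def)
qed

lemma germ_id: "germ (\<lambda>x. x)"
  using riso_germ riso_id[OF root_closed_ball root_in_ball] by blast

lemma root_is_closure: "{v0} = {} \<union> border {}" "outside {v0} = V"
proof -
  have rc: "root_closed {}" by (simp add: root_closed_def)
  show 1: "{v0} = {} \<union> border {}" using root by (auto simp: border_def)
  show "outside {v0} = V" using closure_finite_complete(3)[OF rc] 1 by simp
qed

lemma Aut_honest:
  assumes "g \<in> carrier Aut" shows "({v0}, {v0}, g) \<in> honest"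
proof -
  have "root_closed {}" by (simp add: root_closed_def)
  then have "finite_complete {v0}" using closure_finite_complete(1) root_is_closure by fastforce
  then show ?thesis using assms root_is_closure(2) by (simp add: Aut_iff honest_def)
qed

lemma Aut_incl_eq: "g \<in> carrier Aut \<Longrightarrow> Aut_incl g = cls g"
  unfolding Aut_incl_def by (rule class_eq_cls) (simp add: cls_iff Aut_honest)

lemma leaves_root: "leaves {v0} = {v0}"
  using root_is_closure(1) closure_finite_complete(2)[of "{}"] by (simp add: root_closed_def)

lemma subtree_at_root: "subtree_at v0 = V"
  using root by (auto simp: subtree_at_eq)

lemma UF_germ: "g \<in> UF F \<Longrightarrow> germ g"
proof -
  assume g: "g \<in> UF F"
  then have "({v0}, {v0}, g) \<in> UF_honest F"
    using Aut_honest[of g] leaves_root by (auto simp: UF_honest_def UF_def)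
  then show "germ g" by (rule UF_honest_germ)
qed

lemma one_NF: "\<one>\<^bsub>NF F\<^esub> = cls (\<lambda>x. x)"
proof -
  have g: "(\<lambda>x\<in>V. x) \<in> carrier Aut" by (auto simp: Aut_iff bij_betw_def inj_on_def)
  have "\<one>\<^bsub>NF F\<^esub> = Aut_incl (\<lambda>x\<in>V. x)" by (simp add: NF_def AAut_def Aut_incl_def)
  also have "\<dots> = cls (\<lambda>x. x)"
    using Aut_incl_eq[OF g] by (simp, intro cls_eqI eventually_ends_off[of "{}"]) auto
  finally show ?thesis .
qed

lemma group_NF: "group (NF F)"
proof (rule groupI)
  show "\<one>\<^bsub>NF F\<^esub> \<in> carrier (NF F)" using germ_id one_NF by simp
  fix A B C assume A: "A \<in> carrier (NF F)"
  then obtain \<phi> where \<phi>: "germ \<phi>" "A = cls \<phi>" by (auto simp: carrier_NF)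
  show "\<one>\<^bsub>NF F\<^esub> \<otimes>\<^bsub>NF F\<^esub> A = A" using \<phi> germ_id by (simp add: one_NF mult_cls comp_def)
  show "\<exists>y\<in>carrier (NF F). y \<otimes>\<^bsub>NF F\<^esub> A = \<one>\<^bsub>NF F\<^esub>"
  proof -
    obtain \<psi> where \<psi>: "germ \<psi>" "\<forall>\<^sub>F x in ends. \<psi> (\<phi> x) = x" by (rule germ_inverse[OF \<phi>(1)])
    then have "cls \<psi> \<otimes>\<^bsub>NF F\<^esub> A = \<one>\<^bsub>NF F\<^esub>" using \<phi> by (simp add: mult_cls one_NF cls_eqI)
    then show ?thesis using \<psi> by auto
  qed
  assume B: "B \<in> carrier (NF F)"
  then obtain \<psi> where \<psi>: "germ \<psi>" "B = cls \<psi>" by (auto simp: carrier_NF)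
  show "A \<otimes>\<^bsub>NF F\<^esub> B \<in> carrier (NF F)" using \<phi> \<psi> by (simp add: mult_cls germ_comp)
  assume "C \<in> carrier (NF F)"
  then obtain \<theta> where "germ \<theta>" "C = cls \<theta>" by (auto simp: carrier_NF)
  then show "A \<otimes>\<^bsub>NF F\<^esub> B \<otimes>\<^bsub>NF F\<^esub> C = A \<otimes>\<^bsub>NF F\<^esub> (B \<otimes>\<^bsub>NF F\<^esub> C)"
    using \<phi> \<psi> by (simp add: mult_cls germ_comp comp_assoc)
qed

lemma inv_cls:
  assumes "germ \<phi>" "germ \<psi>" "\<forall>\<^sub>F x in ends. \<psi> (\<phi> x) = x"
  shows "inv\<^bsub>NF F\<^esub> (cls \<phi>) = cls \<psi>"
proof -
  interpret group "NF F" by (rule group_NF)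
  have "cls \<psi> \<otimes>\<^bsub>NF F\<^esub> cls \<phi> = \<one>\<^bsub>NF F\<^esub>" using assms by (simp add: mult_cls one_NF cls_eqI)
  then show ?thesis using inv_equality assms by simp
qed

section \<open>An open subgroup of the commutator subgroup\<close>

sublocale N: group "NF F" by (rule group_NF)

abbreviation DN :: "'v forest_map set set" where
  "DN \<equiv> commutator_subgroup (NF F)"

lemma DN_subgroup: "subgroup DN (NF F)"
  by (rule N.derived_is_subgroup) simp

lemma DN_normal: "DN \<lhd> NF F"
  by (rule N.derived_self_is_normal)

text \<open>Membership in U(F) without extensionality, so that maps can be pieced together and
  composed without restricting them to \<open>V\<close>.\<close>

definition F_automorphism :: "('v \<Rightarrow> 'v) \<Rightarrow> bool" where
  "F_automorphism g \<longleftrightarrow> (\<forall>x\<in>V. g x \<in> V \<and> (\<exists>p\<in>F. acts_as g x p))"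

lemma F_automorphism_bij: "F_automorphism g \<Longrightarrow> bij_betw g V V"
  by (rule locally_F_imp_bij) (auto simp: F_automorphism_def)

lemma F_automorphism_germ:
  assumes "F_automorphism g" shows "germ g"
proof -
  have "acts_as (restrict g V) x p" if "acts_as g x p" "x \<in> V" for x p
    using that by (simp add: acts_as_def)
  then have "restrict g V \<in> UF F" using assms unfolding UF_iff F_automorphism_def by fastforce
  then have "germ (restrict g V)" by (rule UF_germ)
  then show ?thesis by (rule germ_cong) (rule eventually_ends_off[of "{}"], auto)
qed

lemma UF_F_automorphism: "g \<in> UF F \<Longrightarrow> F_automorphism g"
  by (auto simp: UF_iff F_automorphism_def)

lemma acts_as_id: "(\<And>c. c \<le> d \<Longrightarrow> g (nbr x c) = nbr x c) \<Longrightarrow> g x = x \<Longrightarrow> acts_as g x (\<lambda>c\<in>{0..d}. c)"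
  by (simp add: acts_as_def)

lemma translation_germ:
  assumes "bij_betw t V V" "\<And>x c. x \<in> V \<Longrightarrow> c \<le> d \<Longrightarrow> t (nbr x c) = nbr (t x) c"
  shows "germ t"
proof (rule F_automorphism_germ)
  have "acts_as t x (\<lambda>c\<in>{0..d}. c)" if "x \<in> V" for x using assms(2) that by (simp add: acts_as_def)
  then show "F_automorphism t" using F_id bij_betwE[OF assms(1)] unfolding F_automorphism_def by blast
qed

lemma hd_code_nbr:
  assumes "y \<in> V" "y \<noteq> v0" "c \<le> d" "nbr y c \<noteq> v0"
  shows "hd (code (nbr y c)) = hd (code y)"
proof (cases "c \<in> child_colours y")
  case True
  then show ?thesis using assms code_child code_Nil_iff by simp
next
  case False
  then have "nbr y c = parent y" using assms parent_props(4)[of y] by (auto simp: child_colours_eq)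
  then show ?thesis using assms parent_props(1,5)[of y] code_Nil_iff[of "parent y"] by simp
qed

lemma code_nbr_root: "c \<le> d \<Longrightarrow> code (nbr v0 c) = [c]"
  using code_walk[of "[c]"] by simp

text \<open>Translate the branch of colour \<open>c\<close> at \<open>v0\<close> along the line through \<open>v0\<close> whose edges have the
  colours \<open>a\<close> and \<open>b\<close> alternately: \<open>k\<close> is the commutator of the translation and the product of all
  translated copies of \<open>k\<close>.\<close>

lemma branch_automorphism_in_DN:
  assumes k: "F_automorphism k" and c: "c \<le> d"
    and fix_off: "\<And>y. y \<in> V \<Longrightarrow> y = v0 \<or> hd (code y) \<noteq> c \<Longrightarrow> k y = y"
    and fix_x: "k (nbr v0 c) = nbr v0 c"
  shows "cls k \<in> DN"
proof -
  define T where "T = {y \<in> V. y \<noteq> v0 \<and> hd (code y) = c}"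
  obtain a b where ab: "a \<le> d" "b \<le> d" "a \<noteq> b" "a \<noteq> c" "b \<noteq> c" using third_colour by metis
  \<comment> \<open>The colours of the line have period two, so a colour-preserving translation
    along it moves the root by two edges.\<close>
  have "nbr (nbr v0 a) b \<in> V" using ab root by simp
  then obtain t where t: "bij_betw t V V" "t v0 = nbr (nbr v0 a) b"
    "\<And>x c. x \<in> V \<Longrightarrow> c \<le> d \<Longrightarrow> t (nbr x c) = nbr (t x) c"
    using translation_exists[OF root] by metis
  have tV: "t y \<in> V" if "y \<in> V" for y using bij_betwE[OF t(1)] that by blast
  have tnV: "(t ^^ n) y \<in> V" if "y \<in> V" for n y using that tV by (induction n) auto
  have tn_nbr: "(t ^^ n) (nbr x e) = nbr ((t ^^ n) x) e" if "x \<in> V" "e \<le> d" for n x e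
    using that tnV t(3) by (induction n) auto
  have tinj: "x = y" if "t x = t y" "x \<in> V" "y \<in> V" for x y
    using t(1) that by (auto simp: bij_betw_def inj_on_def)
  have tninj: "x = y" if "(t ^^ n) x = (t ^^ n) y" "x \<in> V" "y \<in> V" for n x y
    using that by (induction n) (auto dest: tinj simp: tnV)
  \<comment> \<open>No cancellation occurs in front of a code that does not begin with
    \<open>b\<close>. So all proper translates of the root and of the branch lie in the branch of
    colour \<open>a\<close>, which gives their disjointness.\<close>
  have t_hd: "t y \<noteq> v0 \<and> hd (code (t y)) = a" if y: "y \<in> V" "y = v0 \<or> hd (code y) \<noteq> b" for y
  proof -
    have r: "reduced (code y)" using y by simp
    then have s: "set (code y) \<subseteq> {0..d}" by (simp add: reduced_def)
    have "t y = walk (t v0) (code y)"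
      using walk_colour_preserving[of t v0 "code y"] t(3) root s y by simp
    then have "t y = walk v0 (a # b # code y)" using t(2) by simp
    moreover have "reduced (a # b # code y)" using ab r y code_Nil_iff by (auto simp: reduced_Cons)
    ultimately have "code (t y) = a # b # code y" by (metis code_walk)
    then show ?thesis by (metis code_root list.distinct(1) list.sel(1))
  qed
  have tn_hd: "t ((t ^^ n) y) \<noteq> v0 \<and> hd (code (t ((t ^^ n) y))) = a" if "y \<in> V" "y = v0 \<or> hd (code y) \<noteq> b" for n y
  proof (induction n)
    case 0
    then show ?case using t_hd that by simp
  next
    case (Suc n)
    then show ?case using t_hd[of "t ((t ^^ n) y)"] tV[OF tnV[OF that(1)]] ab by simp
  qed
  \<comment> \<open>The root is added to the branch because it is the one outside neighbour of it;
    checking local actions of \<open>h\<close> on a copy involves the translates of both.\<close>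
  let ?T = "insert v0 T"
  have TV: "z \<in> V" "z = v0 \<or> hd (code z) \<noteq> b" if "z \<in> ?T" for z using that root ab by (auto simp: T_def)
  have disj: "t ((t ^^ n) z) \<notin> ?T" if "z \<in> ?T" for n z
    using tn_hd[OF TV[OF that]] ab by (auto simp: T_def)
  have inj: "n = m \<and> z = z'" if z: "z \<in> ?T" "z' \<in> ?T" "(t ^^ n) z = (t ^^ m) z'" for n m z z'
  proof -
    have *: "n = m \<and> z = z'" if "z \<in> ?T" "z' \<in> ?T" "(t ^^ n) z = (t ^^ m) z'" "n \<le> m" for n m z z'
    proof -
      have "(t ^^ m) z' = (t ^^ n) ((t ^^ (m - n)) z')"
        using that(4) by (metis add_diff_inverse_nat funpow_add comp_apply not_less)
      then have e: "z = (t ^^ (m - n)) z'" using tninj[of n] that TV tnV by metis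
      then have "m - n = 0" using disj[OF that(2)] that(1) by (cases "m - n") auto
      then show ?thesis using e that(4) by simp
    qed
    show ?thesis using *[OF z] *[OF z(2) z(1) z(3)[symmetric]] by (cases "n \<le> m") auto
  qed
  obtain h where h: "\<And>n z. z \<in> T \<Longrightarrow> h ((t ^^ n) z) = (t ^^ n) (k z)"
    and h_off: "\<And>y. (\<And>n z. z \<in> T \<Longrightarrow> y \<noteq> (t ^^ n) z) \<Longrightarrow> h y = y"
    using product_of_shifted_copies[of T t k] inj by blast
  have kV: "k y \<in> V" if "y \<in> V" for y using k that by (auto simp: F_automorphism_def)
  have kinj: "x = y" if "k x = k y" "x \<in> V" "y \<in> V" for x y
    using F_automorphism_bij[OF k] that by (auto simp: bij_betw_def inj_on_def)
  have k_off: "k y = y" if "y \<in> V" "y \<notin> T" for y using fix_off that by (auto simp: T_def)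
  have kT: "k y \<in> T" if "y \<in> T" for y
  proof (rule ccontr)
    assume n: "k y \<notin> T"
    then have "k (k y) = k y" using k_off kV that by (simp add: T_def)
    then have "k y = y" using kinj kV that by (simp add: T_def)
    then show False using n that by simp
  qed
  have h': "h ((t ^^ n) z) = (t ^^ n) (k z)" if "z \<in> ?T" for n z
  proof (cases "z = v0")
    case True
    have "v0 \<notin> T" by (simp add: T_def)
    then have "h ((t ^^ n) v0) = (t ^^ n) v0" using inj[of v0 _ n] by (intro h_off) blast
    then show ?thesis using True k_off[OF root \<open>v0 \<notin> T\<close>] by simp
  qed (use h that in simp)
  have T_nbr: "nbr z e \<in> ?T" if "z \<in> T" "e \<le> d" for z e
    using that hd_code_nbr[of z e] by (auto simp: T_def)
  have Fh: "F_automorphism h"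
    unfolding F_automorphism_def
  proof (intro ballI)
    fix y assume y: "y \<in> V"
    show "h y \<in> V \<and> (\<exists>p\<in>F. acts_as h y p)"
    proof (cases "\<exists>n. \<exists>z\<in>T. y = (t ^^ n) z")
      case True
      then obtain n z where z: "z \<in> T" "y = (t ^^ n) z" by blast
      have zV: "z \<in> V" using z by (simp add: T_def)
      obtain p where p: "p \<in> F" "acts_as k z p" using k zV by (auto simp: F_automorphism_def)
      have hy: "h y = (t ^^ n) (k z)" using h z by simp
      have "acts_as h y p"
        unfolding acts_as_def
      proof (intro allI impI)
        fix e assume e: "e \<le> d"
        have "h (nbr y e) = h ((t ^^ n) (nbr z e))" using tn_nbr zV e z by simp
        also have "\<dots> = (t ^^ n) (k (nbr z e))" using h' T_nbr z e by blast
        also have "\<dots> = nbr ((t ^^ n) (k z)) (p e)"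
          using acts_asD[OF p(2) e] tn_nbr[OF kV[OF zV] F_le[OF p(1) e]] by simp
        finally show "h (nbr y e) = nbr (h y) (p e)" using hy by simp
      qed
      then show ?thesis using hy p tnV kV zV by auto
    next
      case False
      then have hy: "h y = y" by (intro h_off) blast
      have "h (nbr y e) = nbr y e" if e: "e \<le> d" for e
      proof (cases "\<exists>n. \<exists>z\<in>T. nbr y e = (t ^^ n) z")
        case True
        then obtain n z where z: "z \<in> T" "nbr y e = (t ^^ n) z" by blast
        have zV: "z \<in> V" using z by (simp add: T_def)
        have "y = nbr (nbr y e) e" using y e by simp
        also have "\<dots> = (t ^^ n) (nbr z e)" using z tn_nbr zV e by simp
        \<comment> \<open>An edge from outside into a copy must start at a translate of the root and
          end at the translated top vertex of the branch, which \<open>h\<close> fixes by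
          \<open>fix_x\<close>.\<close>
        finally have "nbr z e = v0" using False T_nbr[OF z(1) e] by blast
        then have "z = nbr v0 e" using zV e by (metis nbr_nbr)
        moreover have "e = c" using \<open>z = nbr v0 e\<close> z e code_nbr_root by (simp add: T_def)
        ultimately show ?thesis using h z fix_x by simp
      qed (intro h_off, blast)
      then show ?thesis using hy y acts_as_id F_id by metis
    qed
  qed
  \<comment> \<open>Conjugating \<open>h\<close> by \<open>t\<close> shifts every factor by one, so
    only the factor with \<open>n = 0\<close> is lost, and that factor is \<open>k\<close>.\<close>
  have eq: "h (t y) = k (t (h y))" if y: "y \<in> V" for y
  proof (cases "\<exists>n. \<exists>z\<in>T. y = (t ^^ n) z")
    case True
    then obtain n z where z: "z \<in> T" "y = (t ^^ n) z" by blast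
    have "h (t y) = t ((t ^^ n) (k z))" using h[OF z(1), of "Suc n"] z by simp
    moreover have "t ((t ^^ n) (k z)) \<notin> T" "t ((t ^^ n) (k z)) \<in> V"
      using disj[of "k z" n] kT[OF z(1)] TV(1)[of "k z"] tV[OF tnV] by auto
    moreover have "t (h y) = t ((t ^^ n) (k z))" using h z by simp
    ultimately show ?thesis using k_off by simp
  next
    case False
    then have hy: "h y = y" by (intro h_off) blast
    show ?thesis
    proof (cases "t y \<in> T")
      case True
      then show ?thesis using h[OF True, of 0] hy by simp
    next
      case nT: False
      have "t y \<noteq> (t ^^ n) z" if zT: "z \<in> T" for n z
      proof
        assume e: "t y = (t ^^ n) z"
        then obtain m where "n = Suc m" using nT zT by (cases n) auto
        then have "y = (t ^^ m) z" using e tinj[of y "(t ^^ m) z"] y tnV that by (simp add: T_def)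
        then show False using False that by blast
      qed
      then have "h (t y) = t y" by (rule h_off)
      then show ?thesis using hy k_off[OF tV[OF y] nT] by simp
    qed
  qed
  have g: "germ h" "germ t" "germ k"
    using F_automorphism_germ Fh k translation_germ t by auto
  have "cls (h \<circ> t) = cls (k \<circ> (t \<circ> h))" by (rule cls_eqI, rule eventually_ends_off[of "{}"]) (auto simp: eq)
  then have "cls h \<otimes>\<^bsub>NF F\<^esub> cls t = cls k \<otimes>\<^bsub>NF F\<^esub> (cls t \<otimes>\<^bsub>NF F\<^esub> cls h)"
    using g by (simp add: mult_cls germ_comp)
  then show ?thesis using N.commutator_in_derived[of "cls h" "cls t" "cls k"] g by simp
qed

text \<open>The map is the product of its restrictions to the branches at the root. Fixing the
  1-ball makes each restriction, extended by the identity, again an automorphism with local actions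
  in \<open>F\<close>.\<close>

lemma ball_fixator_in_DN:
  assumes k: "F_automorphism k" and k0: "k v0 = v0" and k1: "\<And>c. c \<le> d \<Longrightarrow> k (nbr v0 c) = nbr v0 c"
  shows "cls k \<in> DN"
proof -
  define part where "part C y = (if y \<noteq> v0 \<and> hd (code y) \<in> C then k y else y)" for C y
  have kV: "k y \<in> V" if "y \<in> V" for y using k that by (auto simp: F_automorphism_def)
  have kinj: "x = y" if "k x = k y" "x \<in> V" "y \<in> V" for x y
    using F_automorphism_bij[OF k] that by (auto simp: bij_betw_def inj_on_def)
  \<comment> \<open>Each branch at the root is preserved; otherwise the partial maps would not
    compose to the map on the union of the branches.\<close>
  have k_hd: "y \<noteq> v0 \<longrightarrow> k y \<noteq> v0 \<and> hd (code (k y)) = hd (code y)" if "y \<in> V" for y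
    using that
  proof (induction rule: vertex_induct)
    case (child y c)
    have c: "c \<le> d" using child child_coloursD by blast
    have ne: "nbr y c \<noteq> v0" using child child_neq_root by blast
    then have kne: "k (nbr y c) \<noteq> v0" using kinj[of "nbr y c" v0] k0 c child root by auto
    show ?case
    proof (cases "y = v0")
      case True
      then show ?thesis using k1 c ne by simp
    next
      case False
      obtain p where p: "p \<in> F" "acts_as k y p" using k child by (auto simp: F_automorphism_def)
      have "hd (code (k (nbr y c))) = hd (code (k y))"
        using hd_code_nbr[of "k y" "p c"] kV F_le p c kne child.IH child.hyps False acts_asD[OF p(2) c] by simp
      then show ?thesis using kne child.IH False hd_code_nbr[OF child.hyps(1) False c ne] by simp
    qed
  qed simp
  have F_part: "F_automorphism (part C)" for C
    unfolding F_automorphism_def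
  proof (intro ballI conjI)
    fix y assume y: "y \<in> V"
    show "part C y \<in> V" using y kV by (simp add: part_def)
    show "\<exists>p\<in>F. acts_as (part C) y p"
    proof (cases "y \<noteq> v0 \<and> hd (code y) \<in> C")
      case True
      obtain p where p: "p \<in> F" "acts_as k y p" using k y by (auto simp: F_automorphism_def)
      have "part C (nbr y c) = k (nbr y c)" if "c \<le> d" for c
        using hd_code_nbr[of y c] True y that k0 by (cases "nbr y c = v0") (auto simp: part_def)
      then have "acts_as (part C) y p" using p(2) True by (simp add: acts_as_def part_def)
      then show ?thesis using p by blast
    next
      case False
      have "part C (nbr y c) = nbr y c" if "c \<le> d" for c
        using hd_code_nbr[of y c] False y that k1 by (cases "y = v0") (auto simp: part_def)
      moreover have "part C y = y" using False by (auto simp: part_def)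
      ultimately show ?thesis using acts_as_id F_id by metis
    qed
  qed
  have "cls (part C) \<in> DN" if "finite C" "C \<subseteq> {0..d}" for C
    using that
  proof (induction C)
    case empty
    have "cls (part {}) = \<one>\<^bsub>NF F\<^esub>" unfolding one_NF by (rule cls_eqI) (simp add: part_def)
    then show ?case using subgroup.one_closed[OF DN_subgroup] by simp
  next
    case (insert c C)
    have "cls (part {c}) \<in> DN"
      using insert.prems k1 F_part by (intro branch_automorphism_in_DN[of _ c]) (auto simp: part_def)
    then have "cls (part C) \<otimes>\<^bsub>NF F\<^esub> cls (part {c}) \<in> DN"
      using insert subgroup.m_closed[OF DN_subgroup] by blast
    moreover have "cls (part C) \<otimes>\<^bsub>NF F\<^esub> cls (part {c}) = cls (part C \<circ> part {c})"
      using mult_cls F_part F_automorphism_germ by blast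
    moreover have "cls (part C \<circ> part {c}) = cls (part (insert c C))"
      using insert(2) k_hd by (intro cls_eqI eventually_ends_off[of "{}"]) (auto simp: part_def)
    ultimately show ?case by simp
  qed
  then have "cls (part {0..d}) \<in> DN" by blast
  moreover have "cls (part {0..d}) = cls k"
  proof (intro cls_eqI eventually_ends_off[of "{}"])
    fix y assume "y \<in> V - {}"
    then have "hd (code y) \<le> d" if "y \<noteq> v0"
      using that code(1)[of y] code_Nil_iff[of y] by (metis Diff_empty hd_in_set reduced_set)
    then show "part {0..d} y = k y" using k0 by (cases "y = v0") (simp_all add: part_def)
  qed simp
  ultimately show ?thesis by simp
qed

lemma fixator_open:
  assumes "finite A" "A \<subseteq> V"
  shows "openin (UF_topology F) (UF F \<inter> fixator A {})"
proof -
  have one: "(\<lambda>x\<in>V. x) \<in> carrier Aut" by (auto simp: Aut_iff bij_betw_def inj_on_def)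
  have "(\<lambda>x\<in>V. x) \<otimes>\<^bsub>Aut\<^esub> h = h" if "h \<in> carrier Aut" for h
  proof -
    have "h \<in> Bij V" using that by (simp add: Aut_def)
    then show ?thesis by (simp add: Aut_def BijGroup_def id_Bij Bij_imp_funcset Bij_imp_extensional)
  qed
  then have "(\<lambda>x\<in>V. x) <#\<^bsub>Aut\<^esub> fixator A {} = fixator A {}"
    by (auto simp: l_coset_def fixator_def)
  then have "fixator A {} \<in> {g <#\<^bsub>Aut\<^esub> fixator A B | g A B.
        g \<in> carrier Aut \<and> A \<subseteq> V \<and> finite A \<and> B \<subseteq> E \<and> finite B}"
    using one assms by (intro CollectI exI[of _ "\<lambda>x\<in>V. x"] exI[of _ A] exI[of _ "{}"]) auto
  then have "openin Aut_topology (fixator A {})" unfolding Aut_topology_def by (rule topology_generated_by_Basis)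
  then show ?thesis unfolding UF_topology_def openin_subtopology by (metis inf_commute)
qed

lemma DN_open:
  assumes "NF_topology F \<tau>" shows "openin \<tau> DN"
proof (rule N.open_subgroup)
  let ?A = "insert v0 (nbr v0 ` {0..d})"
  let ?U = "UF F \<inter> fixator ?A {}"
  show "group_topology (NF F) \<tau>" using assms by (simp add: NF_topology_def)
  show "subgroup DN (NF F)" by (rule DN_subgroup)
  have "openin (UF_topology F) ?U" using root by (intro fixator_open) auto
  then show "openin \<tau> (Aut_incl ` ?U)" using assms by (simp add: NF_topology_def open_map_def)
  show "Aut_incl ` ?U \<subseteq> DN"
  proof clarify
    fix g assume g: "g \<in> UF F" "g \<in> fixator ?A {}"
    then have "Aut_incl g = cls g" by (intro Aut_incl_eq) (simp add: UF_def)
    then show "Aut_incl g \<in> DN"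
      using g UF_F_automorphism by (auto simp: fixator_def intro!: ball_fixator_in_DN)
  qed
  show "\<one>\<^bsub>NF F\<^esub> \<in> Aut_incl ` ?U"
  proof -
    let ?i = "\<lambda>x\<in>V. x"
    have c: "?i \<in> carrier Aut" by (auto simp: Aut_iff bij_betw_def inj_on_def)
    have "acts_as ?i x (\<lambda>c\<in>{0..d}. c)" if "x \<in> V" for x using that by (simp add: acts_as_def)
    then have "?i \<in> UF F" using F_id by (auto simp: UF_iff)
    moreover have "?i \<in> fixator ?A {}" using c root by (auto simp: fixator_def)
    moreover have "Aut_incl ?i = \<one>\<^bsub>NF F\<^esub>"
      unfolding Aut_incl_eq[OF c] one_NF by (rule cls_eqI, rule eventually_ends_off[of "{}"]) auto
    ultimately show ?thesis by (metis IntI imageI)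
  qed
qed

section \<open>Almost automorphisms modulo commutators and their leaf maps\<close>

lemma border_nbr:
  assumes "root_closed J" "v0 \<in> J" "x \<in> J" "c \<le> d" shows "nbr x c \<in> J \<union> border J"
proof -
  have x: "x \<in> V" using assms root_closedD by blast
  show ?thesis
  proof (cases "c \<in> child_colours x")
    case True
    then show ?thesis using parent_nbr[of x c] x assms by (auto simp: border_def)
  next
    case False
    then have "x \<noteq> v0" "nbr x c = parent x" using parent_props(4)[of x] x assms by (auto simp: child_colours_eq split: if_splits)
    then show ?thesis using root_closedD(3) assms by auto
  qed
qed

lemma riso_border:
  assumes "riso \<phi> I J" "x \<in> border I" shows "\<phi> x \<in> border J"
proof -
  note r = risoD[OF assms(1)]
  have x: "x \<in> V" "x \<notin> I" "x \<noteq> v0" "parent x \<in> I" using assms(2) r(3) by (auto simp: border_def)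
  have fx: "\<phi> x \<in> V - J" "\<phi> x \<noteq> v0" using r(7) clocD(3) r(6) x by blast+
  have "parent (\<phi> x) \<in> J"
  proof (rule ccontr)
    assume n: "parent (\<phi> x) \<notin> J"
    have "parent (\<phi> x) \<in> V" "\<phi> x \<in> children (parent (\<phi> x))"
      using parent_props(1)[of "\<phi> x"] fx by (auto simp: child_iff_parent)
    then obtain x' where x': "x' \<in> V - I" "parent (\<phi> x) = \<phi> x'"
      using n r(5) by (metis DiffI bij_betw_def imageE)
    then have "\<phi> x \<in> \<phi> ` children x'"
      using cloc_children[of \<phi> x'] r(6) \<open>\<phi> x \<in> children (parent (\<phi> x))\<close> by auto
    then obtain y where y: "y \<in> children x'" "\<phi> x = \<phi> y" by blast
    then have "y \<in> V - I" using child_notin[OF r(1)] x' children_eq by auto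
    then have "x = y" using y r(5) x by (auto simp: bij_betw_def inj_on_def)
    then have "parent x = x'" using y by (simp add: child_iff_parent)
    then show False using x x' by blast
  qed
  then show ?thesis using fx by (simp add: border_def)
qed

text \<open>Extend by the identity inside the tree. At a leaf this gives a correct local action
  because \<open>cloc\<close> matches the parent colour of the leaf with that of its image, here the
  same leaf. The extension fixes the tree and therefore the 1-ball.\<close>

lemma border_fixing_in_DN:
  assumes r: "riso \<phi> J J" and fixes_border: "\<And>x. x \<in> border J \<Longrightarrow> \<phi> x = x"
  shows "cls \<phi> \<in> DN"
proof -
  note rD = risoD[OF r]
  define k where "k y = (if y \<in> J then y else \<phi> y)" for y
  have k_fix: "k y = y" if "y \<in> J \<union> border J" for y using that fixes_border by (auto simp: k_def)
  have "F_automorphism k"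
    unfolding F_automorphism_def
  proof (intro ballI)
    fix y assume y: "y \<in> V"
    show "k y \<in> V \<and> (\<exists>p\<in>F. acts_as k y p)"
    proof (cases "y \<in> J")
      case True
      then have "acts_as k y (\<lambda>c\<in>{0..d}. c)" using k_fix border_nbr[OF rD(2,4) True] by (intro acts_as_id) auto
      then show ?thesis using F_id y True by (auto simp: k_def)
    next
      case False
      then have cy: "cloc \<phi> y" using rD(6) y by blast
      note cD = clocD[OF cy]
      obtain p where p: "p \<in> F" "p (parent_colour y) = parent_colour (\<phi> y)"
        "\<And>c. c \<in> child_colours y \<Longrightarrow> \<phi> (nbr y c) = nbr (\<phi> y) (p c)"
        using clocE cy by blast
      have "k (nbr y c) = nbr (k y) (p c)" if c: "c \<le> d" for c
      proof (cases "c \<in> child_colours y")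
        case True
        then show ?thesis using p(3) child_notin[OF rD(1) y False True] False by (simp add: k_def)
      next
        case c': False
        then have cc: "c = parent_colour y" using c y cD by (simp add: child_colours_eq)
        then have n: "nbr y c = parent y" using parent_props y cD by blast
        have e: "nbr (\<phi> y) (p c) = parent (\<phi> y)" using parent_props(4)[of "\<phi> y"] p cc cD by simp
        show ?thesis
        proof (cases "parent y \<in> J")
          case True
          then have "\<phi> y = y" using fixes_border False y by (simp add: border_def)
          then show ?thesis using True n e False by (simp add: k_def)
        next
          case nJ: False
          then have "parent (\<phi> y) = \<phi> (parent y)"
            using parent_cloc(3) rD(6) parent_props(1) y cD by blast
          then show ?thesis using nJ n e False by (simp add: k_def)
        qed
      qed
      then show ?thesis using p(1) False cD by (auto simp: k_def acts_as_def)
    qed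
  qed
  then have "cls k \<in> DN"
    using k_fix rD(2,4) border_nbr by (intro ball_fixator_in_DN) auto
  moreover have "cls k = cls \<phi>"
    using root_closedD(1)[OF rD(1)] by (intro cls_eqI eventually_ends_off[of J]) (auto simp: k_def)
  ultimately show ?thesis by simp
qed

lemma same_border_map:
  assumes "riso \<phi> I J" "riso \<psi> I J" "\<And>x. x \<in> border I \<Longrightarrow> \<phi> x = \<psi> x"
  shows "\<exists>x\<in>DN. cls \<phi> = x \<otimes>\<^bsub>NF F\<^esub> cls \<psi>"
proof -
  let ?\<chi> = "inv_into (V - I) \<psi>"
  note rD = risoD[OF assms(2)]
  have r: "riso ?\<chi> J I" by (rule riso_inv[OF assms(2)])
  have bwd: "\<psi> (?\<chi> x) = x" if "x \<in> V - J" for x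
    using rD(5) that by (auto simp: bij_betw_def intro!: f_inv_into_f)
  have fwd: "?\<chi> (\<psi> x) = x" if "x \<in> V - I" for x
    using rD(5) that by (auto simp: bij_betw_def)
  have "cls (\<phi> \<circ> ?\<chi>) \<in> DN"
  proof (rule border_fixing_in_DN)
    show "riso (\<phi> \<circ> ?\<chi>) J J" using riso_comp r assms(1) by blast
    fix x assume x: "x \<in> border J"
    then have "?\<chi> x \<in> border I" using riso_border r by blast
    then show "(\<phi> \<circ> ?\<chi>) x = x" using assms(3) bwd x by (simp add: border_def)
  qed
  moreover have "cls (\<phi> \<circ> ?\<chi>) \<otimes>\<^bsub>NF F\<^esub> cls \<psi> = cls (\<phi> \<circ> ?\<chi> \<circ> \<psi>)"
    by (intro mult_cls germ_comp riso_germ[OF assms(1)] riso_germ[OF assms(2)] riso_germ[OF r])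
  moreover have "cls (\<phi> \<circ> ?\<chi> \<circ> \<psi>) = cls \<phi>"
    using root_closedD(1)[OF rD(1)] fwd by (intro cls_eqI eventually_ends_off[of I]) auto
  ultimately show ?thesis by (intro bexI[of _ "cls (\<phi> \<circ> ?\<chi>)"]) simp_all
qed

lemma orbit_image: "p \<in> F \<Longrightarrow> \<chi> \<le> d \<Longrightarrow> colour_orbit F (p \<chi>) = colour_orbit F \<chi>"
proof -
  assume p: "p \<in> F" and \<chi>: "\<chi> \<le> d"
  obtain q where q: "q \<in> F" "\<And>c. c \<le> d \<Longrightarrow> q (p c) = c" using F_inv p by metis
  have "s (p \<chi>) \<in> colour_orbit F \<chi>" if "s \<in> F" for s
    using F_comp[OF that p] \<chi> unfolding colour_orbit_def
    by (intro CollectI exI[of _ "compose {0..d} s p"]) (simp add: compose_def)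
  moreover have "s \<chi> \<in> colour_orbit F (p \<chi>)" if "s \<in> F" for s
    using F_comp[OF that q(1)] q(2)[OF \<chi>] F_le[OF p \<chi>] unfolding colour_orbit_def
    by (intro CollectI exI[of _ "compose {0..d} s q"]) (simp add: compose_def)
  ultimately show ?thesis by (auto simp: colour_orbit_def)
qed

lemma eventually_ends_children:
  assumes "eventually P ends"
  shows "\<forall>\<^sub>F x in ends. P x \<and> (\<forall>c\<in>child_colours x. P (nbr x c))"
proof -
  obtain n where "n > 0" "\<And>x. x \<in> V - ball n \<Longrightarrow> P x" using assms by (auto simp: eventually_ends_ball)
  then show ?thesis
    unfolding eventually_ends_ball using child_notin[OF root_closed_ball, of _ n] by (intro exI[of _ n]) auto
qed

section \<open>Counting the leaves of each label\<close>

abbreviation orb :: "'v \<Rightarrow> nat set" where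
  "orb x \<equiv> colour_orbit F (parent_colour x)"

lemma cloc_orb: "cloc \<phi> x \<Longrightarrow> x \<in> V \<Longrightarrow> orb (\<phi> x) = orb x"
proof -
  assume c: "cloc \<phi> x" and x: "x \<in> V"
  obtain p where p: "p \<in> F" "p (parent_colour x) = parent_colour (\<phi> x)" using clocE[OF c] by blast
  show ?thesis using orbit_image[OF p(1) parent_props(6)[OF x clocD(1)[OF c]]] p(2) by simp
qed

text \<open>Both sides count the pairs of an interior vertex and an outgoing edge with colour in \<open>C\<close>: such
  an edge leads to a leaf, or it is traversed in one of its two directions between interior vertices.\<close>

lemma count_edges:
  assumes J: "root_closed J" "v0 \<in> J" and C: "C \<subseteq> {0..d}"
  shows "card J * card C =
    card {y \<in> border J. parent_colour y \<in> C} + 2 * card {x \<in> J - {v0}. parent_colour x \<in> C}"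
proof -
  let ?L = "{y \<in> border J. parent_colour y \<in> C}" and ?M = "{x \<in> J - {v0}. parent_colour x \<in> C}"
  \<comment> \<open>The first set consists of the steps to a child and reaches every leaf and every
    interior vertex other than the root once, subject to the colour; the second consists of the
    steps to the parent.\<close>
  let ?S1 = "{(x, c). x \<in> J \<and> c \<in> C \<and> c \<in> child_colours x}"
  let ?S2 = "{(x, c). x \<in> J \<and> c \<in> C \<and> c \<notin> child_colours x}"
  have fin: "finite J" "finite C" "finite (border J)" and JV: "J \<subseteq> V"
    using J C root_closedD border_finite finite_subset by blast+
  have "bij_betw (\<lambda>(x, c). nbr x c) ?S1 (?L \<union> ?M)"
  proof (rule bij_betw_byWitness[where f' = "\<lambda>y. (parent y, parent_colour y)"])
    show "\<forall>a\<in>?S1. (\<lambda>y. (parent y, parent_colour y)) ((\<lambda>(x, c). nbr x c) a) = a"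
      using JV parent_nbr parent_colour_nbr by auto
    have yV: "y \<in> V \<and> y \<noteq> v0 \<and> parent y \<in> J" if "y \<in> ?L \<union> ?M" for y
      using that J JV root_closedD(3)[OF J(1)] by (auto simp: border_def)
    show "\<forall>y\<in>?L \<union> ?M. (\<lambda>(x, c). nbr x c) (parent y, parent_colour y) = y"
    proof (intro ballI)
      fix y assume "y \<in> ?L \<union> ?M"
      then have "y \<in> V \<and> y \<noteq> v0" using yV by blast
      then show "(\<lambda>(x, c). nbr x c) (parent y, parent_colour y) = y" using parent_props(3) by simp
    qed
    show "(\<lambda>(x, c). nbr x c) ` ?S1 \<subseteq> ?L \<union> ?M"
    proof (intro image_subsetI)
      fix a assume "a \<in> ?S1"
      then obtain x c where a: "a = (x, c)" "x \<in> J" "c \<in> C" "c \<in> child_colours x" by blast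
      then have "nbr x c \<in> J \<union> border J" using border_nbr[OF J] child_coloursD by blast
      moreover have "parent_colour (nbr x c) = c" "nbr x c \<noteq> v0"
        using parent_colour_nbr child_neq_root JV a by blast+
      ultimately show "(\<lambda>(x, c). nbr x c) a \<in> ?L \<union> ?M" using a by auto
    qed
    show "(\<lambda>y. (parent y, parent_colour y)) ` (?L \<union> ?M) \<subseteq> ?S1"
      using yV parent_props(2) by auto
  qed
  then have "card ?S1 = card (?L \<union> ?M)" by (rule bij_betw_same_card)
  also have "\<dots> = card ?L + card ?M"
  proof (rule card_Un_disjoint)
    show "finite ?L" "finite ?M" using fin by simp_all
  qed (auto simp: border_def)
  finally have 1: "card ?S1 = card ?L + card ?M" .
  have "bij_betw fst ?S2 ?M"
  proof (rule bij_betw_byWitness[where f' = "\<lambda>x. (x, parent_colour x)"])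
    have *: "x \<noteq> v0 \<and> c = parent_colour x" if "x \<in> J" "c \<in> C" "c \<notin> child_colours x" for x c
    proof -
      have "x \<in> V" "c \<in> {0..d}" using that C JV by blast+
      then show ?thesis using that(3) child_colours_eq[of x] by (auto split: if_splits)
    qed
    show "\<forall>a\<in>?S2. (\<lambda>x. (x, parent_colour x)) (fst a) = a"
    proof (intro ballI)
      fix a assume "a \<in> ?S2"
      then obtain x c where a: "a = (x, c)" "x \<in> J" "c \<in> C" "c \<notin> child_colours x" by blast
      then show "(\<lambda>x. (x, parent_colour x)) (fst a) = a" using *[OF a(2-4)] by simp
    qed
    show "fst ` ?S2 \<subseteq> ?M"
    proof (intro image_subsetI)
      fix a assume "a \<in> ?S2"
      then obtain x c where a: "a = (x, c)" "x \<in> J" "c \<in> C" "c \<notin> child_colours x" by blast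
      then show "fst a \<in> ?M" using *[OF a(2-4)] by simp
    qed
    show "(\<lambda>x. (x, parent_colour x)) ` ?M \<subseteq> ?S2"
    proof (intro image_subsetI)
      fix x assume x: "x \<in> ?M"
      then have "x \<in> V" using JV by blast
      then show "(x, parent_colour x) \<in> ?S2" using x by (simp add: child_colours_eq)
    qed
  qed auto
  then have 2: "card ?S2 = card ?M" by (rule bij_betw_same_card)
  have "finite (J \<times> C)" using fin by simp
  then have "card (J \<times> C) = card ?S1 + card ?S2"
    by (subst card_Un_disjoint[symmetric]) (auto intro: finite_subset[of _ "J \<times> C"] intro!: arg_cong[of _ _ card])
  then show ?thesis using 1 2 by (simp add: card_cartesian_product)
qed

lemma riso_border_bij:
  assumes "riso \<phi> I J" shows "bij_betw \<phi> (border I) (border J)"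
proof -
  note r = risoD[OF assms]
  have "\<phi> ` border I = border J"
  proof
    show "\<phi> ` border I \<subseteq> border J" using riso_border[OF assms] by blast
    show "border J \<subseteq> \<phi> ` border I"
    proof
      fix y assume y: "y \<in> border J"
      then have "inv_into (V - I) \<phi> y \<in> border I" using riso_border[OF riso_inv[OF assms]] by blast
      moreover have "\<phi> (inv_into (V - I) \<phi> y) = y"
        using bij_betw_inv_into_right[OF r(5)] y by (simp add: border_def)
      ultimately show "y \<in> \<phi> ` border I" by force
    qed
  qed
  moreover have "inj_on \<phi> (border I)"
    using r(5) by (auto simp: bij_betw_def border_def intro: inj_on_subset)
  ultimately show ?thesis by (simp add: bij_betw_def)
qed

text \<open>Counting with all colours shows that the number of leaves determines the number of
  interior vertices. Counting with one orbit then determines the interior vertices of that label,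
  since the map preserves the labels of leaves.\<close>

lemma riso_card:
  assumes "riso \<phi> I J"
  shows "card I = card J" "card {x \<in> I - {v0}. orb x = Q} = card {x \<in> J - {v0}. orb x = Q}"
proof -
  note r = risoD[OF assms]
  have all: "card K * (d + 1) = card (border K) + 2 * (card K - 1)" if K: "root_closed K" "v0 \<in> K" for K
  proof -
    have "parent_colour x \<le> d" if "x \<in> border K \<union> (K - {v0})" for x
      using that parent_props(6)[of x] K root_closedD(2)[OF K(1)] by (auto simp: border_def)
    then have "{y \<in> border K. parent_colour y \<in> {0..d}} = border K" "{x \<in> K - {v0}. parent_colour x \<in> {0..d}} = K - {v0}"
      by auto
    then show ?thesis using count_edges[OF K, of "{0..d}"] K root_closedD(1)[OF K(1)] by simp
  qed
  have b: "card (border I) = card (border J)" using riso_border_bij[OF assms] by (rule bij_betw_same_card)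
  have pos: "card I > 0" "card J > 0" using r(1-4) root_closedD(1) by (auto simp: card_gt_0_iff)
  \<comment> \<open>The coefficient \<open>d - 1\<close> is written as \<open>Suc e\<close>: this
    avoids truncated subtraction and shows that it can be cancelled.\<close>
  obtain e where e: "d = Suc (Suc e)" using d2 by (metis Suc_le_D numeral_2_eq_2 Suc_le_mono)
  have "Suc e * card I + 2 = card (border I)" "Suc e * card J + 2 = card (border J)"
    using all[OF r(1,3)] all[OF r(2,4)] pos e by (simp_all add: algebra_simps)
  then have "Suc e * card I = Suc e * card J" using b by simp
  then show c: "card I = card J" by (metis mult_cancel1 nat.distinct(2))
  let ?C = "{c. c \<le> d \<and> colour_orbit F c = Q}"
  have C: "?C \<subseteq> {0..d}" by auto
  have Q: "parent_colour x \<in> ?C \<longleftrightarrow> orb x = Q" if "x \<in> V" "x \<noteq> v0" for x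
    using parent_props(6) that by simp
  have set_eq: "{y \<in> border K. parent_colour y \<in> ?C} = {y \<in> border K. orb y = Q}"
    "{x \<in> K - {v0}. parent_colour x \<in> ?C} = {x \<in> K - {v0}. orb x = Q}" if K: "root_closed K" "v0 \<in> K" for K
    using Q root_closedD(2)[OF K(1)] K(2) by (auto simp: border_def)
  have "bij_betw \<phi> {y \<in> border I. orb y = Q} {y \<in> border J. orb y = Q}"
  proof (rule bij_betw_subset[OF riso_border_bij[OF assms]])
    have o: "orb (\<phi> y) = orb y" if "y \<in> border I" for y
      using cloc_orb r(6) that by (auto simp: border_def)
    show "\<phi> ` {y \<in> border I. orb y = Q} = {y \<in> border J. orb y = Q}"
    proof
      show "\<phi> ` {y \<in> border I. orb y = Q} \<subseteq> {y \<in> border J. orb y = Q}"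
        using o riso_border[OF assms] by auto
      show "{y \<in> border J. orb y = Q} \<subseteq> \<phi> ` {y \<in> border I. orb y = Q}"
      proof clarify
        fix y assume y: "y \<in> border J" "Q = orb y"
        then have "y \<in> \<phi> ` border I" using riso_border_bij[OF assms] by (simp add: bij_betw_def)
        then obtain x where "x \<in> border I" "y = \<phi> x" by blast
        then show "y \<in> \<phi> ` {z \<in> border I. orb z = orb y}" using o by auto
      qed
    qed
  qed auto
  then have "card {y \<in> border I. orb y = Q} = card {y \<in> border J. orb y = Q}" by (rule bij_betw_same_card)
  then show "card {x \<in> I - {v0}. orb x = Q} = card {x \<in> J - {v0}. orb x = Q}"
    using count_edges[OF r(1,3) C] count_edges[OF r(2,4) C] c
    unfolding set_eq[OF r(1,3)] set_eq[OF r(2,4)] by simp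
qed

section \<open>Swapping two branches\<close>

definition swappable :: "'v \<Rightarrow> 'v \<Rightarrow> bool" where
  "swappable v w \<longleftrightarrow> v \<in> V \<and> w \<in> V \<and> v \<noteq> v0 \<and> w \<noteq> v0 \<and> w \<notin> subtree_at v \<and> v \<notin> subtree_at w \<and> orb v = orb w"

lemma swappable_sym: "swappable v w \<Longrightarrow> swappable w v"
  by (auto simp: swappable_def)

text \<open>The parents of \<open>v\<close> and \<open>w\<close> are exempted because a child is
  torn off there and replaced by a distant vertex.\<close>

definition swapping :: "'v \<Rightarrow> 'v \<Rightarrow> ('v \<Rightarrow> 'v) \<Rightarrow> bool" where
  "swapping v w s \<longleftrightarrow> bij_betw s V V \<and> (\<forall>x\<in>V. s (s x) = x) \<and> s v = w \<and> s w = v \<and>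
     (\<forall>x\<in>V. x \<notin> subtree_at v \<longrightarrow> x \<notin> subtree_at w \<longrightarrow> s x = x) \<and>
     (\<forall>x\<in>V. x \<noteq> v0 \<longrightarrow> x \<noteq> parent v \<longrightarrow> x \<noteq> parent w \<longrightarrow> cloc s x)"

text \<open>The choice does not affect the class modulo commutators, since any two candidates agree
  on the leaves of a tree that has \<open>v\<close> and \<open>w\<close> among its leaves.\<close>

definition swap :: "'v \<Rightarrow> 'v \<Rightarrow> 'v \<Rightarrow> 'v" where
  "swap v w = (SOME s. swapping v w s)"

lemma constant_action_branch:
  assumes "p \<in> F" "\<And>x. x \<in> V \<Longrightarrow> g x \<in> V" "\<And>x c. x \<in> V \<Longrightarrow> c \<le> d \<Longrightarrow> g (nbr x c) = nbr (g x) (p c)"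
    and v: "v \<in> V" "v \<noteq> v0" "g v \<noteq> v0" "p (parent_colour v) = parent_colour (g v)"
    and x: "x \<in> subtree_at v"
  shows "g x \<in> subtree_at (g v)" "cloc g x"
proof -
  have gv: "g v \<in> V" using assms(2) v by blast
  have step: "p c \<in> child_colours (g x) \<and> g (nbr x c) = nbr (g x) (p c) \<and> p c = parent_colour (g (nbr x c)) \<and> g (nbr x c) \<noteq> v0"
    if x: "x \<in> V" "x \<noteq> v0" "g x \<noteq> v0" "p (parent_colour x) = parent_colour (g x)" "c \<in> child_colours x" for x c
  proof -
    have "p c \<in> child_colours (g x)" using F_child_colours(2)[OF assms(1) x(1,2) _ x(3,4,5)] assms(2) x by blast
    then show ?thesis using assms(2,3) x child_coloursD parent_colour_nbr child_neq_root by metis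
  qed
  have *: "g x \<in> subtree_at (g v) \<and> x \<noteq> v0 \<and> g x \<noteq> v0 \<and> p (parent_colour x) = parent_colour (g x)"
    using v(1) x
  proof (induction rule: subtree_induct)
    case base
    then show ?case using v gv by simp
  next
    case (child x c)
    have xV: "x \<in> V" using child subtree_atD by blast
    note s = step[OF xV] 
    have "g (nbr x c) \<in> subtree_at (g v)"
      using s child subtree_at_child_iff[OF gv] assms(2)[OF xV] by metis
    then show ?case using s child child_neq_root[OF xV] parent_colour_nbr[OF xV] by metis
  qed
  then show "g x \<in> subtree_at (g v)" by blast
  show "cloc g x"
    unfolding cloc_def using * step[of x] subtree_atD[OF x] assms(1,2) by blast
qed

lemma cloc_id: "x \<in> V \<Longrightarrow> x \<noteq> v0 \<Longrightarrow> cloc (\<lambda>x. x) x"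
  using F_id parent_props(6) child_coloursD unfolding cloc_def by (intro conjI bexI[of _ "\<lambda>c\<in>{0..d}. c"]) auto

text \<open>Equal labels give a permutation in \<open>F\<close> carrying one parent colour to the
  other. Prescribed at every vertex it is consistent and yields an automorphism sending
  \<open>v\<close> to \<open>w\<close>; the swap uses it on one branch, its inverse on the other and
  the identity elsewhere.\<close>

lemma swapping_swap:
  assumes "swappable v w" shows "swapping v w (swap v w)"
proof -
  have vw: "v \<in> V" "w \<in> V" "v \<noteq> v0" "w \<noteq> v0" "w \<notin> subtree_at v" "v \<notin> subtree_at w" "orb v = orb w"
    using assms by (auto simp: swappable_def)
  have disj: "x \<notin> subtree_at w" if "x \<in> subtree_at v" for x
    using subtree_at_comparable[OF vw(1,2) that] vw by blast
  have pd: "parent_colour v \<le> d" "parent_colour w \<le> d" using parent_props(6) vw by auto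
  have "parent_colour w \<in> orb w"
    unfolding colour_orbit_def using F_id pd by (intro CollectI exI[of _ "\<lambda>c\<in>{0..d}. c"]) simp
  then have "parent_colour w \<in> orb v" using vw(7) by simp
  then obtain p where p: "p \<in> F" "p (parent_colour v) = parent_colour w"
    unfolding colour_orbit_def mem_Collect_eq by (elim exE conjE) (rule that[OF _ sym], assumption+)
  obtain q where q: "q \<in> F" "\<And>c. c \<le> d \<Longrightarrow> q (p c) = c" "\<And>c. c \<le> d \<Longrightarrow> p (q c) = c"
    using F_inv p by metis
  obtain g where g: "bij_betw g V V" "g v = w" "\<And>x c. x \<in> V \<Longrightarrow> c \<le> d \<Longrightarrow> g (nbr x c) = nbr (g x) (p c)"
    using local_action_extends[of v w "\<lambda>_. p"] vw F_bij[OF p(1)] by metis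
  define g' where "g' = inv_into V g"
  have gV: "g x \<in> V" if "x \<in> V" for x using bij_betwE[OF g(1)] that by blast
  have g'V: "g' x \<in> V" "g (g' x) = x" if "x \<in> V" for x
    using bij_betwE[OF bij_betw_inv_into[OF g(1)]] bij_betw_inv_into_right[OF g(1)] that by (auto simp: g'_def)
  have g'g: "g' (g x) = x" if "x \<in> V" for x using bij_betw_inv_into_left[OF g(1)] that by (simp add: g'_def)
  have g'_nbr: "g' (nbr x c) = nbr (g' x) (q c)" if x: "x \<in> V" "c \<le> d" for x c
  proof -
    have "g (nbr (g' x) (q c)) = nbr x c" using g(3)[of "g' x" "q c"] g'V[OF x(1)] q F_le x by simp
    then show ?thesis using g'g[of "nbr (g' x) (q c)"] g'V[OF x(1)] F_le q x by simp
  qed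
  have g'w: "g' w = v" using g'g[OF vw(1)] g(2) by simp
  have A: "g x \<in> subtree_at w \<and> cloc g x" if "x \<in> subtree_at v" for x
    using constant_action_branch[of p g v x] p g gV vw that by auto
  have B: "g' x \<in> subtree_at v \<and> cloc g' x" if "x \<in> subtree_at w" for x
    using constant_action_branch[of q g' w x] q(1) q(2)[OF pd(1)] p g'V g'_nbr g'w vw that by auto
  define s where "s x = (if x \<in> subtree_at v then g x else if x \<in> subtree_at w then g' x else x)" for x
  have ss: "s (s x) = x" if x: "x \<in> V" for x
  proof -
    consider "x \<in> subtree_at v" | "x \<in> subtree_at w" "x \<notin> subtree_at v" | "x \<notin> subtree_at v" "x \<notin> subtree_at w" by blast
    then show ?thesis
    proof cases
      case 1
      then have "s x \<in> subtree_at w" "s x \<notin> subtree_at v" "s x = g x" using A disj by (auto simp: s_def)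
      then show ?thesis using g'g x by (simp add: s_def)
    next
      case 2
      then have "s x \<in> subtree_at v" "s x = g' x" using B by (auto simp: s_def)
      then show ?thesis using g'V x by (simp add: s_def)
    qed (simp add: s_def)
  qed
  have sV: "s x \<in> V" if "x \<in> V" for x using that gV g'V by (simp add: s_def)
  have "bij_betw s V V" using ss sV by (intro bij_betw_byWitness[where f' = s]) auto
  moreover have "s v = w" "s w = v" using vw g g'w by (auto simp: s_def)
  moreover have "cloc s x" if x: "x \<in> V" "x \<noteq> v0" "x \<noteq> parent v" "x \<noteq> parent w" for x
  proof -
    have in_v: "nbr x c \<in> subtree_at v \<longleftrightarrow> x \<in> subtree_at v" if c: "c \<in> child_colours x" for c
      using subtree_at_child_iff[OF vw(1) x(1) c] parent_nbr[OF x(1) c] x by metis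
    have in_w: "nbr x c \<in> subtree_at w \<longleftrightarrow> x \<in> subtree_at w" if c: "c \<in> child_colours x" for c
      using subtree_at_child_iff[OF vw(2) x(1) c] parent_nbr[OF x(1) c] x by metis
    show ?thesis
    proof (cases "x \<in> subtree_at v")
      case True
      then show ?thesis using A[OF True] x in_v by (intro cloc_cong[of g x s]) (auto simp: s_def)
    next
      case nv: False
      show ?thesis
      proof (cases "x \<in> subtree_at w")
        case True
        then show ?thesis using B[OF True] x in_v in_w nv by (intro cloc_cong[of g' x s]) (auto simp: s_def)
      next
        case False
        then show ?thesis using cloc_id x in_v in_w nv by (intro cloc_cong[of "\<lambda>x. x" x s]) (auto simp: s_def)
      qed
    qed
  qed
  ultimately have "swapping v w s" using ss unfolding swapping_def by (auto simp: s_def)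
  then show ?thesis unfolding swap_def by (rule someI[where P = "swapping v w"])
qed

lemma swapD:
  assumes "swappable v w"
  shows "bij_betw (swap v w) V V" "\<And>x. x \<in> V \<Longrightarrow> swap v w (swap v w x) = x" "swap v w v = w" "swap v w w = v"
    "\<And>x. x \<in> V \<Longrightarrow> x \<notin> subtree_at v \<Longrightarrow> x \<notin> subtree_at w \<Longrightarrow> swap v w x = x"
    "\<And>x. x \<in> V \<Longrightarrow> x \<noteq> v0 \<Longrightarrow> x \<noteq> parent v \<Longrightarrow> x \<noteq> parent w \<Longrightarrow> cloc (swap v w) x"
  using swapping_swap[OF assms] by (auto simp: swapping_def)

lemma swap_riso:
  assumes s: "swappable v w" and J: "root_closed J" "v0 \<in> J" "parent v \<in> J" "parent w \<in> J"
  shows "riso (swap v w) J (swap v w ` J)"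
proof -
  have "riso (swap v w) J (V - swap v w ` (V - J))"
    using swapD(1,6)[OF s] J by (intro riso_restrict_aux[of "{}" "{}"]) auto
  moreover have "V - swap v w ` (V - J) = swap v w ` J"
  proof -
    have "swap v w ` (V - J) = V - swap v w ` J"
      using swapD(1)[OF s] root_closedD(2)[OF J(1)] inj_on_image_set_diff[of "swap v w" V V J]
      by (auto simp: bij_betw_def)
    moreover have "swap v w ` J \<subseteq> V"
      using bij_betwE[OF swapD(1)[OF s]] root_closedD(2)[OF J(1)] by blast
    ultimately have "swap v w ` (V - J) = V - swap v w ` J" "swap v w ` J \<subseteq> V" by blast+
    then show ?thesis by blast
  qed
  ultimately show ?thesis by simp
qed

lemma swap_riso_self:
  assumes s: "swappable v w" and J: "root_closed J" "v0 \<in> J" "v \<in> border J" "w \<in> border J"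
  shows "riso (swap v w) J J"
proof -
  have "swap v w x = x" if "x \<in> J" for x
  proof (rule swapD(5)[OF s])
    show "x \<in> V" using that J root_closedD by blast
    show "x \<notin> subtree_at v" "x \<notin> subtree_at w" using border_subtree_outside[OF J(1)] J that by blast+
  qed
  then have "swap v w ` J = J" by (simp cong: image_cong)
  moreover have "parent v \<in> J" "parent w \<in> J" using s J by (auto simp: border_def swappable_def)
  ultimately show ?thesis using swap_riso[OF s J(1,2)] by simp
qed

lemma border_subtree:
  assumes J: "root_closed J" "v0 \<in> J" and x: "x \<in> border J" "v \<in> border J" "x \<in> subtree_at v"
  shows "x = v"
proof (rule ccontr)
  assume n: "x \<noteq> v"
  have "v \<in> V" using x by (simp add: border_def)
  then have "x \<noteq> v0" "parent x \<in> subtree_at v" using subtree_at_parent[OF _ x(3) n] by auto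
  then show False using border_subtree_outside[OF J(1) x(2)] x(1) by (auto simp: border_def)
qed

lemma swap_border:
  assumes s: "swappable v w" and J: "root_closed J" "v0 \<in> J" "v \<in> border J" "w \<in> border J" and x: "x \<in> border J"
  shows "swap v w x = (if x = v then w else if x = w then v else x)"
  using swapD(3,4)[OF s] swapD(5)[OF s, of x] border_subtree[OF J(1,2) x J(3)] border_subtree[OF J(1,2) x J(4)] x
  by (auto simp: border_def)

lemma border_swappable:
  assumes J: "root_closed J" "v0 \<in> J" "v \<in> border J" "w \<in> border J" "v \<noteq> w" "orb v = orb w"
  shows "swappable v w"
  using border_subtree[OF J(1,2)] J by (auto simp: swappable_def border_def)

text \<open>The interior of the smallest finite complete tree that has \<open>v\<close> as a leaf.
  For incomparable vertices the union of these sets has all of them as leaves.\<close>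

definition above :: "'v \<Rightarrow> 'v set" where
  "above v = {x \<in> V. v \<in> subtree_at x \<and> x \<noteq> v}"

lemma root_closed_above:
  assumes "v \<in> V" "v \<noteq> v0" shows "root_closed (above v)" "v0 \<in> above v" "parent v \<in> above v"
proof -
  have "above v \<subseteq> walk v0 ` set (prefixes (code v))"
    by (auto simp: above_def subtree_at_eq intro!: image_eqI[of _ _ "code _"])
  then have "finite (above v)" by (rule finite_subset) simp
  moreover have "parent x \<in> above v" if x: "x \<in> above v" "x \<noteq> v0" for x
  proof -
    have xV: "x \<in> V" "v \<in> subtree_at x" "x \<noteq> v" using x by (auto simp: above_def)
    have c: "code x = code (parent x) @ [parent_colour x]" "parent x \<in> V" using parent_props x xV by auto
    then have p: "v \<in> subtree_at (parent x)" using xV by (auto simp: subtree_at_eq dest: append_prefixD)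
    have "x \<in> subtree_at (parent x)" using c xV by (simp add: subtree_at_eq)
    then have "parent x \<noteq> v" using subtree_at_antisym[of x v] xV by auto
    then show ?thesis using p c by (simp add: above_def)
  qed
  ultimately show "root_closed (above v)" by (auto simp: root_closed_def above_def)
  show "v0 \<in> above v" using assms root subtree_at_root by (simp add: above_def)
  have c: "code v = code (parent v) @ [parent_colour v]" "parent v \<in> V" using parent_props assms by auto
  then show "parent v \<in> above v" using assms by (auto simp: above_def subtree_at_eq)
qed

section \<open>Swaps in the abelianization\<close>

abbreviation ab_class :: "('v \<Rightarrow> 'v) \<Rightarrow> 'v forest_map set set" where
  "ab_class \<phi> \<equiv> DN #>\<^bsub>NF F\<^esub> cls \<phi>"

sublocale Q: comm_group "NF F Mod DN"
  by (rule N.derived_quot_is_comm_group)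

lemma ab_class_carrier: "germ \<phi> \<Longrightarrow> ab_class \<phi> \<in> carrier (NF F Mod DN)"
  by (auto simp: FactGroup_def RCOSETS_def)

lemma ab_class_comp: "germ \<phi> \<Longrightarrow> germ \<psi> \<Longrightarrow> ab_class (\<phi> \<circ> \<psi>) = ab_class \<phi> \<otimes>\<^bsub>NF F Mod DN\<^esub> ab_class \<psi>"
  using normal.rcos_sum[OF DN_normal, of "cls \<phi>" "cls \<psi>"] by (simp add: FactGroup_def mult_cls)

lemma ab_class_DN: "cls \<phi> \<in> DN \<Longrightarrow> ab_class \<phi> = \<one>\<^bsub>NF F Mod DN\<^esub>"
  using N.coset_join2[OF _ DN_subgroup] subgroup.subset[OF DN_subgroup] by (auto simp: FactGroup_def)

lemma ab_class_border:
  assumes "riso \<phi> I J" "riso \<psi> I J" "\<And>x. x \<in> border I \<Longrightarrow> \<phi> x = \<psi> x"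
  shows "ab_class \<phi> = ab_class \<psi>"
proof -
  obtain x where x: "x \<in> DN" "cls \<phi> = x \<otimes>\<^bsub>NF F\<^esub> cls \<psi>" using same_border_map[OF assms] by blast
  have c: "x \<in> carrier (NF F)" "cls \<psi> \<in> carrier (NF F)"
    using x subgroup.subset[OF DN_subgroup] riso_germ assms(2) by auto
  have "ab_class \<phi> = (DN #>\<^bsub>NF F\<^esub> x) #>\<^bsub>NF F\<^esub> cls \<psi>"
    using N.coset_mult_assoc[OF subgroup.subset[OF DN_subgroup] c] x by simp
  then show ?thesis using N.coset_join2[OF c(1) DN_subgroup x(1)] by simp
qed

lemma swap_germ: "swappable v w \<Longrightarrow> germ (swap v w)"
proof -
  assume s: "swappable v w"
  have "riso (swap v w) (above v \<union> above w) (swap v w ` (above v \<union> above w))"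
    using s root_closed_above by (intro swap_riso root_closed_Un) (auto simp: swappable_def)
  then show ?thesis by (rule riso_germ)
qed

lemma swap_involution:
  assumes "swappable v w" shows "ab_class (swap v w) \<otimes>\<^bsub>NF F Mod DN\<^esub> ab_class (swap v w) = \<one>\<^bsub>NF F Mod DN\<^esub>"
proof -
  have "cls (swap v w \<circ> swap v w) = \<one>\<^bsub>NF F\<^esub>"
    unfolding one_NF by (rule cls_eqI, rule eventually_ends_off[of "{}"]) (auto simp: swapD(2)[OF assms])
  then have "cls (swap v w \<circ> swap v w) \<in> DN" using subgroup.one_closed[OF DN_subgroup] by simp
  then show ?thesis using ab_class_DN ab_class_comp swap_germ[OF assms] by metis
qed

text \<open>On leaves this is the conjugation of one transposition by another, and conjugation is
  trivial in an abelian group.\<close>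

lemma swap_move:
  assumes vw: "swappable v w" and vu: "swappable v u" and wu: "swappable w u"
  shows "ab_class (swap v w) = ab_class (swap v u)"
proof -
  let ?J = "above v \<union> above w \<union> above u"
  have V: "v \<in> V" "w \<in> V" "u \<in> V" "v \<noteq> v0" "w \<noteq> v0" "u \<noteq> v0" using vw vu by (auto simp: swappable_def)
  have J: "root_closed ?J" "v0 \<in> ?J" using root_closed_above V root_closed_Un by auto
  have b: "v \<in> border ?J" "w \<in> border ?J" "u \<in> border ?J"
    using vw vu wu root_closed_above(3) by (auto simp: border_def swappable_def above_def)
  have ne: "v \<noteq> w" "v \<noteq> u" "w \<noteq> u" using vw vu wu by (auto simp: swappable_def)
  let ?a = "swap v w" and ?b = "swap w u" and ?c = "swap v u"
  have r: "riso ?a ?J ?J" "riso ?b ?J ?J" "riso ?c ?J ?J"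
    using swap_riso_self[OF _ J] vw vu wu b by auto
  have "ab_class (?b \<circ> (?a \<circ> ?b)) = ab_class ?c"
  proof (rule ab_class_border)
    show "riso (?b \<circ> (?a \<circ> ?b)) ?J ?J" "riso ?c ?J ?J" using r riso_comp by blast+
    fix x assume x: "x \<in> border ?J"
    note sw = swap_border[OF vw J b(1,2)] swap_border[OF wu J b(2,3)] swap_border[OF vu J b(1,3)]
    show "(?b \<circ> (?a \<circ> ?b)) x = ?c x" using x sw b ne by auto
  qed
  moreover have "ab_class (?b \<circ> (?a \<circ> ?b)) = ab_class ?b \<otimes>\<^bsub>NF F Mod DN\<^esub> (ab_class ?a \<otimes>\<^bsub>NF F Mod DN\<^esub> ab_class ?b)"
    using ab_class_comp swap_germ germ_comp vw wu by simp
  moreover have "\<dots> = ab_class ?a \<otimes>\<^bsub>NF F Mod DN\<^esub> (ab_class ?b \<otimes>\<^bsub>NF F Mod DN\<^esub> ab_class ?b)"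
    using ab_class_carrier swap_germ vw wu by (intro Q.m_lcomm) auto
  ultimately show ?thesis using swap_involution[OF wu] ab_class_carrier[OF swap_germ[OF vw]] Q.r_one by simp
qed

text \<open>The two choices made by \<open>swap\<close> may be different maps, but they induce the
  same transposition of leaves.\<close>

lemma swap_class_sym: "swappable v w \<Longrightarrow> ab_class (swap v w) = ab_class (swap w v)"
proof -
  assume vw: "swappable v w"
  let ?J = "above v \<union> above w"
  have V: "v \<in> V" "w \<in> V" "v \<noteq> v0" "w \<noteq> v0" using vw by (auto simp: swappable_def)
  have J: "root_closed ?J" "v0 \<in> ?J" using root_closed_above V root_closed_Un by auto
  have b: "v \<in> border ?J" "w \<in> border ?J"
    using vw root_closed_above(3) by (auto simp: border_def swappable_def above_def)
  note wv = swappable_sym[OF vw]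
  show ?thesis
    using swap_riso_self[OF vw J b] swap_riso_self[OF wv J b(2,1)] swap_border[OF vw J b] swap_border[OF wv J b(2,1)]
    by (intro ab_class_border) auto
qed

section \<open>Finiteness of the abelianization\<close>

abbreviation swap_classes :: "'v forest_map set set set" where
  "swap_classes \<equiv> {ab_class (swap v w) | v w. swappable v w}"

abbreviation swap_group :: "'v forest_map set set set" where
  "swap_group \<equiv> generate (NF F Mod DN) swap_classes"

lemma swap_in_swap_group: "swappable v w \<Longrightarrow> ab_class (swap v w) \<in> swap_group"
  by (rule generate.incl) blast

lemma swap_peel:
  assumes "swappable v w" "germ \<phi>" "ab_class (swap v w \<circ> \<phi>) \<in> swap_group"
  shows "ab_class \<phi> \<in> swap_group"
proof -
  let ?s = "ab_class (swap v w)"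
  have c: "?s \<in> carrier (NF F Mod DN)" "ab_class \<phi> \<in> carrier (NF F Mod DN)"
    using ab_class_carrier swap_germ assms by auto
  have "?s \<otimes>\<^bsub>NF F Mod DN\<^esub> ab_class (swap v w \<circ> \<phi>) = (?s \<otimes>\<^bsub>NF F Mod DN\<^esub> ?s) \<otimes>\<^bsub>NF F Mod DN\<^esub> ab_class \<phi>"
    using ab_class_comp[OF swap_germ[OF assms(1)] assms(2)] Q.m_assoc[OF c(1) c(1) c(2)] by simp
  also have "\<dots> = ab_class \<phi>" using swap_involution[OF assms(1)] Q.l_one[OF c(2)] by simp
  finally show ?thesis using generate.eng[OF swap_in_swap_group[OF assms(1)] assms(3)] by simp
qed

text \<open>Composing with the swap of \<open>v\<close> and \<open>\<phi> v\<close> makes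
  \<open>v\<close> a fixed leaf and moves no leaf that was fixed before, so the number of moved
  leaves drops.\<close>

lemma leaf_permutation_in_swap_group:
  assumes "riso \<phi> J J" shows "ab_class \<phi> \<in> swap_group"
  using assms
proof (induction "card {x \<in> border J. \<phi> x \<noteq> x}" arbitrary: \<phi> rule: less_induct)
  case less
  note r = risoD[OF less.prems]
  have fin: "finite {x \<in> border J. \<phi> x \<noteq> x}" using border_finite[OF r(1)] by simp
  show ?case
  proof (cases "{x \<in> border J. \<phi> x \<noteq> x} = {}")
    case True
    then have "cls \<phi> \<in> DN" using border_fixing_in_DN[OF less.prems] by blast
    then have eq: "ab_class \<phi> = \<one>\<^bsub>NF F Mod DN\<^esub>" by (rule ab_class_DN)
    show ?thesis unfolding eq by (rule generate.one)
  next
    case False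
    then obtain v where v: "v \<in> border J" "\<phi> v \<noteq> v" by blast
    have w: "\<phi> v \<in> border J" using riso_border[OF less.prems v(1)] .
    have "orb v = orb (\<phi> v)" using cloc_orb r(6) v(1) by (simp add: border_def)
    then have s: "swappable v (\<phi> v)" using border_swappable[OF r(1,3) v(1) w] v(2) by simp
    let ?s = "swap v (\<phi> v)"
    let ?\<psi> = "?s \<circ> \<phi>"
    note sw = swap_border[OF s r(1,3) v(1) w]
    have "riso ?\<psi> J J" using riso_comp[OF less.prems swap_riso_self[OF s r(1,3) v(1) w]] .
    moreover have "{x \<in> border J. ?\<psi> x \<noteq> x} \<subset> {x \<in> border J. \<phi> x \<noteq> x}"
    proof
      show "{x \<in> border J. ?\<psi> x \<noteq> x} \<subseteq> {x \<in> border J. \<phi> x \<noteq> x}"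
      proof clarify
        fix x assume x: "x \<in> border J" "?\<psi> x \<noteq> x" "\<phi> x = x"
        have "x \<noteq> \<phi> v"
        proof
          assume "x = \<phi> v"
          then have "\<phi> x = \<phi> v" using x by simp
          then have "x = v" using riso_border_bij[OF less.prems] x v by (auto simp: bij_betw_def inj_on_def)
          then show False using x v by simp
        qed
        moreover have "x \<noteq> v" using x v by auto
        ultimately show False using x sw[OF x(1)] by simp
      qed
      have "?\<psi> v = v" using sw[OF w] v by simp
      then show "{x \<in> border J. ?\<psi> x \<noteq> x} \<noteq> {x \<in> border J. \<phi> x \<noteq> x}" using v by blast
    qed
    ultimately have "ab_class ?\<psi> \<in> swap_group" using less.hyps psubset_card_mono[OF fin] by blast
    then show ?thesis using swap_peel[OF s riso_germ[OF less.prems]] by blast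
  qed
qed

text \<open>Swaps applied after the map change the image tree one vertex at a time until it equals
  the source tree; then only a permutation of leaves remains.\<close>

lemma riso_in_swap_group:
  assumes "riso \<phi> I J" shows "ab_class \<phi> \<in> swap_group"
  using assms
proof (induction "card (I - J)" arbitrary: \<phi> J rule: less_induct)
  case less
  note r = risoD[OF less.prems]
  have fin: "finite I" "finite J" using root_closedD r by blast+
  show ?case
  proof (cases "I \<subseteq> J")
    case True
    then have "I = J" using riso_card(1)[OF less.prems] fin card_subset_eq by metis
    then show ?thesis using leaf_permutation_in_swap_group less.prems by blast
  next
    case False
    then have "I - J \<noteq> {}" by blast
    \<comment> \<open>Least depth puts the parent of \<open>x\<close> into \<open>J\<close>, so that
      \<open>x\<close> is a leaf of the image tree.\<close>
    then obtain x where x: "x \<in> I - J" "\<And>z. z \<in> I - J \<Longrightarrow> length (code x) \<le> length (code z)"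
      using ex_has_least_nat[of "\<lambda>x. x \<in> I - J" _ "\<lambda>x. length (code x)"] by blast
    have xV: "x \<in> V" "x \<noteq> v0" using x(1) r(4) root_closedD(2)[OF r(1)] by auto
    have "parent x \<in> J"
    proof (rule ccontr)
      assume "parent x \<notin> J"
      then have "parent x \<in> I - J" using x xV root_closedD(3)[OF r(1)] by blast
      then show False using x(2) parent_props(5)[OF xV] by fastforce
    qed
    then have xb: "x \<in> border J" using x xV by (simp add: border_def)
    \<comment> \<open>Both interiors contain equally many vertices with the label of
      \<open>x\<close>, so a vertex missing from \<open>J\<close> is compensated by one missing from
      \<open>I\<close>.\<close>
    have "\<exists>y\<in>J - I. y \<noteq> v0 \<and> orb y = orb x"
    proof (rule ccontr)
      assume n: "\<not> (\<exists>y\<in>J - I. y \<noteq> v0 \<and> orb y = orb x)"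
      then have "{y \<in> J - {v0}. orb y = orb x} \<subseteq> {y \<in> I - {v0}. orb y = orb x}" by blast
      then have "{y \<in> J - {v0}. orb y = orb x} = {y \<in> I - {v0}. orb y = orb x}"
        using riso_card(2)[OF less.prems, of "orb x"] fin by (intro card_subset_eq) auto
      then show False using x xV by blast
    qed
    then obtain y where y: "y \<in> J" "y \<notin> I" "y \<noteq> v0" "orb y = orb x" by blast
    have yV: "y \<in> V" using y root_closedD(2)[OF r(2)] by blast
    have I_y: "z \<notin> subtree_at y" if "z \<in> I" for z
      using root_closed_subtree[OF r(1) yV _ that] y by blast
    have J_x: "z \<notin> subtree_at x" if "z \<in> J" for z
      using border_subtree_outside[OF r(2) xb] that by blast
    have s: "swappable x y" using xV yV y I_y[of x] J_x[of y] x by (simp add: swappable_def)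
    let ?s = "swap x y"
    have "parent y \<in> J" using root_closedD(3)[OF r(2)] y by blast
    then have rs: "riso ?s J (?s ` J)" using swap_riso[OF s r(2,4)] \<open>parent x \<in> J\<close> by blast
    have "riso (?s \<circ> \<phi>) I (?s ` J)" by (rule riso_comp[OF less.prems rs])
    \<comment> \<open>Common interior vertices lie below neither \<open>x\<close> nor
      \<open>y\<close> and stay in place, while \<open>x\<close> enters the new interior as the
      image of \<open>y\<close>.\<close>
    moreover have "I - ?s ` J \<subset> I - J"
    proof
      show "I - ?s ` J \<subseteq> I - J"
      proof clarify
        fix z assume z: "z \<in> I" "z \<notin> ?s ` J" "z \<in> J"
        then have "z \<in> V" using root_closedD(2)[OF r(1)] by blast
        then have "?s z = z" using swapD(5)[OF s] I_y[OF z(1)] J_x[OF z(3)] by blast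
        then show False using z by (metis imageI)
      qed
      have "x \<in> ?s ` J" using swapD(4)[OF s] y by (metis imageI)
      then show "I - ?s ` J \<noteq> I - J" using x by blast
    qed
    then have "card (I - ?s ` J) < card (I - J)" using fin by (intro psubset_card_mono) auto
    ultimately have "ab_class (?s \<circ> \<phi>) \<in> swap_group" using less.hyps by blast
    then show ?thesis using swap_peel[OF s riso_germ[OF less.prems]] by blast
  qed
qed

text \<open>These are the standard positions for swaps: two incomparable vertices with prescribed
  branch and prescribed parent colour.\<close>

lemma branch_pair_exists:
  assumes "c \<le> d" "i \<le> d"
  shows "\<exists>u1 u2. u1 \<in> V \<and> u2 \<in> V \<and> u1 \<noteq> v0 \<and> u2 \<noteq> v0 \<and> hd (code u1) = c \<and> hd (code u2) = c \<and>
    parent_colour u1 = i \<and> parent_colour u2 = i \<and> u1 \<notin> subtree_at u2 \<and> u2 \<notin> subtree_at u1"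
proof -
  obtain a b where ab: "a \<le> d" "b \<le> d" "a \<noteq> b" "a \<noteq> c" "b \<noteq> c" using third_colour by metis
  \<comment> \<open>The second letter takes two different values to make the vertices incomparable.
    If it is already \<open>i\<close> it must not be repeated, or the word would not be
    reduced.\<close>
  define word where "word e = (if e = i then [c, e] else [c, e, i])" for e
  have red: "reduced (word e)" if "e \<le> d" "e \<noteq> c" for e
    using that assms by (auto simp: word_def reduced_Cons)
  have word: "walk v0 (word e) \<in> V" "code (walk v0 (word e)) = word e" "walk v0 (word e) \<noteq> v0"
    "parent_colour (walk v0 (word e)) = i" if "e \<le> d" "e \<noteq> c" for e
  proof -
    show 1: "walk v0 (word e) \<in> V" using walk_reduced_in[OF root red[OF that]] .
    show 2: "code (walk v0 (word e)) = word e" using red[OF that] by (rule code_walk)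
    show 3: "walk v0 (word e) \<noteq> v0"
    proof
      assume "walk v0 (word e) = v0"
      then have "word e = []" using 2 code_root by simp
      then show False by (simp add: word_def split: if_splits)
    qed
    show "parent_colour (walk v0 (word e)) = i" using parent_colour_eq[OF 1 3] 2 by (simp add: word_def)
  qed
  have np: "\<not> prefix (word a) (word b)" "\<not> prefix (word b) (word a)"
    using ab by (auto simp: word_def)
  have "walk v0 (word b) \<notin> subtree_at (walk v0 (word a))" "walk v0 (word a) \<notin> subtree_at (walk v0 (word b))"
    using word[of a] word[of b] ab np by (simp_all add: subtree_at_eq)
  moreover have "hd (word e) = c" for e by (simp add: word_def)
  ultimately show ?thesis using word[of a] word[of b] ab
    by (intro exI[of _ "walk v0 (word a)"] exI[of _ "walk v0 (word b)"]) simp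
qed

text \<open>Choose a branch at the root containing neither \<open>v\<close> nor \<open>w\<close>.
  Its vertices are incomparable with both, so \<open>swap_move\<close> can bring first
  \<open>w\<close> and then \<open>v\<close> into standard position there; only the branch colour
  and the parent colour of \<open>v\<close> remain.\<close>

lemma finite_swap_classes: "finite swap_classes"
proof -
  have "\<exists>u. \<forall>c i. c \<le> d \<longrightarrow> i \<le> d \<longrightarrow> (let u1 = fst (u c i); u2 = snd (u c i) in
    u1 \<in> V \<and> u2 \<in> V \<and> u1 \<noteq> v0 \<and> u2 \<noteq> v0 \<and> hd (code u1) = c \<and> hd (code u2) = c \<and>
    parent_colour u1 = i \<and> parent_colour u2 = i \<and> u1 \<notin> subtree_at u2 \<and> u2 \<notin> subtree_at u1)"
    (is "\<exists>u. \<forall>c i. ?P u c i")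
  proof -
    have "\<forall>c i. \<exists>u. ?P (\<lambda>_ _. u) c i" using branch_pair_exists by (auto simp: Let_def)
    then obtain u where "\<forall>c i. ?P (\<lambda>_ _. u c i) c i" by metis
    then show ?thesis by blast
  qed
  then obtain u where u: "\<And>c i. c \<le> d \<Longrightarrow> i \<le> d \<Longrightarrow> (let u1 = fst (u c i); u2 = snd (u c i) in
    u1 \<in> V \<and> u2 \<in> V \<and> u1 \<noteq> v0 \<and> u2 \<noteq> v0 \<and> hd (code u1) = c \<and> hd (code u2) = c \<and>
    parent_colour u1 = i \<and> parent_colour u2 = i \<and> u1 \<notin> subtree_at u2 \<and> u2 \<notin> subtree_at u1)"
    by blast
  define ref where "ref c i = ab_class (swap (fst (u c i)) (snd (u c i)))" for c i
  have "swap_classes \<subseteq> (\<lambda>(c, i). ref c i) ` ({0..d} \<times> {0..d})"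
  proof clarify
    fix v w assume vw: "swappable v w"
    have V: "v \<in> V" "w \<in> V" "v \<noteq> v0" "w \<noteq> v0" using vw by (auto simp: swappable_def)
    obtain c where c: "c \<le> d" "c \<noteq> hd (code v)" "c \<noteq> hd (code w)" using third_colour by blast
    let ?i = "parent_colour v"
    have i: "?i \<le> d" using parent_props(6) V by blast
    let ?a = "fst (u c ?i)" and ?b = "snd (u c ?i)"
    have ab: "?a \<in> V" "?b \<in> V" "?a \<noteq> v0" "?b \<noteq> v0" "hd (code ?a) = c" "hd (code ?b) = c"
      "parent_colour ?a = ?i" "parent_colour ?b = ?i" "?a \<notin> subtree_at ?b" "?b \<notin> subtree_at ?a"
      using u[OF c(1) i] by (auto simp: Let_def)
    have far: "y \<notin> subtree_at x" if "x \<in> V" "x \<noteq> v0" "hd (code x) \<noteq> hd (code y)" for x y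
      using that code_Nil_iff[of x] by (auto simp: subtree_at_eq prefix_def)
    have s: "swappable v ?a" "swappable w ?a" "swappable ?a ?b" "swappable v ?b"
      using vw V ab far c by (auto simp: swappable_def)
    have "ab_class (swap v w) = ab_class (swap v ?a)" by (rule swap_move[OF vw s(1,2)])
    also have "\<dots> = ab_class (swap ?a v)" by (rule swap_class_sym[OF s(1)])
    also have "\<dots> = ref c ?i" unfolding ref_def by (rule swap_move[OF swappable_sym[OF s(1)] s(3,4)])
    finally show "ab_class (swap v w) \<in> (\<lambda>(c, i). ref c i) ` ({0..d} \<times> {0..d})" using c i by auto
  qed
  then show ?thesis by (rule finite_subset) simp
qed

lemma finite_index_DN: "finite (rcosets\<^bsub>NF F\<^esub> DN)"
proof -
  have "rcosets\<^bsub>NF F\<^esub> DN \<subseteq> swap_group"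
  proof
    fix X assume "X \<in> rcosets\<^bsub>NF F\<^esub> DN"
    then obtain \<phi> where \<phi>: "germ \<phi>" "X = ab_class \<phi>" by (auto simp: RCOSETS_def carrier_NF)
    obtain I J where "riso \<phi> I J" by (rule germ_riso_ex[OF \<phi>(1)])
    then show "X \<in> swap_group" using riso_in_swap_group \<phi> by blast
  qed
  moreover have "finite swap_group"
  proof (rule Q.finite_generate_involutions[OF finite_swap_classes])
    show "swap_classes \<subseteq> carrier (NF F Mod DN)" using ab_class_carrier swap_germ by blast
    fix s assume "s \<in> swap_classes"
    then show "s \<otimes>\<^bsub>NF F Mod DN\<^esub> s = \<one>\<^bsub>NF F Mod DN\<^esub>" using swap_involution by auto
  qed
  ultimately show ?thesis by (rule finite_subset)
qed

end

locale reference_neretin = coloured_neretin V E v0 d col F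
  for V :: "'v set" and E :: "('v \<times> 'v) set" and v0 :: 'v and d :: nat and col :: "'v \<times> 'v \<Rightarrow> nat"
    and F :: "(nat \<Rightarrow> nat) set" +
  fixes r :: "nat set \<Rightarrow> nat" and f :: "nat \<Rightarrow> nat \<Rightarrow> nat"
  assumes reference: "reference_choice F r f"
begin

section \<open>Label-preserving germs\<close>

lemma f_F: "\<chi> \<le> d \<Longrightarrow> f \<chi> \<in> F"
  using reference by (simp add: reference_choice_def)

lemma f_ref: "\<chi> \<le> d \<Longrightarrow> f \<chi> \<chi> = r (colour_orbit F \<chi>)"
  using reference by (simp add: reference_choice_def)

text \<open>On colours this is the inverse of \<open>f \<eta>\<close> after \<open>f \<chi>\<close>,
  the permutation matching the child orders below parent edges of colours \<open>\<chi>\<close> and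
  \<open>\<eta>\<close>. For colours in one orbit it sends \<open>\<chi>\<close> to
  \<open>\<eta>\<close>.\<close>

definition transfer :: "nat \<Rightarrow> nat \<Rightarrow> nat \<Rightarrow> nat" where
  "transfer \<chi> \<eta> = (SOME p. p \<in> F \<and> (\<forall>c\<le>d. f \<eta> (p c) = f \<chi> c))"

lemma transfer:
  assumes "\<chi> \<le> d" "\<eta> \<le> d"
  shows "transfer \<chi> \<eta> \<in> F" "\<And>c. c \<le> d \<Longrightarrow> f \<eta> (transfer \<chi> \<eta> c) = f \<chi> c"
proof -
  obtain q where q: "q \<in> F" "\<And>c. c \<le> d \<Longrightarrow> f \<eta> (q c) = c" using F_inv[OF f_F[OF assms(2)]] by metis
  have "compose {0..d} q (f \<chi>) \<in> F \<and> (\<forall>c\<le>d. f \<eta> (compose {0..d} q (f \<chi>) c) = f \<chi> c)"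
    using F_comp q f_F assms F_le by (simp add: compose_def)
  then have "transfer \<chi> \<eta> \<in> F \<and> (\<forall>c\<le>d. f \<eta> (transfer \<chi> \<eta> c) = f \<chi> c)"
    unfolding transfer_def by (rule someI[where P = "\<lambda>p. p \<in> F \<and> (\<forall>c\<le>d. f \<eta> (p c) = f \<chi> c)"])
  then show "transfer \<chi> \<eta> \<in> F" "\<And>c. c \<le> d \<Longrightarrow> f \<eta> (transfer \<chi> \<eta> c) = f \<chi> c" by auto
qed

lemma f_inj: "\<eta> \<le> d \<Longrightarrow> c \<le> d \<Longrightarrow> c' \<le> d \<Longrightarrow> f \<eta> c = f \<eta> c' \<longleftrightarrow> c = c'"
  using F_inj f_F by blast

lemma transfer_ref:
  assumes "\<chi> \<le> d" "\<eta> \<le> d" "colour_orbit F \<chi> = colour_orbit F \<eta>"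
  shows "transfer \<chi> \<eta> \<chi> = \<eta>"
proof -
  have "f \<eta> (transfer \<chi> \<eta> \<chi>) = f \<eta> \<eta>" using transfer(2)[OF assms(1,2,1)] f_ref assms by simp
  then show ?thesis using f_inj[OF assms(2) F_le[OF transfer(1)[OF assms(1,2)] assms(1)] assms(2)] by simp
qed

text \<open>A label-preserving map has these local actions because an order isomorphism of
  \<open>D - {r O}\<close> to itself is the identity.\<close>

definition vloc :: "('v \<Rightarrow> 'v) \<Rightarrow> 'v \<Rightarrow> bool" where
  "vloc \<phi> x \<longleftrightarrow> x \<noteq> v0 \<and> \<phi> x \<in> V \<and> \<phi> x \<noteq> v0 \<and>
     colour_orbit F (parent_colour x) = colour_orbit F (parent_colour (\<phi> x)) \<and>
     (\<forall>c\<in>child_colours x. \<phi> (nbr x c) = nbr (\<phi> x) (transfer (parent_colour x) (parent_colour (\<phi> x)) c))"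

lemma vloc_cloc: "vloc \<phi> x \<Longrightarrow> x \<in> V \<Longrightarrow> cloc \<phi> x"
proof -
  assume v: "vloc \<phi> x" and x: "x \<in> V"
  have le: "parent_colour x \<le> d" "parent_colour (\<phi> x) \<le> d"
    using v x parent_props(6) by (auto simp: vloc_def)
  show ?thesis
    using v transfer(1)[OF le] transfer_ref[OF le] unfolding vloc_def cloc_def by blast
qed

lemma transfer_unique:
  assumes "\<chi> \<le> d" "\<eta> \<le> d" "c \<le> d" "c' \<le> d" "f \<eta> c' = f \<chi> c"
  shows "c' = transfer \<chi> \<eta> c"
proof -
  have "f \<eta> c' = f \<eta> (transfer \<chi> \<eta> c)" using transfer(2) assms by simp
  then show ?thesis using f_inj[OF assms(2,4) F_le[OF transfer(1)[OF assms(1,2)] assms(3)]] by simp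
qed

text \<open>Transfers satisfy the cocycle identity: passing from \<open>?a\<close> to
  \<open>?b\<close> and on to \<open>?c\<close> is passing from \<open>?a\<close> to
  \<open>?c\<close>, because a transfer is determined by its normalised values.\<close>

lemma vloc_comp:
  assumes "vloc \<psi> x" "vloc \<phi> (\<psi> x)" "x \<in> V"
  shows "vloc (\<phi> \<circ> \<psi>) x"
proof -
  let ?a = "parent_colour x" and ?b = "parent_colour (\<psi> x)" and ?c = "parent_colour (\<phi> (\<psi> x))"
  have x: "x \<noteq> v0" "\<psi> x \<in> V" "\<psi> x \<noteq> v0" "\<phi> (\<psi> x) \<in> V" "\<phi> (\<psi> x) \<noteq> v0"
    using assms by (auto simp: vloc_def)
  have le: "?a \<le> d" "?b \<le> d" "?c \<le> d" using parent_props(6) x assms(3) by auto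
  have "(\<phi> \<circ> \<psi>) (nbr x c) = nbr (\<phi> (\<psi> x)) (transfer ?a ?c c)" if c: "c \<in> child_colours x" for c
  proof -
    have cd: "c \<le> d" using c child_coloursD by blast
    let ?e = "transfer ?a ?b c"
    have e: "?e \<le> d" using F_le transfer(1) le cd by blast
    have "?e \<in> child_colours (\<psi> x)"
      using F_child_colours(2)[OF transfer(1)[OF le(1,2)] assms(3) x(1-3) transfer_ref[OF le(1,2)] c] assms(1)
      by (simp add: vloc_def)
    then have "(\<phi> \<circ> \<psi>) (nbr x c) = nbr (\<phi> (\<psi> x)) (transfer ?b ?c ?e)"
      using assms c by (simp add: vloc_def)
    moreover have "transfer ?b ?c ?e = transfer ?a ?c c"
      using transfer(2)[OF le(2,3) e] transfer(2)[OF le(1,2) cd] le cd e F_le transfer(1)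
      by (intro transfer_unique) auto
    ultimately show ?thesis by simp
  qed
  then show ?thesis using assms x by (simp add: vloc_def)
qed

lemma vloc_inverse:
  assumes "vloc \<phi> x" "x \<in> V" "\<psi> (\<phi> x) = x" "\<And>c. c \<in> child_colours x \<Longrightarrow> \<psi> (\<phi> (nbr x c)) = nbr x c"
  shows "vloc \<psi> (\<phi> x)"
proof -
  let ?a = "parent_colour x" and ?b = "parent_colour (\<phi> x)"
  have x: "x \<noteq> v0" "\<phi> x \<in> V" "\<phi> x \<noteq> v0" "colour_orbit F ?a = colour_orbit F ?b"
    using assms by (auto simp: vloc_def)
  have le: "?a \<le> d" "?b \<le> d" using parent_props(6) x assms(2) by auto
  have "\<psi> (nbr (\<phi> x) c) = nbr x (transfer ?b ?a c)" if c: "c \<in> child_colours (\<phi> x)" for c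
  proof -
    have "c \<in> transfer ?a ?b ` child_colours x"
      using F_child_colours(1)[OF transfer(1)[OF le] assms(2) x(1-3) transfer_ref[OF le x(4)]] c by simp
    then obtain e where e: "e \<in> child_colours x" "c = transfer ?a ?b e" by auto
    have ed: "e \<le> d" "c \<le> d" using e c child_coloursD by auto
    have "\<psi> (nbr (\<phi> x) c) = nbr x e" using assms(1,4) e by (simp add: vloc_def)
    moreover have "e = transfer ?b ?a c"
      using transfer(2)[OF le ed(1)] e ed le by (intro transfer_unique) auto
    ultimately show ?thesis by simp
  qed
  then show ?thesis using x assms(2,3) by (simp add: vloc_def)
qed

definition vgerm :: "('v \<Rightarrow> 'v) \<Rightarrow> bool" where
  "vgerm \<phi> \<longleftrightarrow> germ \<phi> \<and> eventually (vloc \<phi>) ends"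

lemma eventually_in_V: "eventually (\<lambda>x. x \<in> V) ends"
  by (rule eventually_ends_off[of "{}"]) auto

lemma vgerm_comp: "vgerm \<phi> \<Longrightarrow> vgerm \<psi> \<Longrightarrow> vgerm (\<phi> \<circ> \<psi>)"
proof -
  assume a: "vgerm \<phi>" "vgerm \<psi>"
  have ev: "eventually (vloc \<phi>) ends" and fl: "filterlim \<psi> ends ends"
    using a germ_filterlim by (auto simp: vgerm_def)
  have "eventually (\<lambda>x. vloc \<phi> (\<psi> x)) ends" by (rule eventually_compose_filterlim[OF ev fl])
  moreover have "eventually (vloc \<psi>) ends" using a by (simp add: vgerm_def)
  ultimately have "eventually (vloc (\<phi> \<circ> \<psi>)) ends"
    using eventually_in_V by eventually_elim (rule vloc_comp)
  then show ?thesis using a germ_comp by (simp add: vgerm_def)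
qed

lemma vgerm_inverse:
  assumes "vgerm \<phi>"
  obtains \<psi> where "vgerm \<psi>" "\<forall>\<^sub>F x in ends. \<psi> (\<phi> x) = x"
proof -
  obtain \<psi> where \<psi>: "germ \<psi>" "\<forall>\<^sub>F x in ends. \<psi> (\<phi> x) = x" "\<forall>\<^sub>F x in ends. \<phi> (\<psi> x) = x"
    by (rule germ_inverse[of \<phi>]) (use assms in \<open>auto simp: vgerm_def\<close>)
  have "eventually (vloc \<phi>) ends" using assms by (simp add: vgerm_def)
  then have "\<forall>\<^sub>F x in ends. vloc \<psi> (\<phi> x)"
    using eventually_ends_children[OF \<psi>(2)] eventually_in_V
    by eventually_elim (rule vloc_inverse[of \<phi>], simp_all)
  then have "\<forall>\<^sub>F y in ends. vloc \<psi> (\<phi> (\<psi> y))"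
    by (rule eventually_compose_filterlim[OF _ germ_filterlim[OF \<psi>(1)]])
  then have "eventually (vloc \<psi>) ends" using \<psi>(3) by eventually_elim simp
  then show ?thesis using that \<psi> by (simp add: vgerm_def)
qed

text \<open>Labels are assumed to be preserved only at the leaves. They propagate outwards: once the
  label of \<open>x\<close> is preserved, the orders force a local action in \<open>F\<close>, and
  this preserves the labels of the children.\<close>

lemma label_preserving_vloc:
  assumes lp: "(T1, T2, \<phi>) \<in> label_preserving F f"
  shows "vgerm \<phi>"
proof -
  have hon: "(T1, T2, \<phi>) \<in> honest"
    and ch: "\<And>v. v \<in> outside T1 \<Longrightarrow> \<phi> ` children v = children (\<phi> v)"
    and ord: "\<And>v v1 v2. v \<in> outside T1 \<Longrightarrow> v1 \<in> children v \<Longrightarrow> v2 \<in> children v \<Longrightarrow>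
       child_less f v v1 v2 \<Longrightarrow> child_less f (\<phi> v) (\<phi> v1) (\<phi> v2)"
    and lab: "T1 = {v0} \<and> T2 = {v0} \<or> (\<forall>v\<in>leaves T1. label F v = label F (\<phi> v))"
    using lp unfolding label_preserving_def by blast+
  obtain I J where IJ: "root_closed I" "root_closed J" "T1 = I \<union> border I" "T2 = J \<union> border J"
    "outside T1 = V - I" "outside T2 = V - J" "bij_betw \<phi> (V - I) (V - J)"
    by (rule honest_bij[OF hon])
  have lv: "leaves T1 = border I" using closure_finite_complete(2) IJ by simp
  have inj: "inj_on \<phi> (V - I)" using IJ(7) by (simp add: bij_betw_def)
  have \<phi>V: "\<phi> x \<in> V" if "x \<in> V - I" for x using bij_betwE[OF IJ(7)] that by blast
  have card_children: "card (children x) = (if x = v0 then d + 1 else d)" if "x \<in> V" for x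
  proof -
    have "inj_on (nbr x) (child_colours x)" using that child_coloursD by (auto simp: inj_on_def)
    then have "card (children x) = card (child_colours x)" using that by (simp add: children_eq card_image)
    then show ?thesis using that parent_props(6) by (simp add: child_colours_eq)
  qed
  have child_out: "children x \<subseteq> V - I" if "x \<in> V - I" for x
    using child_notin[OF IJ(1)] that children_eq by auto
  \<comment> \<open>The root is recognised by having \<open>d + 1\<close> children instead of
    \<open>d\<close>.\<close>
  have root_iff: "\<phi> x = v0 \<longleftrightarrow> x = v0" if x: "x \<in> V - I" for x
  proof -
    have "card (children (\<phi> x)) = card (children x)"
      using ch[of x] IJ(5) x card_image[OF inj_on_subset[OF inj child_out[OF x]]] by simp
    then show ?thesis using card_children \<phi>V x by (auto split: if_splits)
  qed
  have map_colour: "\<exists>g. g ` child_colours x = child_colours (\<phi> x) \<and> (\<forall>c\<in>child_colours x. \<phi> (nbr x c) = nbr (\<phi> x) (g c))"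
    if x: "x \<in> V - I" for x
  proof -
    have eq: "\<phi> ` nbr x ` child_colours x = nbr (\<phi> x) ` child_colours (\<phi> x)"
      using ch[of x] IJ(5) x \<phi>V[OF x] by (simp add: children_eq)
    then have "\<forall>c\<in>child_colours x. \<exists>e\<in>child_colours (\<phi> x). \<phi> (nbr x c) = nbr (\<phi> x) e" by blast
    then obtain g where g: "\<And>c. c \<in> child_colours x \<Longrightarrow> g c \<in> child_colours (\<phi> x) \<and> \<phi> (nbr x c) = nbr (\<phi> x) (g c)"
      by metis
    have "e \<in> g ` child_colours x" if e: "e \<in> child_colours (\<phi> x)" for e
    proof -
      obtain c where c: "c \<in> child_colours x" "nbr (\<phi> x) e = \<phi> (nbr x c)" using eq e by blast
      then have "e = g c" using g[OF c(1)] \<phi>V[OF x] e child_coloursD nbr_inj by metis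
      then show ?thesis using c by blast
    qed
    then have "g ` child_colours x = child_colours (\<phi> x)" using g by blast
    then show ?thesis using g by blast
  qed
  have less_iff: "child_less f x (nbr x c) (nbr x e) \<longleftrightarrow>
      (if x = v0 then c < e else f (parent_colour x) c < f (parent_colour x) e)"
    if "x \<in> V" "c \<in> child_colours x" "e \<in> child_colours x" for x c e
  proof -
    have "parent_colour (nbr x c) = c" "parent_colour (nbr x e) = e" using that parent_colour_nbr by blast+
    then show ?thesis by (auto simp: child_less_def)
  qed
  \<comment> \<open>If the forest is the whole tree, the order at the root is the order of colours,
    so the colours of its children are preserved and their labels need no hypothesis at
    leaves.\<close>
  have root_case: "\<phi> (nbr v0 c) = nbr v0 c" if "v0 \<notin> I" and c: "c \<le> d" for c
  proof -
    have v: "v0 \<in> V - I" "\<phi> v0 = v0" using root that root_iff by auto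
    have cc: "child_colours v0 = {0..d}" using root by (simp add: child_colours_eq)
    obtain g where g: "g ` {0..d} = {0..d}" "\<And>c. c \<le> d \<Longrightarrow> \<phi> (nbr v0 c) = nbr v0 (g c)"
      using map_colour[OF v(1)] v(2) cc by auto
    have gle: "g a \<le> d" if "a \<le> d" for a using g(1) that by auto
    have "g c = c"
    proof (rule strict_mono_on_self_id[of "{0..d}"])
      fix a b assume ab: "a \<in> {0..d}" "b \<in> {0..d}" "a < b"
      then have "child_less f v0 (nbr v0 a) (nbr v0 b)" using less_iff[of v0 a b] root cc by simp
      then have "child_less f v0 (nbr v0 (g a)) (nbr v0 (g b))"
        using ord[of v0 "nbr v0 a" "nbr v0 b"] IJ(5) v ab g(2) root cc by (simp add: children_eq)
      then show "g a < g b" using less_iff[of v0 "g a" "g b"] root cc gle ab by simp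
    qed (use g c in auto)
    then show ?thesis using g(2) c by simp
  qed
  have vl: "vloc \<phi> x" if x: "x \<in> V - I" "x \<noteq> v0"
    and orb: "colour_orbit F (parent_colour x) = colour_orbit F (parent_colour (\<phi> x))" for x
  proof -
    let ?a = "parent_colour x" and ?b = "parent_colour (\<phi> x)"
    let ?t = "transfer ?a ?b"
    have y: "\<phi> x \<in> V" "\<phi> x \<noteq> v0" using \<phi>V root_iff x by auto
    have le: "?a \<le> d" "?b \<le> d" using parent_props(6) x y by auto
    obtain g where g: "g ` child_colours x = child_colours (\<phi> x)" "\<And>c. c \<in> child_colours x \<Longrightarrow> \<phi> (nbr x c) = nbr (\<phi> x) (g c)"
      using map_colour[OF x(1)] by blast
    have im: "?t ` child_colours x = child_colours (\<phi> x)"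
      using F_child_colours(1)[OF transfer(1)[OF le] _ x(2) y transfer_ref[OF le orb]] x by blast
    \<comment> \<open>Under \<open>f\<close> both parent colours become the same reference colour,
      so the children on both sides have the same set of normalised colours. The child map becomes a
      strictly increasing self-map of that set, hence the identity.\<close>
    let ?A = "f ?b ` child_colours (\<phi> x)"
    have A: "?A = f ?a ` child_colours x"
      unfolding im[symmetric] image_image using transfer(2)[OF le] child_coloursD by (intro image_cong) auto
    define u where "u = inv_into (child_colours x) (f ?a)"
    have fa_inj: "inj_on (f ?a) (child_colours x)"
      using f_inj[OF le(1)] child_coloursD by (auto simp: inj_on_def)
    have u: "u (f ?a c) = c" if "c \<in> child_colours x" for c
      unfolding u_def using fa_inj that by simp
    have "f ?b (g c) = f ?a c" if c: "c \<in> child_colours x" for c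
    proof -
      have "(\<lambda>m. f ?b (g (u m))) (f ?a c) = f ?a c"
      proof (rule strict_mono_on_self_id[of ?A])
        show "f ?a c \<in> ?A" using A c by simp
        show "(\<lambda>m. f ?b (g (u m))) ` ?A \<subseteq> ?A"
        proof clarify
          fix m e assume "e \<in> child_colours (\<phi> x)"
          then have "f ?b e \<in> f ?a ` child_colours x" using A by blast
          then obtain e' where "e' \<in> child_colours x" "f ?b e = f ?a e'" by blast
          then show "f ?b (g (u (f ?b e))) \<in> ?A" using u g(1) by auto
        qed
        fix m m' assume m: "m \<in> ?A" "m' \<in> ?A" "m < m'"
        then obtain e e' where e: "e \<in> child_colours x" "e' \<in> child_colours x" "m = f ?a e" "m' = f ?a e'"
          unfolding A by blast
        have ge: "g e \<in> child_colours (\<phi> x)" "g e' \<in> child_colours (\<phi> x)" using g(1) e by auto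
        have "child_less f x (nbr x e) (nbr x e')" using less_iff[of x e e'] e m x by simp
        then have "child_less f (\<phi> x) (nbr (\<phi> x) (g e)) (nbr (\<phi> x) (g e'))"
          using ord[of x "nbr x e" "nbr x e'"] IJ(5) x e g(2) by (simp add: children_eq)
        then have "f ?b (g e) < f ?b (g e')" using less_iff[OF y(1) ge] y by simp
        then show "f ?b (g (u m)) < f ?b (g (u m'))" using u e by simp
      qed simp
      then show ?thesis using u c by simp
    qed
    then have "g c = ?t c" if "c \<in> child_colours x" for c
      using that g(1) child_coloursD le by (intro transfer_unique) auto
    then show ?thesis using g(2) x y orb by (simp add: vloc_def)
  qed
  have key: "x \<notin> I \<longrightarrow> x \<noteq> v0 \<longrightarrow> colour_orbit F (parent_colour x) = colour_orbit F (parent_colour (\<phi> x))"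
    if "x \<in> V" for x
    using that
  proof (induction rule: vertex_induct)
    case (child x c)
    show ?case
    proof (intro impI)
      assume n: "nbr x c \<notin> I"
      have cd: "c \<le> d" using child child_coloursD by blast
      show "colour_orbit F (parent_colour (nbr x c)) = colour_orbit F (parent_colour (\<phi> (nbr x c)))"
      proof (cases "x \<in> I")
        case True
        then have b: "nbr x c \<in> border I" using n child parent_nbr cd by (simp add: border_def)
        \<comment> \<open>This excludes the alternative in which the label condition at leaves is
          void.\<close>
        have "T1 \<noteq> {v0}"
        proof
          assume "T1 = {v0}"
          then have "nbr x c = v0" using b IJ(3) by blast
          then show False using child child_neq_root by blast
        qed
        then show ?thesis using lab lv b by (simp add: label_def)
      next
        case nI: False
        show ?thesis
        proof (cases "x = v0")
          case True
          then show ?thesis using root_case nI cd by simp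
        next
          case False
          then have v: "vloc \<phi> x" using vl child nI by blast
          then have "cloc \<phi> x" using vloc_cloc child by blast
          then obtain p where p: "p \<in> F" "p (parent_colour x) = parent_colour (\<phi> x)"
            "\<phi> (nbr x c) = nbr (\<phi> x) (p c)" "\<phi> x \<in> V" "\<phi> x \<noteq> v0"
            using clocE clocD child by metis
          have "p c \<in> child_colours (\<phi> x)"
            using F_child_colours(2)[OF p(1) child.hyps(1) False p(4,5,2)] child by blast
          then show ?thesis using parent_colour_nbr p child orbit_image[OF p(1) cd] by simp
        qed
      qed
    qed
  qed simp
  have vloc: "vloc \<phi> x" if "x \<in> V - insert v0 I" for x using vl key that by blast
  have fin: "finite (insert v0 I)" "finite J" "finite I" using IJ root_closedD by auto
  have ev: "eventually (vloc \<phi>) ends" by (rule eventually_ends_off[OF fin(1) vloc])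
  moreover have "eventually (cloc \<phi>) ends" using ev eventually_in_V by eventually_elim (rule vloc_cloc)
  ultimately show ?thesis using IJ(7) fin unfolding vgerm_def germ_def by blast
qed

lemma vgerm_label_preserving:
  assumes "vgerm \<phi>" shows "\<exists>a\<in>cls \<phi>. a \<in> label_preserving F f"
proof -
  obtain n where n: "n > 0" "\<And>J. root_closed J \<Longrightarrow> ball n \<subseteq> J \<Longrightarrow> riso \<phi> J (V - \<phi> ` (V - J))"
    using germ_riso[of \<phi>] assms by (auto simp: vgerm_def)
  obtain m where m: "m > 0" "\<And>x. x \<in> V - ball m \<Longrightarrow> vloc \<phi> x" using assms by (auto simp: vgerm_def eventually_ends_ball)
  let ?I = "ball (max n m)"
  let ?J = "V - \<phi> ` (V - ?I)"
  have r: "riso \<phi> ?I ?J" using n root_closed_ball ball_mono by simp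
  have vl: "vloc \<phi> x" if "x \<in> V - ?I" for x using m(2)[of x] ball_mono[of m "max n m"] that by auto
  note rD = risoD[OF r]
  note cI = closure_finite_complete[OF rD(1)]
  let ?\<phi> = "restrict \<phi> (V - ?I)"
  let ?a = "(?I \<union> border ?I, ?J \<union> border ?J, ?\<phi>)"
  have a: "?a \<in> cls \<phi>" by (rule riso_in_cls[OF r])
  have child_out: "nbr x c \<in> V - ?I" if "x \<in> V - ?I" "c \<in> child_colours x" for x c
    using child_notin[OF rD(1)] that by blast
  have "?\<phi> ` children x = children (?\<phi> x)" if x: "x \<in> V - ?I" for x
  proof -
    have "?\<phi> ` children x = \<phi> ` children x"
      using child_out[OF x] x by (intro image_cong) (auto simp: children_eq)
    then show ?thesis using cloc_children[of \<phi> x] rD(6) x by simp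
  qed
  moreover have "child_less f (?\<phi> x) (?\<phi> v1) (?\<phi> v2)"
    if x: "x \<in> V - ?I" and v: "v1 \<in> children x" "v2 \<in> children x" "child_less f x v1 v2" for x v1 v2
  proof -
    obtain c1 c2 where c: "c1 \<in> child_colours x" "c2 \<in> child_colours x" "v1 = nbr x c1" "v2 = nbr x c2"
      using v x by (auto simp: children_eq)
    note vx = vl[OF x, unfolded vloc_def]
    let ?a = "parent_colour x" and ?b = "parent_colour (\<phi> x)"
    let ?t = "transfer ?a ?b"
    have le: "?a \<le> d" "?b \<le> d" using parent_props(6) x vx by auto
    have orb: "colour_orbit F ?a = colour_orbit F ?b" using vx by blast
    have t: "?t c \<in> child_colours (\<phi> x)" if "c \<in> child_colours x" for c
      using F_child_colours(2)[OF transfer(1)[OF le] _ _ _ _ transfer_ref[OF le orb] that] x vx by blast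
    have "f ?a c1 < f ?a c2" using v(3) c x vx by (simp add: child_less_def parent_colour_nbr)
    then have "f ?b (?t c1) < f ?b (?t c2)" using transfer(2)[OF le] c child_coloursD by simp
    then have "child_less f (\<phi> x) (nbr (\<phi> x) (?t c1)) (nbr (\<phi> x) (?t c2))"
      using vx t c by (simp add: child_less_def parent_colour_nbr)
    then show ?thesis using vx c x child_out by simp
  qed
  moreover have "label F v = label F (?\<phi> v)" if "v \<in> border ?I" for v
  proof -
    have "v \<in> V - ?I" using that by (simp add: border_def)
    then show ?thesis using vl[of v] by (simp add: label_def vloc_def)
  qed
  ultimately have "?a \<in> label_preserving F f"
    using a cI unfolding label_preserving_def cls_iff by simp
  then show ?thesis using a by blast
qed

section \<open>The subgroup V_F and surjectivity onto the abelianization\<close>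

lemma carrier_VF: "carrier (VF F f) = cls ` Collect vgerm"
proof
  show "carrier (VF F f) \<subseteq> cls ` Collect vgerm"
  proof
    fix A assume "A \<in> carrier (VF F f)"
    then obtain T1 T2 \<phi> where a: "A \<in> carrier AAut" "(T1, T2, \<phi>) \<in> A" "(T1, T2, \<phi>) \<in> label_preserving F f"
      by (auto simp: VF_def)
    then show "A \<in> cls ` Collect vgerm" using class_with_member label_preserving_vloc by blast
  qed
  show "cls ` Collect vgerm \<subseteq> carrier (VF F f)"
    using vgerm_label_preserving cls_in_AAut by (auto simp: VF_def vgerm_def)
qed

lemma VF_eq: "VF F f = (NF F)\<lparr>carrier := cls ` Collect vgerm\<rparr>"
  using carrier_VF by (simp add: VF_def)

lemma VF_subgroup: "subgroup (cls ` Collect vgerm) (NF F)"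
proof (rule N.subgroupI)
  show "cls ` Collect vgerm \<subseteq> carrier (NF F)" by (auto simp: vgerm_def)
  have "vgerm (\<lambda>x. x)"
  proof -
    have "vloc (\<lambda>x. x) x" if x: "x \<in> V - {v0}" for x
    proof -
      have "parent_colour x \<le> d" using x parent_props(6) by blast
      then have "transfer (parent_colour x) (parent_colour x) c = c" if "c \<le> d" for c
        using transfer_unique that by metis
      then show ?thesis using x child_coloursD by (simp add: vloc_def)
    qed
    then have "eventually (vloc (\<lambda>x. x)) ends" by (intro eventually_ends_off[of "{v0}"]) auto
    then show ?thesis using germ_id by (simp add: vgerm_def)
  qed
  then show "cls ` Collect vgerm \<noteq> {}" by blast
  fix A assume "A \<in> cls ` Collect vgerm"
  then obtain \<phi> where \<phi>: "vgerm \<phi>" "A = cls \<phi>" by blast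
  obtain \<psi> where \<psi>: "vgerm \<psi>" "\<forall>\<^sub>F x in ends. \<psi> (\<phi> x) = x" by (rule vgerm_inverse[OF \<phi>(1)])
  then have "inv\<^bsub>NF F\<^esub> A = cls \<psi>" using \<phi> inv_cls by (simp add: vgerm_def)
  then show "inv\<^bsub>NF F\<^esub> A \<in> cls ` Collect vgerm" using \<psi> by blast
  fix B assume "B \<in> cls ` Collect vgerm"
  then obtain \<theta> where \<theta>: "vgerm \<theta>" "B = cls \<theta>" by blast
  then have "A \<otimes>\<^bsub>NF F\<^esub> B = cls (\<phi> \<circ> \<theta>)" using \<phi> mult_cls by (simp add: vgerm_def)
  then show "A \<otimes>\<^bsub>NF F\<^esub> B \<in> cls ` Collect vgerm" using vgerm_comp \<phi> \<theta> by blast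
qed

text \<open>Correct \<open>\<phi>\<close> by an automorphism \<open>k\<close> fixing the leaves of the image tree: below each leaf,
  \<open>k\<close> is chosen step by step so that \<open>k \<circ> \<phi>\<close> has the local actions of a label-preserving map.\<close>

lemma NF_eq_DN_VF:
  assumes "germ \<phi>"
  shows "\<exists>\<psi>. vgerm \<psi> \<and> (\<exists>x\<in>DN. cls \<phi> = x \<otimes>\<^bsub>NF F\<^esub> cls \<psi>)"
proof -
  obtain I J where r: "riso \<phi> I J" by (rule germ_riso_ex[OF assms])
  note rD = risoD[OF r]
  define \<phi>' where "\<phi>' = inv_into (V - I) \<phi>"
  have \<phi>': "\<phi>' x \<in> V - I" "\<phi> (\<phi>' x) = x" if "x \<in> V - J" for x
    using bij_betwE[OF bij_betw_inv_into[OF rD(5)]] bij_betw_inv_into_right[OF rD(5)] that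
    unfolding \<phi>'_def by blast+
  have \<phi>'\<phi>: "\<phi>' (\<phi> z) = z" if "z \<in> V - I" for z
    unfolding \<phi>'_def using bij_betw_inv_into_left[OF rD(5) that] .
  have "\<forall>z\<in>V - I. \<exists>p\<in>F. p (parent_colour z) = parent_colour (\<phi> z) \<and>
      (\<forall>c\<in>child_colours z. \<phi> (nbr z c) = nbr (\<phi> z) (p c))"
    using rD(6) by (auto simp: cloc_def)
  then obtain q where q: "\<And>z. z \<in> V - I \<Longrightarrow> q z \<in> F \<and> q z (parent_colour z) = parent_colour (\<phi> z) \<and>
      (\<forall>c\<in>child_colours z. \<phi> (nbr z c) = nbr (\<phi> z) (q z c))" by metis
  have "\<forall>z\<in>V - I. \<exists>p\<in>F. \<forall>c\<le>d. p (q z c) = c"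
    using q F_inv by metis
  then obtain qi where qi: "\<And>z. z \<in> V - I \<Longrightarrow> qi z \<in> F \<and> (\<forall>c\<le>d. qi z (q z c) = c)" by metis
  \<comment> \<open>For \<open>x = \<phi> w\<close> the correction undoes the local action of
    \<open>\<phi>\<close> at \<open>w\<close> and then applies the transfer. The image
    \<open>y\<close> of \<open>x\<close> enters because the transfer depends on its parent
    colour.\<close>
  define \<sigma> where "\<sigma> x y = (if x \<in> J then (\<lambda>c\<in>{0..d}. c)
      else compose {0..d} (transfer (parent_colour (\<phi>' x)) (parent_colour y)) (qi (\<phi>' x)))" for x y
  \<comment> \<open>The invariant fixes the tree pointwise and keeps labels; equality of labels is
    what makes the next transfer match parent colours.\<close>
  define P where "P x y \<longleftrightarrow> (x \<noteq> v0 \<longrightarrow> y \<noteq> v0 \<and> colour_orbit F (parent_colour x) = colour_orbit F (parent_colour y)) \<and>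
      (x \<in> J \<union> border J \<longrightarrow> y = x)" for x y
  have z: "\<phi>' x \<in> V - I" "\<phi>' x \<noteq> v0" "parent_colour (\<phi>' x) \<le> d" "x \<noteq> v0" "parent_colour x \<le> d"
    "q (\<phi>' x) (parent_colour (\<phi>' x)) = parent_colour x"
    "colour_orbit F (parent_colour (\<phi>' x)) = colour_orbit F (parent_colour x)" if x: "x \<in> V - J" for x
  proof -
    show 1: "\<phi>' x \<in> V - I" using \<phi>' x by blast
    show 2: "\<phi>' x \<noteq> v0" using 1 rD(3) by auto
    show 3: "parent_colour (\<phi>' x) \<le> d" using 1 2 parent_props(6) by blast
    show "x \<noteq> v0" using x rD(4) by auto
    then show "parent_colour x \<le> d" using x parent_props(6) by blast
    show 4: "q (\<phi>' x) (parent_colour (\<phi>' x)) = parent_colour x" using q[OF 1] \<phi>'(2)[OF x] by simp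
    show "colour_orbit F (parent_colour (\<phi>' x)) = colour_orbit F (parent_colour x)"
      using orbit_image[of "q (\<phi>' x)" "parent_colour (\<phi>' x)"] q[OF 1] 3 4 by simp
  qed
  have \<sigma>F: "\<sigma> x y \<in> F" if "x \<in> V" "y \<in> V" "P x y" for x y
  proof (cases "x \<in> J")
    case False
    then have "parent_colour y \<le> d" using that z(4)[of x] parent_props(6)[of y] by (auto simp: P_def)
    then show ?thesis using False that z(1,3)[of x] qi F_comp transfer(1) by (simp add: \<sigma>_def)
  qed (simp add: \<sigma>_def F_id)
  \<comment> \<open>This is the consistency along edges: undoing \<open>\<phi>\<close> gives the
    parent colour of \<open>\<phi>' x\<close>, and the transfer sends that to the parent colour of
    \<open>y\<close>.\<close>
  have \<sigma>_parent: "\<sigma> x y (parent_colour x) = parent_colour y"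
    if x: "x \<in> V - J" and y: "y \<in> V" "y \<noteq> v0" "colour_orbit F (parent_colour x) = colour_orbit F (parent_colour y)" for x y
  proof -
    have "qi (\<phi>' x) (parent_colour x) = parent_colour (\<phi>' x)" using qi[OF z(1)[OF x]] z(3,6)[OF x] by metis
    then show ?thesis
      using x y z(3,5,7)[OF x] transfer_ref parent_props(6)[OF y(1,2)] by (simp add: \<sigma>_def compose_def)
  qed
  have step: "P (nbr x c) (nbr y (\<sigma> x y c)) \<and> \<sigma> (nbr x c) (nbr y (\<sigma> x y c)) c = \<sigma> x y c"
    if x: "x \<in> V" and y: "y \<in> V" and Pxy: "P x y" and c: "c \<in> child_colours x" for x y c
  proof -
    let ?x = "nbr x c" and ?y = "nbr y (\<sigma> x y c)"
    have cd: "c \<le> d" using c child_coloursD by blast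
    have x': "?x \<in> V" "?x \<noteq> v0" "parent_colour ?x = c" "parent ?x = x"
      using x c cd child_neq_root parent_colour_nbr parent_nbr by auto
    show ?thesis
    proof (cases "x \<in> J")
      case True
      then have e: "?y = ?x" "\<sigma> x y c = c" using Pxy cd by (auto simp: \<sigma>_def P_def)
      have "\<sigma> ?x ?x c = c"
      proof (cases "?x \<in> J")
        case False
        then show ?thesis using \<sigma>_parent[of ?x ?x] x' by simp
      qed (simp add: \<sigma>_def cd)
      then show ?thesis using e x' by (simp add: P_def)
    next
      case False
      have xn: "x \<noteq> v0" using False rD(4) by auto
      have yn: "y \<noteq> v0" "colour_orbit F (parent_colour x) = colour_orbit F (parent_colour y)"
        using Pxy xn by (auto simp: P_def)
      have s: "\<sigma> x y \<in> F" "\<sigma> x y (parent_colour x) = parent_colour y"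
        using \<sigma>F \<sigma>_parent x y Pxy False yn by auto
      have e: "\<sigma> x y c \<in> child_colours y"
        using F_child_colours(2)[OF s(1) x xn y yn(1) s(2) c] .
      have y': "?y \<in> V" "?y \<noteq> v0" "parent_colour ?y = \<sigma> x y c"
        using e y child_coloursD child_neq_root parent_colour_nbr by auto
      have orb: "colour_orbit F (parent_colour ?x) = colour_orbit F (parent_colour ?y)"
        using orbit_image[OF s(1) cd] x' y' by simp
      have xJ: "?x \<in> V - J" using child_notin[OF rD(2) x False c] .
      moreover have "?x \<notin> border J" using x' False by (simp add: border_def)
      ultimately have "P ?x ?y" using y' orb by (simp add: P_def)
      moreover have "\<sigma> ?x ?y c = \<sigma> x y c" using \<sigma>_parent[OF xJ y'(1,2) orb] x' y' by simp
      ultimately show ?thesis by blast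
    qed
  qed
  have "P v0 v0" "v0 \<in> V" using root by (simp_all add: P_def)
  have "\<exists>k. bij_betw k V V \<and> (\<forall>x\<in>V. P x (k x)) \<and> (\<forall>x\<in>V. \<forall>c\<le>d. k (nbr x c) = nbr (k x) (\<sigma> x (k x) c))"
  proof (rule local_data_extends[of v0 P \<sigma>])
    show "v0 \<in> V" "P v0 v0" by fact+
    show "bij_betw (\<sigma> x y) {0..d} {0..d}" if "x \<in> V" "y \<in> V" "P x y" for x y
      using F_bij[OF \<sigma>F[OF that]] .
    show "P (nbr x c) (nbr y (\<sigma> x y c)) \<and> \<sigma> (nbr x c) (nbr y (\<sigma> x y c)) c = \<sigma> x y c"
      if "x \<in> V" "y \<in> V" "P x y" "c \<in> child_colours x" for x y c
      using step[OF that] .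
  qed blast
  then obtain k where k: "bij_betw k V V" "\<And>x. x \<in> V \<Longrightarrow> P x (k x)"
    "\<And>x c. x \<in> V \<Longrightarrow> c \<le> d \<Longrightarrow> k (nbr x c) = nbr (k x) (\<sigma> x (k x) c)"
    by blast
  have kV: "k x \<in> V" if "x \<in> V" for x using bij_betwE[OF k(1)] that by blast
  have Fk: "F_automorphism k"
    unfolding F_automorphism_def acts_as_def using kV \<sigma>F k(2,3) by blast
  have k_fix: "k x = x" if "x \<in> J \<union> border J" for x
    using k(2)[of x] that root_closedD(2)[OF rD(2)] by (auto simp: P_def border_def)
  have kD: "cls k \<in> DN"
    using k_fix rD(2,4) border_nbr by (intro ball_fixator_in_DN[OF Fk]) auto
  let ?\<psi> = "k \<circ> \<phi>"
  have g: "germ k" "germ \<phi>" "germ ?\<psi>" using F_automorphism_germ[OF Fk] assms germ_comp by auto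
  have "vloc ?\<psi> w" if w: "w \<in> V - I" for w
  proof -
    have x: "\<phi> w \<in> V - J" using rD(7) w by blast
    have e: "\<phi>' (\<phi> w) = w" using \<phi>'\<phi> w by blast
    note zx = z[OF x, unfolded e]
    have y: "k (\<phi> w) \<in> V" "k (\<phi> w) \<noteq> v0" "colour_orbit F (parent_colour (\<phi> w)) = colour_orbit F (parent_colour (k (\<phi> w)))"
      using kV x k(2)[of "\<phi> w"] zx(4) by (auto simp: P_def)
    have "k (\<phi> (nbr w c)) = nbr (k (\<phi> w)) (transfer (parent_colour w) (parent_colour (k (\<phi> w))) c)"
      if c: "c \<in> child_colours w" for c
    proof -
      have cd: "c \<le> d" using c child_coloursD by blast
      have qc: "q w c \<le> d" using q[OF w] F_le cd by blast
      have "k (\<phi> (nbr w c)) = nbr (k (\<phi> w)) (\<sigma> (\<phi> w) (k (\<phi> w)) (q w c))"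
        using q[OF w] c k(3)[of "\<phi> w" "q w c"] x qc by simp
      \<comment> \<open>The factor \<open>qi w\<close> cancels \<open>q w\<close>, leaving exactly
        the transfer required by \<open>vloc\<close>.\<close>
      moreover have "\<sigma> (\<phi> w) (k (\<phi> w)) (q w c) = transfer (parent_colour w) (parent_colour (k (\<phi> w))) c"
        using x e qc qi[OF w] cd by (simp add: \<sigma>_def compose_def)
      ultimately show ?thesis by simp
    qed
    then show ?thesis using zx y by (simp add: vloc_def)
  qed
  then have "eventually (vloc ?\<psi>) ends"
    using root_closedD(1)[OF rD(1)] by (intro eventually_ends_off[of I]) auto
  then have "vgerm ?\<psi>" using g by (simp add: vgerm_def)
  moreover have "cls \<phi> = inv\<^bsub>NF F\<^esub> (cls k) \<otimes>\<^bsub>NF F\<^esub> cls ?\<psi>"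
    using g N.inv_solve_left[of "cls \<phi>" "cls k" "cls ?\<psi>"] by (simp add: mult_cls)
  moreover have "inv\<^bsub>NF F\<^esub> (cls k) \<in> DN" using kD subgroup.m_inv_closed[OF DN_subgroup] by blast
  ultimately show ?thesis by blast
qed

lemma abelianization_of_NF:
  "(\<forall>\<tau>. NF_topology F \<tau> \<longrightarrow> openin \<tau> DN) \<and> finite (rcosets\<^bsub>NF F\<^esub> DN) \<and>
   (\<exists>h. h \<in> epi (VF F f Mod commutator_subgroup (VF F f)) (NF F Mod DN) \<and>
     (\<forall>\<phi>\<in>carrier (VF F f). h (commutator_subgroup (VF F f) #>\<^bsub>VF F f\<^esub> \<phi>) = DN #>\<^bsub>NF F\<^esub> \<phi>))"
proof (intro conjI)
  show "\<forall>\<tau>. NF_topology F \<tau> \<longrightarrow> openin \<tau> DN" using DN_open by blast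
  show "finite (rcosets\<^bsub>NF F\<^esub> DN)" by (rule finite_index_DN)
  show "\<exists>h. h \<in> epi (VF F f Mod commutator_subgroup (VF F f)) (NF F Mod DN) \<and>
     (\<forall>\<phi>\<in>carrier (VF F f). h (commutator_subgroup (VF F f) #>\<^bsub>VF F f\<^esub> \<phi>) = DN #>\<^bsub>NF F\<^esub> \<phi>)"
    unfolding VF_eq
  proof (rule N.derived_quotient_epi[OF VF_subgroup])
    fix A assume "A \<in> carrier (NF F)"
    then obtain \<phi> where \<phi>: "germ \<phi>" "A = cls \<phi>" by (auto simp: carrier_NF)
    then show "\<exists>w\<in>cls ` Collect vgerm. \<exists>x\<in>DN. A = x \<otimes>\<^bsub>NF F\<^esub> w" using NF_eq_DN_VF[OF \<phi>(1)] by blast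
  qed
qed

end

theorem theorem4p11:
  fixes V :: "'v set" and E :: "('v \<times> 'v) set" and v0 :: 'v and d :: nat
    and col :: "'v \<times> 'v \<Rightarrow> nat"
    and F :: "(nat \<Rightarrow> nat) set" and r :: "nat set \<Rightarrow> nat" and f :: "nat \<Rightarrow> nat \<Rightarrow> nat"
  assumes "d \<ge> 2"
    and "legally_coloured_tree V E v0 d col"
    and "subgroup F (BijGroup {0..d})"
    and "legally_coloured_tree.reference_choice d F r f"
  shows
    "let N = legally_coloured_tree.NF V E v0 d col F;
         W = legally_coloured_tree.VF V E v0 d col F f;
         DN = commutator_subgroup N;
         DW = commutator_subgroup W
     in (\<forall>\<tau>. legally_coloured_tree.NF_topology V E v0 d col F \<tau> \<longrightarrow> openin \<tau> DN) \<and>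
        finite (rcosets\<^bsub>N\<^esub> DN) \<and>
        (\<exists>h. h \<in> epi (W Mod DW) (N Mod DN) \<and>
             (\<forall>\<phi>\<in>carrier W. h (DW #>\<^bsub>W\<^esub> \<phi>) = DN #>\<^bsub>N\<^esub> \<phi>))"
proof -
  interpret T: legally_coloured_tree V E v0 d col by (rule assms(2))
  interpret R: reference_neretin V E v0 d col F r f
    using assms
    by (intro reference_neretin.intro coloured_neretin.intro coloured_neretin_axioms.intro reference_neretin_axioms.intro)
  show ?thesis unfolding Let_def by (rule R.abelianization_of_NF)
qed

end
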